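(* Let $n\geq2$. Then there exists an $n$-dimensional $\Theta$-network $\bar{\Gamma}\in\Theta(\mathbf{R}^n)$ such that $$E[\bar{\Gamma}]=\inf_{\Gamma\in\Theta(\mathbf{R}^n)}E[\Gamma].$$
   Context: Let $I=(0,1)$; $H^2=W^{2,2}$, $H^2(I)\hookrightarrow C^1(\bar I)$, and a curve is immersed if $\gamma'\neq0$ on $\bar I$. An ($n$-dimensional) $\Theta$-network is a triplet of immersed $H^2$-curves $\Gamma=(\gamma_1,\gamma_2,\gamma_3)\in(H^2(I;\mathbf{R}^n))^3$ such that $\gamma_1(0)=\gamma_2(0)=\gamma_3(0)$, $\gamma_1(1)=\gamma_2(1)=\gamma_3(1)$, and the curves meet at these two triple junctions with equal angles $\frac{2\pi}{3}$ (i.e. at each of the endpoints $0$ and $1$ the three unit tangent vectors $\gamma_i'/|\gamma_i'|$ pairwise make the angle $\frac{2\pi}{3}$). $\Theta(\mathbf{R}^n)$ is the class of all $n$-dimensional $\Theta$-networks. The energy is $$E[\Gamma] := \sum_{i=1}^3\int_{\gamma_i}(|\kappa|^2+1)\,ds,$$ where $ds$ is the arclength element and $\kappa=\partial_s^2\gamma_i$ is the curvature vector, $\partial_s=\frac{1}{|\gamma_i'|}\partial_x$. *)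

theory Defs
  imports "HOL-Analysis.Analysis"
begin

abbreviation I01 :: "real set" where
  "I01 \<equiv> {0<..<1}"

definition test_function :: "(real \<Rightarrow> real) \<Rightarrow> bool" where
  "test_function \<phi> \<longleftrightarrow>
     (\<forall>k x. (deriv ^^ k) \<phi> field_differentiable (at x)) \<and>
     compact (closure {x. \<phi> x \<noteq> 0}) \<and> closure {x. \<phi> x \<noteq> 0} \<subseteq> I01"

definition locally_integrable :: "(real \<Rightarrow> 'a::euclidean_space) \<Rightarrow> bool" where
  "locally_integrable f \<longleftrightarrow>
     (\<forall>K. compact K \<longrightarrow> K \<subseteq> I01 \<longrightarrow> f absolutely_integrable_on K)"

definition has_weak_deriv ::
  "nat \<Rightarrow> (real \<Rightarrow> 'a::euclidean_space) \<Rightarrow> (real \<Rightarrow> 'a) \<Rightarrow> bool" where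
  "has_weak_deriv k f g \<longleftrightarrow>
     locally_integrable f \<and> locally_integrable g \<and>
     (\<forall>\<phi>. test_function \<phi> \<longrightarrow>
        (LINT x:I01|lebesgue. (deriv ^^ k) \<phi> x *\<^sub>R f x)
          = (-1) ^ k *\<^sub>R (LINT x:I01|lebesgue. \<phi> x *\<^sub>R g x))"

definition weak_derivative :: "(real \<Rightarrow> 'a::euclidean_space) \<Rightarrow> real \<Rightarrow> 'a" where
  "weak_derivative f = (SOME g. has_weak_deriv 1 f g)"

definition L2 :: "(real \<Rightarrow> 'a::euclidean_space) \<Rightarrow> bool" where
  "L2 f \<longleftrightarrow> f \<in> borel_measurable (lebesgue_on I01) \<and>
     (\<lambda>x. (norm (f x))\<^sup>2) absolutely_integrable_on I01"

definition W22 :: "(real \<Rightarrow> 'a::euclidean_space) \<Rightarrow> bool" where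
  "W22 f \<longleftrightarrow> L2 f \<and> (\<forall>k\<in>{1, 2}. \<exists>g. L2 g \<and> has_weak_deriv k f g)"

text \<open>
  Curves are functions on the real line of which only the values on \<open>{0..1}\<close> matter.
  The velocity is the classical derivative, one-sided at the endpoints.
\<close>
definition velocity :: "(real \<Rightarrow> 'a::euclidean_space) \<Rightarrow> real \<Rightarrow> 'a" where
  "velocity \<gamma> x = vector_derivative \<gamma> (at x within {0..1})"

text \<open>
  An element of \<open>H\<^sup>2\<close> is an a.e.-class of functions; by the embedding into
  \<open>C\<^sup>1\<close> of the closed interval it has exactly one representative (on \<open>{0..1}\<close>) that is
  continuously differentiable up to the boundary, and a curve is this representative.
\<close>
definition H2_curve :: "(real \<Rightarrow> 'a::euclidean_space) \<Rightarrow> bool" where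
  "H2_curve \<gamma> \<longleftrightarrow>
     W22 \<gamma> \<and> \<gamma> differentiable_on {0..1} \<and> continuous_on {0..1} (velocity \<gamma>)"

definition immersed :: "(real \<Rightarrow> 'a::euclidean_space) \<Rightarrow> bool" where
  "immersed \<gamma> \<longleftrightarrow> (\<forall>x\<in>{0..1}. velocity \<gamma> x \<noteq> 0)"

definition unit_tangent :: "(real \<Rightarrow> 'a::euclidean_space) \<Rightarrow> real \<Rightarrow> 'a" where
  "unit_tangent \<gamma> x = velocity \<gamma> x /\<^sub>R norm (velocity \<gamma> x)"

definition angle :: "'a::euclidean_space \<Rightarrow> 'a \<Rightarrow> real" where
  "angle u v = arccos (u \<bullet> v / (norm u * norm v))"

definition Theta_networks :: "(3 \<Rightarrow> real \<Rightarrow> real ^ 'n) set" where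
  "Theta_networks = {\<Gamma>.
     (\<forall>i. H2_curve (\<Gamma> i) \<and> immersed (\<Gamma> i)) \<and>
     (\<forall>x\<in>{0, 1}. \<forall>i j. \<Gamma> i x = \<Gamma> j x) \<and>
     (\<forall>x\<in>{0, 1}. \<forall>i j. i \<noteq> j \<longrightarrow>
        angle (unit_tangent (\<Gamma> i) x) (unit_tangent (\<Gamma> j) x) = 2 * pi / 3)}"

text \<open>
  The operator \<open>\<partial>\<^sub>s\<close> along \<open>\<gamma>\<close>; the derivative in the parameter is the weak one, so the
  result is determined only almost everywhere.
\<close>
definition arclength_deriv ::
  "(real \<Rightarrow> 'a::euclidean_space) \<Rightarrow> (real \<Rightarrow> 'a) \<Rightarrow> real \<Rightarrow> 'a" where
  "arclength_deriv \<gamma> f x = weak_derivative f x /\<^sub>R norm (velocity \<gamma> x)"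

definition curvature :: "(real \<Rightarrow> 'a::euclidean_space) \<Rightarrow> real \<Rightarrow> 'a" where
  "curvature \<gamma> = arclength_deriv \<gamma> (arclength_deriv \<gamma> \<gamma>)"

text \<open>
  The arclength element is \<open>ds = \<bar>\<gamma>'\<bar> dx\<close>. The integrand is nonnegative, so the energy is taken as
  an element of \<open>[0, \<infinity>]\<close>; this avoids the value \<open>0\<close> that the Bochner integral assigns to
  non-integrable functions. For immersed \<open>H\<^sup>2\<close>-curves it is finite.
\<close>
definition energy :: "(3 \<Rightarrow> real \<Rightarrow> real ^ 'n) \<Rightarrow> ennreal" where
  "energy \<Gamma> = (\<Sum>i\<in>UNIV. \<integral>\<^sup>+ x.
     ennreal (((norm (curvature (\<Gamma> i) x))\<^sup>2 + 1) * norm (velocity (\<Gamma> i) x))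
       \<partial>(lebesgue_on I01))"

end

theory Submission
  imports Defs "HOL-Complex_Analysis.Great_Picard" "HOL-Computational_Algebra.Polynomial"
begin

text \<open>
  After reparametrisation by arclength a network is a triple of unit tangent curves
  \<open>\<tau>\<^sub>i : [0, 1] \<rightarrow> S\<^bsup>n-1\<^esup>\<close> and lengths \<open>L\<^sub>i > 0\<close> with equal displacements
  \<open>L\<^sub>i \<integral>\<tau>\<^sub>i\<close>, and its energy is \<open>\<Sum>\<^sub>i (L\<^sub>i\<^sup>-\<^sup>1 \<integral>|\<tau>\<^sub>i'|\<^sup>2 + L\<^sub>i)\<close>. The Dirichlet integral is recovered
  from finite difference quotients (F. Riesz), which makes it lower semicontinuous under pointwise convergence,
  so along a minimising sequence the Arzela--Ascoli theorem yields a limit. The limit is a network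
  unless some \<open>L\<^sub>i\<close> tends to \<open>0\<close>; then \<open>\<tau>\<^sub>i\<close> becomes constant, the angle condition forbids a
  second curve to shrink, and the two other curves become loops. A loop has energy at least \<open>3\<pi>\<close>, whereas the
  standard double bubble has energy \<open>16\<pi>/3 + \<surd>3 < 6\<pi>\<close>, so a minimising sequence does not degenerate.
\<close>

text \<open>Keeping the interval [0,1] fixed and the length L separate from the tangent makes the
  admissible class closed under pointwise limits. The Dirichlet integral enters through a number C
  that bounds all dyadic energies: each of these is a finite sum of squared increments, so lower
  semicontinuity is the passage of inequalities to the limit, and Riesz's criterion restores a
  genuine derivative afterwards. Since \<open>weak_derivative\<close> is an arbitrary choice, the
  lemma of du Bois-Reymond is what ties \<open>curvature\<close> to the unit tangent. The obstacle
  is the narrow margin between the double bubble, about 18.49, and 6 pi, about 18.85. By AM-GM two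
  loops cost at least 4 sqrt C, so C has to exceed about 21.4. That a loop has total curvature at
  least pi only gives C >= pi^2 and the useless total 4 pi. The closing condition has to be used in
  the mean along the whole loop, and this gives C >= 9 pi^2 / 4, about 22.2.\<close>

section \<open>Cauchy-Schwarz, fast convergence in L1, and equipartitions\<close>

lemma square_le_mult_of_weighted_AM_GM:
  fixes I W Q :: real
  assumes "0 \<le> W" "0 \<le> Q" "\<And>l. l > 0 \<Longrightarrow> 2 * \<bar>I\<bar> \<le> l * W + Q / l"
  shows "I\<^sup>2 \<le> W * Q"
proof (rule field_le_epsilon)
  have *: "I\<^sup>2 \<le> (W + e) * (Q + e)" if "e > 0" for e
  proof -
    \<comment> \<open>The optimal weight would be sqrt (Q / W); raising both numbers by e keeps it
      meaningful when W or Q vanishes, and e is sent to 0 at the end.\<close>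
    define l where "l = sqrt ((Q + e) / (W + e))"
    have pos: "W + e > 0" "Q + e > 0" using assms that by auto
    then have l: "l > 0" by (simp add: l_def)
    have l2: "l * l = (Q + e) / (W + e)" using pos by (simp add: l_def)
    have "2 * \<bar>I\<bar> \<le> l * W + Q / l" using assms(3) l by blast
    also have "\<dots> \<le> l * (W + e) + (Q + e) / l"
      using l that by (intro add_mono mult_left_mono divide_right_mono) auto
    also have "(Q + e) / l = l * (W + e)"
      using l l2 pos by (simp add: field_simps)
    finally have "\<bar>I\<bar> \<le> l * (W + e)" by simp
    then have "\<bar>I\<bar>\<^sup>2 \<le> (l * (W + e))\<^sup>2" by (intro power_mono) auto
    also have "\<dots> = (l * l) * (W + e) * (W + e)" by (simp add: power2_eq_square mult_ac)
    also have "\<dots> = (W + e) * (Q + e)" using l2 pos by (simp add: field_simps)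
    finally show ?thesis by simp
  qed
  fix e :: real assume e: "e > 0"
  define d where "d = min 1 (e / (W + Q + 1))"
  have d: "d > 0" "d \<le> 1" "d * (W + Q + 1) \<le> e"
  proof -
    show "d > 0" "d \<le> 1" using e assms by (auto simp: d_def)
    have "d \<le> e / (W + Q + 1)" by (simp add: d_def)
    then show "d * (W + Q + 1) \<le> e" using assms by (simp add: field_simps)
  qed
  have "I\<^sup>2 \<le> (W + d) * (Q + d)" using * d by blast
  also have "\<dots> = W * Q + d * (W + Q + d)" by (simp add: algebra_simps)
  also have "\<dots> \<le> W * Q + d * (W + Q + 1)" using d by (intro add_left_mono mult_left_mono) auto
  finally show "I\<^sup>2 \<le> W * Q + e" using d by linarith
qed

text \<open>The three-function form asks for a pointwise bound instead of a product of square roots.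
  It covers the weights needed later: the constant 1, the speed of a curve, and a cosine.\<close>

lemma integral_Cauchy_Schwarz:
  fixes f w q :: "'a::euclidean_space \<Rightarrow> real"
  assumes f: "f integrable_on S" and w: "w integrable_on S" and q: "q integrable_on S"
    and nonneg: "\<And>x. x \<in> S \<Longrightarrow> 0 \<le> w x" "\<And>x. x \<in> S \<Longrightarrow> 0 \<le> q x"
    and le: "\<And>x. x \<in> S \<Longrightarrow> (f x)\<^sup>2 \<le> w x * q x"
  shows "(integral S f)\<^sup>2 \<le> integral S w * integral S q"
proof (rule square_le_mult_of_weighted_AM_GM)
  show "0 \<le> integral S w" "0 \<le> integral S q"
    using nonneg by (auto intro: integral_nonneg w q)
  fix l :: real assume l: "l > 0"
  have *: "2 * \<bar>f x\<bar> \<le> l * w x + q x / l" if "x \<in> S" for x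
  proof -
    have "(2 * \<bar>f x\<bar>)\<^sup>2 \<le> 4 * (w x * q x)" using le[OF that] by (simp add: power_mult_distrib)
    also have "\<dots> = 4 * ((l * w x) * (q x / l))" using l by simp
    also have "\<dots> \<le> (l * w x + q x / l)\<^sup>2"
      using sum_squares_bound[of "l * w x" "q x / l"] l by (simp add: power2_sum mult_ac)
    finally show ?thesis
      by (rule power2_le_imp_le) (use l nonneg[OF that] in auto)
  qed
  have int: "(\<lambda>x. l * w x + q x / l) integrable_on S"
    using w q by (intro integrable_add integrable_on_divide) (auto intro: integrable_on_mult_right)
  have I: "integral S (\<lambda>x. l * w x + q x / l) = l * integral S w + integral S q / l"
    using w q by (subst integral_add) (auto intro: integrable_on_divide integrable_on_mult_right)
  have "2 * integral S f \<le> integral S (\<lambda>x. l * w x + q x / l)"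
    unfolding integral_mult_right[symmetric]
    using * f int by (intro integral_le) (auto intro!: integrable_on_mult_right, force)
  moreover have "2 * (- integral S f) \<le> integral S (\<lambda>x. l * w x + q x / l)"
    unfolding integral_mult_right[symmetric] integral_neg[symmetric]
    using * f int by (intro integral_le) (auto intro!: integrable_on_mult_right integrable_neg, force)
  ultimately show "2 * \<bar>integral S f\<bar> \<le> l * integral S w + integral S q / l"
    unfolding I by linarith
qed

text \<open>Riesz-Fischer for a sequence with summable increments: the series of their norms
  converges almost everywhere to an integrable function, which dominates all the errors. One
  sequence thus converges both pointwise and in the mean.\<close>

lemma L1_fast_Cauchy_limit:
  fixes f :: "nat \<Rightarrow> 'a \<Rightarrow> 'b::{banach, second_countable_topology}"
  assumes f [measurable]: "\<And>i. integrable M (f i)"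
    and le: "\<And>i. (\<integral>x. norm (f (Suc i) x - f i x) \<partial>M) \<le> (1/2) ^ i"
  obtains g where "integrable M g" "AE x in M. (\<lambda>i. f i x) \<longlonglongrightarrow> g x"
    "(\<lambda>i. \<integral>x. norm (f i x - g x) \<partial>M) \<longlonglongrightarrow> 0"
proof -
  define u where "u i x = f (Suc i) x - f i x" for i x
  have u: "integrable M (u i)" for i unfolding u_def by (intro Bochner_Integration.integrable_diff f)
  have um [measurable]: "u i \<in> borel_measurable M" for i using u by auto
  have sI: "summable (\<lambda>i. \<integral>x. norm (u i x) \<partial>M)"
  proof (rule summable_comparison_test')
    show "summable (\<lambda>i. (1/2::real) ^ i)" by (rule summable_geometric) simp
    show "norm (\<integral>x. norm (u i x) \<partial>M) \<le> (1/2) ^ i" if "i \<ge> 0" for i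
      using le[of i] by (simp add: u_def)
  qed
  have "(\<integral>\<^sup>+x. (\<Sum>i. ennreal (norm (u i x))) \<partial>M) = (\<Sum>i. \<integral>\<^sup>+x. ennreal (norm (u i x)) \<partial>M)"
    by (intro nn_integral_suminf) measurable
  also have "\<dots> = (\<Sum>i. ennreal (\<integral>x. norm (u i x) \<partial>M))"
    using u by (intro suminf_cong nn_integral_eq_integral) auto
  also have "\<dots> < \<infinity>"
    using sI by (subst suminf_ennreal2) auto
  finally have "(\<integral>\<^sup>+x. (\<Sum>i. ennreal (norm (u i x))) \<partial>M) \<noteq> \<infinity>" by simp
  then have "AE x in M. (\<Sum>i. ennreal (norm (u i x))) \<noteq> \<infinity>"
    by (intro nn_integral_noteq_infinite) measurable
  then have AEs: "AE x in M. summable (\<lambda>i. norm (u i x))"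
    by (auto elim!: eventually_mono intro!: summable_suminf_not_top)
  define g where "g x = f 0 x + (\<Sum>i. u i x)" for x
  define h where "h x = (\<Sum>i. norm (u i x))" for x
  have tel: "(\<Sum>i<n. u i x) = f n x - f 0 x" for n x
    unfolding u_def by (induction n) auto
  have ig: "integrable M g" unfolding g_def
    by (intro Bochner_Integration.integrable_add f integrable_suminf u AEs sI)
  have ih: "integrable M h" unfolding h_def
    by (intro integrable_suminf) (use u AEs sI in auto)
  have lim: "(\<lambda>i. f i x) \<longlonglongrightarrow> g x" and bd: "norm (f n x - g x) \<le> h x"
    if "summable (\<lambda>i. norm (u i x))" for x n
  proof -
    have s: "summable (\<lambda>i. u i x)" using that by (rule summable_norm_cancel)
    have "(\<lambda>n. \<Sum>i<n. u i x) \<longlonglongrightarrow> (\<Sum>i. u i x)" using s by (rule summable_LIMSEQ)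
    then have "(\<lambda>n. f 0 x + (\<Sum>i<n. u i x)) \<longlonglongrightarrow> g x" unfolding g_def by (intro tendsto_intros)
    then show "(\<lambda>i. f i x) \<longlonglongrightarrow> g x" by (simp add: tel)
    have "g x - f n x = (\<Sum>i. u (i + n) x)"
      using suminf_split_initial_segment[OF s, of n] by (simp add: g_def tel)
    also have "norm \<dots> \<le> (\<Sum>i. norm (u (i + n) x))"
      by (rule summable_norm) (use that in \<open>rule summable_ignore_initial_segment\<close>)
    also have "\<dots> \<le> h x"
      unfolding h_def using suminf_split_initial_segment[OF that, of n] by (simp add: sum_nonneg)
    finally show "norm (f n x - g x) \<le> h x" by (simp add: norm_minus_commute)
  qed
  have "(\<lambda>i. \<integral>x. norm (f i x - g x) \<partial>M) \<longlonglongrightarrow> (\<integral>x. 0 \<partial>M)"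
  proof (rule integral_dominated_convergence[where w = h])
    show "AE x in M. (\<lambda>i. norm (f i x - g x)) \<longlonglongrightarrow> 0"
      using AEs by eventually_elim (use lim LIM_zero tendsto_norm_zero in fastforce)
    show "AE x in M. norm (norm (f i x - g x)) \<le> h x" for i
      using AEs by eventually_elim (use bd in auto)
  qed (use ig ih f in auto)
  moreover have "AE x in M. (\<lambda>i. f i x) \<longlonglongrightarrow> g x"
    using AEs by eventually_elim (rule lim)
  ultimately show ?thesis using that[OF ig] by simp
qed

lemma has_integral_equipartition:
  fixes h :: "real \<Rightarrow> 'a::euclidean_space"
  assumes N: "N > 0"
    and h: "\<And>j. j < N \<Longrightarrow> (h has_integral c j) {real j / real N..real (Suc j) / real N}"
  shows "m \<le> N \<Longrightarrow> (h has_integral (\<Sum>j<m. c j)) {0..real m / real N}"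
proof (induction m)
  case 0
  then show ?case by (simp add: has_integral_refl)
next
  case (Suc m)
  then have "(h has_integral (\<Sum>j<m. c j) + c m) {0..real (Suc m) / real N}"
    using h[of m] N by (intro has_integral_combine[of 0 "real m / real N" "real (Suc m) / real N"]) (auto simp: divide_right_mono)
  then show ?case by simp
qed

section \<open>Riesz's criterion for \<open>H\<^sup>1\<close>\<close>

lemma integrable_lebesgue_on_iff:
  fixes f :: "'a::euclidean_space \<Rightarrow> 'b::euclidean_space"
  assumes "S \<in> sets lebesgue"
  shows "integrable (lebesgue_on S) f \<longleftrightarrow> f absolutely_integrable_on S"
  using assms by (simp add: integrable_restrict_space set_integrable_def)

lemma nn_integral_lebesgue_on_eq_integral:
  fixes f :: "'a::euclidean_space \<Rightarrow> real"
  assumes "S \<in> sets lebesgue" "\<And>x. x \<in> S \<Longrightarrow> 0 \<le> f x" "f integrable_on S"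
  shows "(\<integral>\<^sup>+x. ennreal (f x) \<partial>lebesgue_on S) = ennreal (integral S f)"
proof -
  have i: "integrable (lebesgue_on S) f"
    using assms nonnegative_absolutely_integrable_1[of f S] by (simp add: integrable_lebesgue_on_iff)
  have "AE x in lebesgue_on S. 0 \<le> f x"
    using assms by (intro AE_I2) (auto simp: space_restrict_space)
  then show ?thesis
    using nn_integral_eq_integral[OF i] lebesgue_integral_eq_integral[OF i assms(1)] by simp
qed

text \<open>H1 in the form "absolutely continuous with square-integrable density". This fixes F at
  every point of [0,1], not only almost everywhere.\<close>

definition H1_deriv :: "(real \<Rightarrow> 'a::euclidean_space) \<Rightarrow> (real \<Rightarrow> 'a) \<Rightarrow> bool" where
  "H1_deriv F g \<longleftrightarrow> g absolutely_integrable_on {0..1} \<and> (\<lambda>x. (norm (g x))\<^sup>2) integrable_on {0..1} \<and>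
     (\<forall>x\<in>{0..1}. F x = F 0 + integral {0..x} g)"

definition dyadic_slope :: "(real \<Rightarrow> 'a::real_vector) \<Rightarrow> nat \<Rightarrow> nat \<Rightarrow> 'a" where
  "dyadic_slope F k j = 2 ^ k *\<^sub>R (F (real (Suc j) / 2 ^ k) - F (real j / 2 ^ k))"

definition dyadic_step :: "(real \<Rightarrow> 'a::real_vector) \<Rightarrow> nat \<Rightarrow> real \<Rightarrow> 'a" where
  "dyadic_step F k x = dyadic_slope F k (nat \<lfloor>2 ^ k * x\<rfloor>)"

text \<open>The squared L2-norm of \<open>dyadic_step F k\<close>. It depends on finitely many
  values of F, hence passes to pointwise limits; for continuous F its supremum over k is the
  Dirichlet integral.\<close>

definition dyadic_energy :: "(real \<Rightarrow> 'a::real_normed_vector) \<Rightarrow> nat \<Rightarrow> real" where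
  "dyadic_energy F k = (\<Sum>j<2 ^ k. (norm (dyadic_slope F k j))\<^sup>2 / 2 ^ k)"

section \<open>The martingale of dyadic difference quotients\<close>

lemma dyadic_interval_subset:
  assumes "j < 2 ^ k"
  shows "{real j / 2 ^ k..real (Suc j) / 2 ^ k} \<subseteq> {0..1}"
proof -
  have "real (Suc j) \<le> 2 ^ k" using assms by (metis Suc_leI of_nat_le_iff of_nat_numeral of_nat_power)
  then have "real (Suc j) / 2 ^ k \<le> 1" by simp
  then show ?thesis by (auto intro: order_trans)
qed

lemma dyadic_step_eq:
  assumes "x \<in> {real j / 2 ^ k..<real (Suc j) / 2 ^ k}"
  shows "dyadic_step F k x = dyadic_slope F k j"
proof -
  have "real j \<le> 2 ^ k * x" "2 ^ k * x < real (Suc j)" using assms by (auto simp: field_simps)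
  then have "\<lfloor>2 ^ k * x\<rfloor> = int j" by (intro floor_unique) auto
  then show ?thesis by (simp add: dyadic_step_def)
qed

lemma has_integral_dyadic:
  fixes h :: "real \<Rightarrow> 'a::euclidean_space"
  assumes "\<And>j. j < 2 ^ k \<Longrightarrow> (h has_integral c j) {real j / 2 ^ k..real (Suc j) / 2 ^ k}" "m \<le> 2 ^ k"
  shows "(h has_integral (\<Sum>j<m. c j)) {0..real m / 2 ^ k}"
  using has_integral_equipartition[where N = "2 ^ k" and h = h and c = c and m = m] assms by simp

lemma has_integral_dyadic_step_piece:
  fixes \<phi> :: "'a::real_vector \<Rightarrow> 'b::euclidean_space"
  shows "((\<lambda>x. \<phi> (dyadic_step F k x)) has_integral (1 / 2 ^ k) *\<^sub>R \<phi> (dyadic_slope F k j))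
    {real j / 2 ^ k..real (Suc j) / 2 ^ k}"
proof (rule has_integral_spike_finite)
  show "((\<lambda>x. \<phi> (dyadic_slope F k j)) has_integral (1 / 2 ^ k) *\<^sub>R \<phi> (dyadic_slope F k j))
    {real j / 2 ^ k..real (Suc j) / 2 ^ k}"
    using has_integral_const_real[of "\<phi> (dyadic_slope F k j)" "real j / 2 ^ k" "real (Suc j) / 2 ^ k"]
    by (simp add: divide_right_mono diff_divide_distrib[symmetric])
  \<comment> \<open>At the right endpoint the floor has already jumped to the next slope.\<close>
  show "finite {real (Suc j) / 2 ^ k}" by simp
qed (use dyadic_step_eq[of _ j k F] in auto)

lemma has_integral_dyadic_step_fun:
  fixes \<phi> :: "'a::real_vector \<Rightarrow> 'b::euclidean_space"
  shows "((\<lambda>x. \<phi> (dyadic_step F k x)) has_integral (\<Sum>j<2 ^ k. (1 / 2 ^ k) *\<^sub>R \<phi> (dyadic_slope F k j))) {0..1}"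
  using has_integral_dyadic[OF has_integral_dyadic_step_piece[of \<phi> F k], of "2 ^ k"] by simp

lemma has_integral_dyadic_step_initial:
  fixes F :: "real \<Rightarrow> 'a::euclidean_space"
  assumes "m \<le> 2 ^ k"
  shows "(dyadic_step F k has_integral (F (real m / 2 ^ k) - F 0)) {0..real m / 2 ^ k}"
proof -
  have "(\<Sum>j<n. (1 / 2 ^ k) *\<^sub>R dyadic_slope F k j) = F (real n / 2 ^ k) - F 0" for n
    by (induction n) (auto simp: dyadic_slope_def)
  then show ?thesis
    using has_integral_dyadic[OF has_integral_dyadic_step_piece[of "\<lambda>x. x" F k] assms] by simp
qed

lemma has_integral_dyadic_step_coarse:
  fixes F :: "real \<Rightarrow> 'a::euclidean_space"
  assumes "k \<le> m" "j \<le> 2 ^ k"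
  shows "(dyadic_step F m has_integral (F (real j / 2 ^ k) - F 0)) {0..real j / 2 ^ k}"
proof -
  have "j * 2 ^ (m - k) \<le> 2 ^ k * 2 ^ (m - k)" using assms by (intro mult_right_mono) auto
  then have le: "j * 2 ^ (m - k) \<le> 2 ^ m" using assms by (simp add: power_add[symmetric])
  have "(2::real) ^ m = 2 ^ k * 2 ^ (m - k)" using assms by (simp add: power_add[symmetric])
  then have "real (j * 2 ^ (m - k)) / 2 ^ m = real j / 2 ^ k" by simp
  then show ?thesis using has_integral_dyadic_step_initial[OF le, of F] by simp
qed

text \<open>The martingale property: increments of the finer level telescope over a coarser
  interval.\<close>

lemma has_integral_dyadic_step_coarse_piece:
  fixes F :: "real \<Rightarrow> 'a::euclidean_space"
  assumes "k \<le> m" "j < 2 ^ k"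
  shows "(dyadic_step F m has_integral (1 / 2 ^ k) *\<^sub>R dyadic_slope F k j) {real j / 2 ^ k..real (Suc j) / 2 ^ k}"
proof -
  let ?a = "real j / 2 ^ k" and ?b = "real (Suc j) / 2 ^ k"
  have 1: "(dyadic_step F m has_integral (F ?a - F 0)) {0..?a}"
    and 2: "(dyadic_step F m has_integral (F ?b - F 0)) {0..?b}"
    using has_integral_dyadic_step_coarse[OF assms(1), of j F] has_integral_dyadic_step_coarse[OF assms(1), of "Suc j" F] assms(2)
    by auto
  have ab: "0 \<le> ?a" "?a \<le> ?b" by (auto simp: divide_right_mono)
  have int: "dyadic_step F m integrable_on {0..?b}" using 2 by blast
  have "integral {0..?a} (dyadic_step F m) + integral {?a..?b} (dyadic_step F m) = integral {0..?b} (dyadic_step F m)"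
    using ab int by (rule Henstock_Kurzweil_Integration.integral_combine)
  then have "integral {?a..?b} (dyadic_step F m) = F ?b - F ?a"
    using integral_unique[OF 1] integral_unique[OF 2] by (simp add: algebra_simps)
  moreover have "dyadic_step F m integrable_on {?a..?b}"
    using integrable_on_subinterval[OF int, of ?a ?b] ab by auto
  ultimately show ?thesis
    by (simp add: has_integral_iff dyadic_slope_def)
qed

text \<open>On a coarse interval the coarse step is constant and the fine step has the same mean, so
  pairing the two sees only the coarse one. This is the orthogonality of martingale increments;
  Pythagoras then makes the energies increase and measures L2-distances by their
  differences.\<close>

lemma has_integral_dyadic_step_inner:
  fixes F :: "real \<Rightarrow> 'a::euclidean_space"
  assumes "k \<le> m"
  shows "((\<lambda>x. dyadic_step F k x \<bullet> dyadic_step F m x) has_integral dyadic_energy F k) {0..1}"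
proof -
  have "((\<lambda>x. dyadic_step F k x \<bullet> dyadic_step F m x) has_integral (norm (dyadic_slope F k j))\<^sup>2 / 2 ^ k)
    {real j / 2 ^ k..real (Suc j) / 2 ^ k}" if "j < 2 ^ k" for j
  proof (rule has_integral_spike_finite)
    show "((\<lambda>x. dyadic_slope F k j \<bullet> dyadic_step F m x) has_integral (norm (dyadic_slope F k j))\<^sup>2 / 2 ^ k)
      {real j / 2 ^ k..real (Suc j) / 2 ^ k}"
      using has_integral_linear[OF has_integral_dyadic_step_coarse_piece[OF assms that, of F]
          bounded_linear_inner_right[of "dyadic_slope F k j"]]
      by (simp add: o_def power2_norm_eq_inner)
    show "finite {real (Suc j) / 2 ^ k}" by simp
  qed (use dyadic_step_eq[of _ j k F] in auto)
  from has_integral_dyadic[OF this, of "2 ^ k"] show ?thesis by (simp add: dyadic_energy_def)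
qed

lemma absolutely_integrable_dyadic_step:
  fixes F :: "real \<Rightarrow> 'a::euclidean_space"
  shows "dyadic_step F k absolutely_integrable_on {0..1}"
  unfolding absolutely_integrable_on_def
  using has_integral_dyadic_step_fun[of "\<lambda>x. x" F k] has_integral_dyadic_step_fun[of norm F k] by blast

lemma has_integral_dyadic_step_diff:
  fixes F :: "real \<Rightarrow> 'a::euclidean_space"
  assumes "k \<le> m"
  shows "((\<lambda>x. (norm (dyadic_step F m x - dyadic_step F k x))\<^sup>2) has_integral dyadic_energy F m - dyadic_energy F k) {0..1}"
proof -
  have "((\<lambda>x. dyadic_step F m x \<bullet> dyadic_step F m x - 2 * (dyadic_step F k x \<bullet> dyadic_step F m x)
      + dyadic_step F k x \<bullet> dyadic_step F k x) has_integral
      dyadic_energy F m - 2 * dyadic_energy F k + dyadic_energy F k) {0..1}"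
    using assms by (intro has_integral_add has_integral_diff has_integral_mult_right has_integral_dyadic_step_inner) auto
  then show ?thesis
    by (simp add: power2_norm_eq_inner inner_diff_left inner_diff_right inner_commute algebra_simps)
qed

lemma integral_norm_dyadic_step_diff:
  fixes F :: "real \<Rightarrow> 'a::euclidean_space"
  assumes "k \<le> m"
  shows "(integral {0..1} (\<lambda>x. norm (dyadic_step F m x - dyadic_step F k x)))\<^sup>2 \<le> dyadic_energy F m - dyadic_energy F k"
proof -
  note d = has_integral_dyadic_step_diff[OF assms, of F]
  have "(\<lambda>x. dyadic_step F m x - dyadic_step F k x) absolutely_integrable_on {0..1}"
    by (intro set_integral_diff absolutely_integrable_dyadic_step)
  then have i: "(\<lambda>x. norm (dyadic_step F m x - dyadic_step F k x)) integrable_on {0..1}"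
    unfolding absolutely_integrable_on_def by blast
  show ?thesis
    using integral_Cauchy_Schwarz[OF i _ has_integral_integrable[OF d], of "\<lambda>_. 1"] integral_unique[OF d]
    by (simp add: integrable_const_ivl)
qed

lemma mono_dyadic_energy:
  fixes F :: "real \<Rightarrow> 'a::euclidean_space"
  shows "k \<le> m \<Longrightarrow> dyadic_energy F k \<le> dyadic_energy F m"
  using has_integral_nonneg[OF has_integral_dyadic_step_diff[of k m F]] by simp

text \<open>The rate \<open>(1/4) ^ i\<close> is for squared distances; its root is the rate
  \<open>(1/2) ^ i\<close> required by \<open>L1_fast_Cauchy_limit\<close>.\<close>

lemma fast_Cauchy_subsequence:
  fixes S :: "nat \<Rightarrow> real"
  assumes "mono S" "\<And>k. S k \<le> C"
  obtains r where "mono r" "\<And>i. i \<le> r i" "\<And>i m. r i \<le> m \<Longrightarrow> S m - S (r i) \<le> (1/4) ^ i"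
proof -
  obtain L where L: "S \<longlonglongrightarrow> L" "\<And>i. S i \<le> L"
    using incseq_convergent[OF assms(1)] assms(2) by auto
  have "\<exists>N. \<forall>n\<ge>N. L - S n \<le> (1/4) ^ i" for i
  proof -
    have "\<forall>\<^sub>F n in sequentially. S n > L - (1/4) ^ i"
      using L(1) by (intro order_tendstoD) auto
    then show ?thesis by (force simp: eventually_sequentially)
  qed
  then obtain N where N: "\<And>i n. n \<ge> N i \<Longrightarrow> L - S n \<le> (1/4) ^ i" by metis
  define r where "r i = i + (\<Sum>l\<le>i. N l)" for i
  show thesis
  proof (rule that)
    show "mono r" unfolding r_def by (intro monoI add_mono sum_mono2) auto
    show "i \<le> r i" for i by (simp add: r_def)
    have "N i \<le> r i" for i unfolding r_def using member_le_sum[of i "{..i}" N] by simp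
    then show "S m - S (r i) \<le> (1/4) ^ i" if "r i \<le> m" for i m
      using N[of i "r i"] L(2)[of m] by simp
  qed
qed

text \<open>F. Riesz's characterisation of \<open>H\<^sup>1\<close>: the dyadic difference quotients form an \<open>L\<^sup>2\<close>-bounded
  martingale, whose limit is the derivative.\<close>
lemma H1_deriv_of_dyadic_energy_bounded:
  fixes F :: "real \<Rightarrow> 'a::euclidean_space"
  assumes F: "continuous_on {0..1} F" and C: "\<And>k. dyadic_energy F k \<le> C"
  obtains g where "H1_deriv F g" "integral {0..1} (\<lambda>x. (norm (g x))\<^sup>2) \<le> C"
proof -
  have mS: "mono (dyadic_energy F)" using mono_dyadic_energy by (auto intro: monoI)
  obtain r where r: "mono r" "\<And>i. i \<le> r i"
    "\<And>i m. r i \<le> m \<Longrightarrow> dyadic_energy F m - dyadic_energy F (r i) \<le> (1/4) ^ i"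
    using fast_Cauchy_subsequence[OF mS C] by blast
  define M where "M = lebesgue_on {0..1::real}"
  define f where "f i = dyadic_step F (r i)" for i
  have SM: "{0..1::real} \<in> sets lebesgue" by simp
  have fi: "integrable M (f i)" for i
    unfolding M_def f_def by (simp add: integrable_lebesgue_on_iff absolutely_integrable_dyadic_step)
  have fast: "(\<integral>x. norm (f (Suc i) x - f i x) \<partial>M) \<le> (1/2) ^ i" for i
  proof -
    have le: "r i \<le> r (Suc i)" using r(1) by (simp add: monoD)
    have "(\<integral>x. norm (f (Suc i) x - f i x) \<partial>M) = integral {0..1} (\<lambda>x. norm (f (Suc i) x - f i x))"
      unfolding M_def using fi by (intro lebesgue_integral_eq_integral) (auto simp: M_def)
    moreover
    have "(integral {0..1} (\<lambda>x. norm (f (Suc i) x - f i x)))\<^sup>2 \<le> ((1/2) ^ i)\<^sup>2"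
    proof -
      have "((1/2::real) ^ i)\<^sup>2 = (1/4) ^ i"
        by (induction i) (auto simp: power_mult_distrib power2_eq_square)
      then show ?thesis
        unfolding f_def using integral_norm_dyadic_step_diff[OF le, of F] r(3)[OF le] by linarith
    qed
    then have "integral {0..1} (\<lambda>x. norm (f (Suc i) x - f i x)) \<le> (1/2) ^ i"
      by (rule power2_le_imp_le) simp
    ultimately show ?thesis by simp
  qed
  obtain g where gi: "integrable M g" and AEg: "AE x in M. (\<lambda>i. f i x) \<longlonglongrightarrow> g x"
    and L1: "(\<lambda>i. \<integral>x. norm (f i x - g x) \<partial>M) \<longlonglongrightarrow> 0"
    by (rule L1_fast_Cauchy_limit[of M f, OF fi fast])
  have ga: "g absolutely_integrable_on {0..1}"
    using gi by (simp add: M_def integrable_lebesgue_on_iff)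
  have gx: "g integrable_on {0..x}" "f i integrable_on {0..x}"
    "(\<lambda>x. norm (f i x - g x)) integrable_on {0..x}" if "x \<in> {0..1}" for x i
  proof -
    have sub: "{0..x} \<subseteq> {0..1}" using that by auto
    have fa: "f i absolutely_integrable_on {0..1}"
      unfolding f_def by (rule absolutely_integrable_dyadic_step)
    have "(\<lambda>x. f i x - g x) absolutely_integrable_on {0..x}"
      using absolutely_integrable_on_subinterval[OF fa sub] absolutely_integrable_on_subinterval[OF ga sub]
      by (rule set_integral_diff)
    then show "g integrable_on {0..x}" "f i integrable_on {0..x}"
    "(\<lambda>x. norm (f i x - g x)) integrable_on {0..x}"
      using absolutely_integrable_on_subinterval[OF fa sub] absolutely_integrable_on_subinterval[OF ga sub]
      by (auto simp: absolutely_integrable_on_def)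
  qed
  have lim: "(\<lambda>i. integral {0..x} (f i)) \<longlonglongrightarrow> integral {0..x} g" if x: "x \<in> {0..1}" for x
  proof (rule Lim_transform[OF tendsto_const])
    have "norm (integral {0..x} (f i) - integral {0..x} g) \<le> (\<integral>x. norm (f i x - g x) \<partial>M)" for i
    proof -
      have "norm (integral {0..x} (f i) - integral {0..x} g) = norm (integral {0..x} (\<lambda>x. f i x - g x))"
        using gx[OF x] by (simp add: Henstock_Kurzweil_Integration.integral_diff)
      also have "\<dots> \<le> integral {0..x} (\<lambda>x. norm (f i x - g x))"
        using gx[OF x] by (intro integral_norm_bound_integral integrable_diff) auto
      also have "\<dots> \<le> integral {0..1} (\<lambda>x. norm (f i x - g x))"
        using gx[of 1] gx[OF x] x by (intro integral_subset_le) auto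
      also have "\<dots> = (\<integral>x. norm (f i x - g x) \<partial>M)"
        unfolding M_def using fi gi by (intro lebesgue_integral_eq_integral[symmetric]) (auto simp: M_def)
      finally show ?thesis .
    qed
    then show "(\<lambda>i. integral {0..x} (f i) - integral {0..x} g) \<longlonglongrightarrow> 0"
      by (intro Lim_null_comparison[OF _ L1]) auto
  qed
  have dyad: "F x - F 0 - integral {0..x} g = 0" if mem: "x \<in> {0..1} \<inter> (\<Union>k m. {real m / 2 ^ k})" for x
  proof -
    \<comment> \<open>At a dyadic point of level k every step of level at least k has exactly the
      integral F x - F 0, so the sequence is eventually constant. Density of the dyadic points and
      continuity then give all x.\<close>
    obtain k m where x: "x = real m / 2 ^ k" "x \<in> {0..1}" using mem by blast
    then have "real m \<le> 2 ^ k" by simp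
    then have m: "m \<le> 2 ^ k" by (metis of_nat_le_iff of_nat_numeral of_nat_power)
    have "\<forall>\<^sub>F i in sequentially. integral {0..x} (f i) = F x - F 0"
      using eventually_ge_at_top[of k]
    proof eventually_elim
      case (elim i)
      then have "k \<le> r i" using r(2)[of i] by simp
      then show ?case unfolding f_def x(1)
        by (intro integral_unique has_integral_dyadic_step_coarse m)
    qed
    then have "(\<lambda>i. integral {0..x} (f i)) \<longlonglongrightarrow> F x - F 0" by (rule tendsto_eventually)
    then show ?thesis using LIMSEQ_unique[OF lim[OF x(2)]] by simp
  qed
  have cl: "closure ({0..1} \<inter> (\<Union>k m. {real m / 2 ^ k})) = {0..1::real}"
    by (subst closure_dyadic_rationals_in_convex_set_pos_1) auto
  have cont: "continuous_on {0..1} (\<lambda>x. F x - F 0 - integral {0..x} g)"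
    using F gx[of 1] by (intro continuous_intros indefinite_integral_continuous_1) auto
  have rep: "F x = F 0 + integral {0..x} g" if "x \<in> {0..1}" for x
    using continuous_constant_on_closure[of "{0..1} \<inter> (\<Union>k m. {real m / 2 ^ k})" _ 0, unfolded cl, OF cont dyad that]
    by (simp add: algebra_simps)
  \<comment> \<open>This bound survives for g by Fatou's lemma, since the steps converge almost
    everywhere.\<close>
  have en: "(\<integral>\<^sup>+x. ennreal ((norm (f i x))\<^sup>2) \<partial>M) \<le> ennreal C" for i
  proof -
    have hi: "((\<lambda>x. (norm (f i x))\<^sup>2) has_integral dyadic_energy F (r i)) {0..1}"
      using has_integral_dyadic_step_inner[of "r i" "r i" F] by (simp add: f_def power2_norm_eq_inner)
    then have "(\<integral>\<^sup>+x. ennreal ((norm (f i x))\<^sup>2) \<partial>M) = ennreal (integral {0..1} (\<lambda>x. (norm (f i x))\<^sup>2))"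
      unfolding M_def by (intro nn_integral_lebesgue_on_eq_integral) auto
    then show ?thesis using integral_unique[OF hi] C[of "r i"] by (simp add: ennreal_leI)
  qed
  have [measurable]: "f i \<in> borel_measurable M" "g \<in> borel_measurable M" for i
    using fi gi by auto
  have "(\<integral>\<^sup>+x. ennreal ((norm (g x))\<^sup>2) \<partial>M) = (\<integral>\<^sup>+x. liminf (\<lambda>i. ennreal ((norm (f i x))\<^sup>2)) \<partial>M)"
  proof (rule nn_integral_cong_AE)
    show "AE x in M. ennreal ((norm (g x))\<^sup>2) = liminf (\<lambda>i. ennreal ((norm (f i x))\<^sup>2))"
      using AEg
    proof eventually_elim
      case (elim x)
      then have "(\<lambda>i. ennreal ((norm (f i x))\<^sup>2)) \<longlonglongrightarrow> ennreal ((norm (g x))\<^sup>2)"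
        by (intro tendsto_intros)
      then show ?case by (intro lim_imp_Liminf[symmetric]) auto
    qed
  qed
  also have "\<dots> \<le> liminf (\<lambda>i. \<integral>\<^sup>+x. ennreal ((norm (f i x))\<^sup>2) \<partial>M)"
    by (rule nn_integral_liminf) measurable
  also have "\<dots> \<le> ennreal C"
    using en by (intro Liminf_le) auto
  finally have g2: "(\<integral>\<^sup>+x. ennreal ((norm (g x))\<^sup>2) \<partial>M) \<le> ennreal C" .
  have ig2: "integrable M (\<lambda>x. (norm (g x))\<^sup>2)"
    using g2 by (intro integrableI_bounded) (auto simp: le_less_trans[OF _ ennreal_less_top])
  then have g2i: "(\<lambda>x. (norm (g x))\<^sup>2) integrable_on {0..1}"
    using integrable_on_lebesgue_on M_def SM by blast
  have "ennreal (integral {0..1} (\<lambda>x. (norm (g x))\<^sup>2)) \<le> ennreal C"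
    using g2 nn_integral_lebesgue_on_eq_integral[OF SM _ g2i] by (simp add: M_def)
  \<comment> \<open>\<open>ennreal\<close> sends negative numbers to 0, so the comparison can be
    read back in the reals only once C is known to be nonnegative.\<close>
  moreover have "0 \<le> C" using C[of 0] by (simp add: dyadic_energy_def order_trans[OF _ C[of 0]])
  ultimately have "integral {0..1} (\<lambda>x. (norm (g x))\<^sup>2) \<le> C" by simp
  then show thesis using that[of g] ga g2i rep unfolding H1_deriv_def by blast
qed

section \<open>Primitives of integrable functions\<close>

text \<open>Phrased by increments so that it restricts to subintervals without reference to a base
  point; weak derivatives give such information only on compact subintervals of (0,1).\<close>

definition primitive_on :: "real \<Rightarrow> real \<Rightarrow> (real \<Rightarrow> 'a::euclidean_space) \<Rightarrow> (real \<Rightarrow> 'a) \<Rightarrow> bool" where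
  "primitive_on a b F g \<longleftrightarrow> g absolutely_integrable_on {a..b} \<and>
     (\<forall>x y. a \<le> x \<longrightarrow> x \<le> y \<longrightarrow> y \<le> b \<longrightarrow> F y - F x = integral {x..y} g)"

lemma primitive_onI:
  assumes g: "g absolutely_integrable_on {a..b}" and F: "\<And>x. x \<in> {a..b} \<Longrightarrow> F x = F a + integral {a..x} g"
  shows "primitive_on a b F g"
  unfolding primitive_on_def
proof (intro conjI allI impI g)
  fix x y assume xy: "a \<le> x" "x \<le> y" "y \<le> b"
  have "g integrable_on {a..y}"
    using absolutely_integrable_on_subinterval[OF g, of a y] xy by (auto simp: absolutely_integrable_on_def)
  then have "integral {a..x} g + integral {x..y} g = integral {a..y} g"
    using xy by (intro Henstock_Kurzweil_Integration.integral_combine) auto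
  then show "F y - F x = integral {x..y} g"
    using F[of x] F[of y] xy by (simp add: algebra_simps)
qed

lemma primitive_on_subinterval:
  "primitive_on a b F g \<Longrightarrow> a \<le> c \<Longrightarrow> d \<le> b \<Longrightarrow> primitive_on c d F g"
  unfolding primitive_on_def by (auto intro: absolutely_integrable_on_subinterval)

lemma primitive_on_integrable:
  assumes "primitive_on a b F g" "a \<le> c" "d \<le> b"
  shows "g integrable_on {c..d}" "(\<lambda>x. norm (g x)) integrable_on {c..d}"
  using primitive_on_subinterval[OF assms] by (auto simp: primitive_on_def absolutely_integrable_on_def)

lemma continuous_on_primitive:
  assumes "primitive_on a b F g"
  shows "continuous_on {a..b} F"
proof (cases "a \<le> b")
  case True
  have "continuous_on {a..b} (\<lambda>x. F a + integral {a..x} g)"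
    using primitive_on_integrable[OF assms, of a b]
    by (intro continuous_intros indefinite_integral_continuous_1) auto
  moreover have "F a + integral {a..x} g = F x" if "x \<in> {a..b}" for x
    using assms that unfolding primitive_on_def by (metis add_diff_cancel_left' add_diff_eq atLeastAtMost_iff order_refl)
  ultimately show ?thesis by (rule continuous_on_eq)
qed auto

lemma primitive_on_norm_le:
  assumes "primitive_on a b F g" "a \<le> x" "x \<le> y" "y \<le> b"
  shows "norm (F y - F x) \<le> integral {x..y} (\<lambda>t. norm (g t))"
proof -
  have "F y - F x = integral {x..y} g" using assms by (auto simp: primitive_on_def)
  also have "norm \<dots> \<le> integral {x..y} (\<lambda>t. norm (g t))"
    using primitive_on_integrable[OF assms(1,2,4)] by (intro integral_norm_bound_integral) auto
  finally show ?thesis .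
qed

lemma H1_deriv_iff_primitive:
  "H1_deriv F g \<longleftrightarrow> primitive_on 0 1 F g \<and> (\<lambda>x. (norm (g x))\<^sup>2) integrable_on {0..1}"
proof
  assume "H1_deriv F g"
  then show "primitive_on 0 1 F g \<and> (\<lambda>x. (norm (g x))\<^sup>2) integrable_on {0..1}"
    unfolding H1_deriv_def by (auto intro!: primitive_onI)
next
  assume "primitive_on 0 1 F g \<and> (\<lambda>x. (norm (g x))\<^sup>2) integrable_on {0..1}"
  then show "H1_deriv F g"
    unfolding H1_deriv_def primitive_on_def by (auto simp: algebra_simps)
qed

section \<open>Integration by parts for absolutely continuous functions\<close>

text \<open>Over n equal pieces the increments of V telescope, and the common factor (b - a) / n
  tends to 0.\<close>

lemma eq_of_increments_le:
  fixes h :: "real \<Rightarrow> 'a::real_normed_vector" and V :: "real \<Rightarrow> real"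
  assumes ab: "a \<le> b"
    and le: "\<And>x y. a \<le> x \<Longrightarrow> x \<le> y \<Longrightarrow> y \<le> b \<Longrightarrow> norm (h y - h x) \<le> (y - x) * (V y - V x)"
  shows "h b = h a"
proof -
  have *: "norm (h b - h a) \<le> (b - a) * (V b - V a) / real n" if n: "n > 0" for n
  proof -
    define p where "p j = a + (b - a) * real j / real n" for j
    have p: "p 0 = a" "p n = b" "p (Suc j) - p j = (b - a) / real n" for j
      using n by (auto simp: p_def field_simps)
    have bd: "a \<le> p j" "p j \<le> b" if "j \<le> n" for j
    proof -
      have "(b - a) * (real j / real n) \<le> (b - a) * 1"
        using that ab n by (intro mult_left_mono) auto
      then show "p j \<le> b" by (simp add: p_def)
      show "a \<le> p j" using ab by (simp add: p_def)
    qed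
    have mono: "p j \<le> p (Suc j)" for j using p(3)[of j] ab divide_nonneg_nonneg[of "b - a" "real n"] by linarith
    have "h b - h a = (\<Sum>j<n. h (p (Suc j)) - h (p j))"
      using sum_lessThan_telescope[of "\<lambda>j. h (p j)" n] p by simp
    also have "norm \<dots> \<le> (\<Sum>j<n. norm (h (p (Suc j)) - h (p j)))" by (rule norm_sum)
    also have "\<dots> \<le> (\<Sum>j<n. (b - a) / real n * (V (p (Suc j)) - V (p j)))"
    proof (rule sum_mono)
      fix j assume "j \<in> {..<n}"
      then have "norm (h (p (Suc j)) - h (p j)) \<le> (p (Suc j) - p j) * (V (p (Suc j)) - V (p j))"
        by (intro le bd mono) auto
      then show "norm (h (p (Suc j)) - h (p j)) \<le> (b - a) / real n * (V (p (Suc j)) - V (p j))"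
        by (simp add: p(3))
    qed
    also have "\<dots> = (b - a) / real n * (V b - V a)"
      unfolding sum_distrib_left[symmetric] using sum_lessThan_telescope[of "\<lambda>j. V (p j)" n] p by simp
    finally show ?thesis by simp
  qed
  have "(\<lambda>n. (b - a) * (V b - V a) / real n) \<longlonglongrightarrow> 0" by (rule lim_const_over_n)
  moreover have "\<exists>N. \<forall>n\<ge>N. norm (h b - h a) \<le> (b - a) * (V b - V a) / real n"
    using * by (intro exI[of _ 1]) auto
  ultimately have "norm (h b - h a) \<le> 0" by (rule LIMSEQ_le_const)
  then show ?thesis by simp
qed

lemma absolutely_integrable_continuous_scaleR:
  fixes \<phi> :: "real \<Rightarrow> real" and g :: "real \<Rightarrow> 'a::euclidean_space"
  assumes "continuous_on {a..b} \<phi>" "g absolutely_integrable_on {a..b}"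
  shows "(\<lambda>x. \<phi> x *\<^sub>R g x) absolutely_integrable_on {a..b}"
proof (rule absolutely_integrable_bounded_measurable_product[where h = scaleR and f = \<phi>])
  show "bilinear (scaleR :: real \<Rightarrow> 'a \<Rightarrow> 'a)"
    by (simp add: bilinear_conv_bounded_bilinear bounded_bilinear_scaleR)
  show "\<phi> \<in> borel_measurable (lebesgue_on {a..b})"
    using assms(1) by (intro continuous_imp_measurable_on_sets_lebesgue) auto
  show "bounded (\<phi> ` {a..b})"
    using assms(1) by (intro compact_imp_bounded compact_continuous_image) auto
qed (use assms in auto)

text \<open>The defect of the product rule on \<open>[x, y]\<close> is \<open>O(y - x)\<close> times the total variation of \<open>F\<close> there,
  so it vanishes on summation over fine partitions.\<close>
lemma integration_by_parts_primitive:
  fixes F g :: "real \<Rightarrow> 'a::euclidean_space" and \<phi> \<phi>' :: "real \<Rightarrow> real"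
  assumes ab: "a \<le> b" and F: "primitive_on a b F g"
    and \<phi>: "\<And>x. x \<in> {a..b} \<Longrightarrow> (\<phi> has_real_derivative \<phi>' x) (at x within {a..b})"
    and \<phi>': "continuous_on {a..b} \<phi>'"
  shows "((\<lambda>x. \<phi>' x *\<^sub>R F x + \<phi> x *\<^sub>R g x) has_integral (\<phi> b *\<^sub>R F b - \<phi> a *\<^sub>R F a)) {a..b}"
proof -
  have c\<phi>: "continuous_on {a..b} \<phi>" using \<phi> by (rule DERIV_continuous_on)
  have cF: "continuous_on {a..b} F" using F by (rule continuous_on_primitive)
  have ga: "g absolutely_integrable_on {a..b}" using F by (simp add: primitive_on_def)
  have "compact (\<phi>' ` {a..b})" using \<phi>' by (intro compact_continuous_image) auto
  then obtain M where M: "M > 0" "\<And>x. x \<in> {a..b} \<Longrightarrow> \<bar>\<phi>' x\<bar> \<le> M"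
    by (metis bounded_pos compact_imp_bounded imageI real_norm_def)
  have i1: "(\<lambda>x. \<phi>' x *\<^sub>R F x) integrable_on {x..y}"
    and i2: "(\<lambda>x. \<phi> x *\<^sub>R g x) integrable_on {x..y}" if "a \<le> x" "y \<le> b" for x y
  proof -
    have "continuous_on {a..b} (\<lambda>x. \<phi>' x *\<^sub>R F x)" by (intro continuous_intros \<phi>' cF)
    then show "(\<lambda>x. \<phi>' x *\<^sub>R F x) integrable_on {x..y}"
      using that by (intro integrable_continuous_interval) (auto elim: continuous_on_subset)
    have "(\<lambda>x. \<phi> x *\<^sub>R g x) absolutely_integrable_on {x..y}"
      using absolutely_integrable_on_subinterval[OF absolutely_integrable_continuous_scaleR[OF c\<phi> ga], of x y] that by auto
    then show "(\<lambda>x. \<phi> x *\<^sub>R g x) integrable_on {x..y}" by (simp add: absolutely_integrable_on_def)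
  qed
  define u where "u x = \<phi>' x *\<^sub>R F x + \<phi> x *\<^sub>R g x" for x
  have iu: "u integrable_on {x..y}" if "a \<le> x" "y \<le> b" for x y
    unfolding u_def using i1[OF that] i2[OF that] by (rule integrable_add)
  define h where "h x = \<phi> x *\<^sub>R F x - integral {a..x} u" for x
  \<comment> \<open>The defect has two terms, each with integral at most M (y - x) times the
    integral of \<open>norm (g t)\<close> over [x, y]; hence the factor 2.\<close>
  define V where "V x = 2 * M * integral {a..x} (\<lambda>t. norm (g t))" for x
  note gn = primitive_on_integrable[OF F]
  have "h b = h a"
  proof (rule eq_of_increments_le[OF ab, of h V])
    fix x y assume xy: "a \<le> x" "x \<le> y" "y \<le> b"
    define G where "G = integral {x..y} (\<lambda>t. norm (g t))"
    have dV: "V y - V x = 2 * M * G"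
    proof -
      have "integral {a..x} (\<lambda>t. norm (g t)) + G = integral {a..y} (\<lambda>t. norm (g t))"
        unfolding G_def using xy gn[of a y] by (intro Henstock_Kurzweil_Integration.integral_combine) auto
      then have "integral {a..y} (\<lambda>t. norm (g t)) = integral {a..x} (\<lambda>t. norm (g t)) + G" by simp
      then show ?thesis unfolding V_def by (simp add: algebra_simps)
    qed
    have du: "integral {a..y} u - integral {a..x} u = integral {x..y} u"
      using Henstock_Kurzweil_Integration.integral_combine[of a x y u] xy iu[of a y] by (simp add: algebra_simps)
    have \<phi>xy: "(\<phi>' has_integral (\<phi> t - \<phi> s)) {s..t}" if "a \<le> s" "s \<le> t" "t \<le> b" for s t
      using that by (intro fundamental_theorem_of_calculus)
        (auto simp flip: has_real_derivative_iff_has_vector_derivative intro!: has_field_derivative_subset[OF \<phi>])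
    have gxy: "(g has_integral (F y - F x)) {x..y}"
      using F xy gn[of x y] by (auto simp: primitive_on_def has_integral_iff)
    \<comment> \<open>The increment of the product is split as (\<phi> y - \<phi> x) F y + \<phi> x
      (F y - F x). Subtracting the integral of u leaves only differences of F and of \<phi> inside
      [x, y], which are small.\<close>
    have "((\<lambda>t. \<phi>' t *\<^sub>R F y + \<phi> x *\<^sub>R g t) has_integral ((\<phi> y - \<phi> x) *\<^sub>R F y + \<phi> x *\<^sub>R (F y - F x))) {x..y}"
      using has_integral_scaleR_left[OF \<phi>xy[OF xy], of "F y"] has_integral_cmul[OF gxy, of "\<phi> x"]
      by (rule has_integral_add)
    from has_integral_diff[OF this integrable_integral[OF iu[of x y]]] xy
    have D: "((\<lambda>t. \<phi>' t *\<^sub>R (F y - F t) + (\<phi> x - \<phi> t) *\<^sub>R g t) has_integral (h y - h x)) {x..y}"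
      by (simp add: u_def h_def algebra_simps du[symmetric])
    have Dn: "norm (h y - h x) \<le> integral {x..y} (\<lambda>t. M * G + M * (y - x) * norm (g t))"
      unfolding integral_unique[OF D, symmetric]
    proof (rule integral_norm_bound_integral)
      show "(\<lambda>t. \<phi>' t *\<^sub>R (F y - F t) + (\<phi> x - \<phi> t) *\<^sub>R g t) integrable_on {x..y}" using D by blast
      show "(\<lambda>t. M * G + M * (y - x) * norm (g t)) integrable_on {x..y}"
        using gn xy by (intro integrable_add integrable_on_mult_right) auto
      fix t assume t: "t \<in> {x..y}"
      have "norm (F y - F t) \<le> integral {t..y} (\<lambda>t. norm (g t))"
        using xy t by (intro primitive_on_norm_le[OF F]) auto
      also have "\<dots> \<le> G"
        unfolding G_def using xy t gn by (intro integral_subset_le) auto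
      finally have 1: "norm (F y - F t) \<le> G" .
      have "norm (\<phi> t - \<phi> x) \<le> M * (t - x)"
      proof -
        have "norm (integral {x..t} \<phi>') \<le> integral {x..t} (\<lambda>_. M)"
          using xy t \<phi>xy[of x t] M by (intro integral_norm_bound_integral) auto
        then show ?thesis using \<phi>xy[of x t] xy t by (auto dest!: integral_unique simp: mult.commute)
      qed
      also have "\<dots> \<le> M * (y - x)" using t M by auto
      finally have 2: "\<bar>\<phi> x - \<phi> t\<bar> \<le> M * (y - x)" by (simp add: abs_minus_commute)
      have "norm (\<phi>' t *\<^sub>R (F y - F t) + (\<phi> x - \<phi> t) *\<^sub>R g t)
        \<le> \<bar>\<phi>' t\<bar> * norm (F y - F t) + \<bar>\<phi> x - \<phi> t\<bar> * norm (g t)"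
        by (rule norm_triangle_le) simp
      also have "\<dots> \<le> M * G + M * (y - x) * norm (g t)"
        using 1 2 M(1) M(2)[of t] xy t by (intro add_mono mult_mono) auto
      finally show "norm (\<phi>' t *\<^sub>R (F y - F t) + (\<phi> x - \<phi> t) *\<^sub>R g t) \<le> M * G + M * (y - x) * norm (g t)" .
    qed
    also have "\<dots> = (y - x) * (V y - V x)"
    proof -
      have "((\<lambda>t. M * G + M * (y - x) * norm (g t)) has_integral ((y - x) * (M * G) + M * (y - x) * G)) {x..y}"
        using xy gn[of x y] has_integral_const_real[of "M * G" x y] unfolding G_def
        by (intro has_integral_add has_integral_mult_right integrable_integral) auto
      then show ?thesis by (simp add: integral_unique dV algebra_simps)
    qed
    finally show "norm (h y - h x) \<le> (y - x) * (V y - V x)" .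
  qed
  then have "integral {a..b} u = \<phi> b *\<^sub>R F b - \<phi> a *\<^sub>R F a" by (simp add: h_def algebra_simps)
  then show ?thesis using iu[of a b] unfolding u_def by (auto simp: has_integral_iff)
qed

section \<open>Functions determined almost everywhere by their integrals over intervals\<close>

text \<open>By Lebesgue differentiation f is almost everywhere the limit of its averages over
  [x, x + h], all of which vanish. The right endpoint d admits no such interval and is added to the
  null set.\<close>

lemma negligible_nonzero_of_integrals_zero_cbox:
  fixes f :: "real \<Rightarrow> 'a::euclidean_space"
  assumes int: "f integrable_on {c..d}" and zero: "\<And>a b. c \<le> a \<Longrightarrow> a \<le> b \<Longrightarrow> b \<le> d \<Longrightarrow> integral {a..b} f = 0"
  shows "negligible {x \<in> {c..d}. f x \<noteq> 0}"
proof -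
  let ?f = "\<lambda>x. if x \<in> {c..d} then f x else 0"
  have "?f integrable_on cbox a b" for a b
    using int by (intro integrable_on_subcbox[of ?f UNIV]) (simp_all only: integrable_restrict_UNIV subset_UNIV)
  then have "\<exists>N. negligible N \<and> (\<forall>x e. x \<notin> N \<longrightarrow> 0 < e \<longrightarrow> (\<exists>r>0. \<forall>h. 0 < h \<and> h < r \<longrightarrow>
      norm (integral (cbox x (x + h *\<^sub>R One)) ?f /\<^sub>R h ^ DIM(real) - ?f x) < e))"
    by (rule integrable_ccontinuous_explicit) blast
  then obtain N where N: "negligible N" "\<And>x e. \<lbrakk>x \<notin> N; 0 < e\<rbrakk> \<Longrightarrow> \<exists>r>0. \<forall>h. 0 < h \<and> h < r \<longrightarrow>
      norm (integral (cbox x (x + h *\<^sub>R One)) ?f /\<^sub>R h ^ DIM(real) - ?f x) < e"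
    by blast
  have "f x = 0" if x: "x \<in> {c..<d}" "x \<notin> N" for x
  proof (rule ccontr)
    assume "f x \<noteq> 0"
    then obtain r where r: "r > 0" "\<And>h. 0 < h \<Longrightarrow> h < r \<Longrightarrow> norm (integral {x..x + h} ?f /\<^sub>R h - ?f x) < norm (f x)"
      using N(2)[OF x(2), of "norm (f x)"] by auto
    define h where "h = min (r / 2) (d - x)"
    have h: "h > 0" "h < r" "x + h \<le> d" using r x by (auto simp: h_def)
    have "integral {x..x + h} ?f = integral {x..x + h} f"
      using x h by (intro integral_cong) auto
    also have "\<dots> = 0" using zero[of x "x + h"] x h by auto
    finally show False using r(2)[of h] h x by auto
  qed
  then have "{x \<in> {c..d}. f x \<noteq> 0} \<subseteq> N \<union> {d}" by force
  then show ?thesis using N(1) by (meson negligible_Un negligible_sing negligible_subset)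
qed

lemma negligible_nonzero_of_integrals_zero:
  fixes f :: "real \<Rightarrow> 'a::euclidean_space"
  assumes int: "\<And>c d. 0 < c \<Longrightarrow> d < 1 \<Longrightarrow> f integrable_on {c..d}"
    and zero: "\<And>a b. 0 < a \<Longrightarrow> a \<le> b \<Longrightarrow> b < 1 \<Longrightarrow> integral {a..b} f = 0"
  shows "negligible {x \<in> {0<..<1}. f x \<noteq> 0}"
proof -
  let ?c = "\<lambda>n. 1 / real (n + 2)"
  have "{x \<in> {0<..<1}. f x \<noteq> 0} \<subseteq> (\<Union>n. {x \<in> {?c n..1 - ?c n}. f x \<noteq> 0})"
  proof clarify
    fix x assume x: "x \<in> {0<..<1::real}" "f x \<noteq> 0"
    then obtain n where n: "inverse (real (Suc n)) < min x (1 - x)"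
      using reals_Archimedean[of "min x (1 - x)"] by auto
    have "?c n \<le> inverse (real (Suc n))" by (simp add: field_simps)
    then show "x \<in> (\<Union>n. {x \<in> {?c n..1 - ?c n}. f x \<noteq> 0})" using n x by (intro UN_I[of n]) auto
  qed
  moreover have "negligible {x \<in> {?c n..1 - ?c n}. f x \<noteq> 0}" for n
  proof (rule negligible_nonzero_of_integrals_zero_cbox)
    have c: "0 < ?c n" by simp
    then show "f integrable_on {?c n..1 - ?c n}" by (intro int) auto
    show "integral {a..b} f = 0" if "?c n \<le> a" "a \<le> b" "b \<le> 1 - ?c n" for a b
      using that c by (intro zero) linarith+
  qed
  ultimately show ?thesis
    by (meson negligible_Union_nat negligible_subset)
qed

text \<open>Compact subintervals are the right setting because the function picked by
  \<open>weak_derivative\<close> is only known to be locally integrable in (0,1).\<close>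

lemma primitive_on_unique:
  fixes F :: "real \<Rightarrow> 'a::euclidean_space"
  assumes "\<And>c d. 0 < c \<Longrightarrow> d < 1 \<Longrightarrow> primitive_on c d F g" "\<And>c d. 0 < c \<Longrightarrow> d < 1 \<Longrightarrow> primitive_on c d F h"
  shows "negligible {x \<in> {0<..<1}. g x \<noteq> h x}"
proof -
  have "negligible {x \<in> {0<..<1}. g x - h x \<noteq> 0}"
  proof (rule negligible_nonzero_of_integrals_zero)
    show "(\<lambda>x. g x - h x) integrable_on {c..d}" if "0 < c" "d < 1" for c d
      using assms[OF that] by (auto simp: primitive_on_def absolutely_integrable_on_def intro: integrable_diff)
    show "integral {a..b} (\<lambda>x. g x - h x) = 0" if ab: "0 < a" "a \<le> b" "b < 1" for a b
      using assms[OF ab(1,3)] ab(2)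
      by (subst Henstock_Kurzweil_Integration.integral_diff)
         (auto simp: primitive_on_def absolutely_integrable_on_def)
  qed
  then show ?thesis by simp
qed

section \<open>Test functions\<close>

text \<open>A finite order of smoothness, so that closure under sums, products and affine
  substitutions goes by induction on n. All orders together give the smoothness in
  \<open>test_function\<close>.\<close>

definition smooth_upto :: "nat \<Rightarrow> (real \<Rightarrow> real) \<Rightarrow> bool" where
  "smooth_upto n f \<longleftrightarrow> (\<forall>k<n. \<forall>x. (deriv ^^ k) f field_differentiable (at x))"

lemma smooth_upto_0 [simp]: "smooth_upto 0 f"
  by (simp add: smooth_upto_def)

lemma smooth_upto_Suc:
  "smooth_upto (Suc n) f \<longleftrightarrow> (\<forall>x. f field_differentiable (at x)) \<and> smooth_upto n (deriv f)"
  unfolding smooth_upto_def by (auto simp: less_Suc_eq_0_disj funpow_Suc_right simp del: funpow.simps)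

lemma smooth_upto_mono: "smooth_upto n f \<Longrightarrow> m \<le> n \<Longrightarrow> smooth_upto m f"
  by (simp add: smooth_upto_def)

lemma smooth_upto_DERIV:
  assumes "\<And>x. (f has_field_derivative f' x) (at x)" "smooth_upto n f'"
  shows "smooth_upto (Suc n) f"
proof -
  have "deriv f = f'" using assms(1) by (auto intro: DERIV_imp_deriv)
  then show ?thesis
    using assms by (auto simp: smooth_upto_Suc field_differentiable_def)
qed

lemma smooth_upto_add: "smooth_upto n f \<Longrightarrow> smooth_upto n g \<Longrightarrow> smooth_upto n (\<lambda>x. f x + g x)"
proof (induction n arbitrary: f g)
  case (Suc n)
  then show ?case
    by (intro smooth_upto_DERIV[where f' = "\<lambda>x. deriv f x + deriv g x"])
       (auto simp: smooth_upto_Suc intro!: derivative_intros simp flip: DERIV_deriv_iff_field_differentiable)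
qed simp

lemma smooth_upto_mult: "smooth_upto n f \<Longrightarrow> smooth_upto n g \<Longrightarrow> smooth_upto n (\<lambda>x. f x * g x)"
proof (induction n arbitrary: f g)
  case (Suc n)
  have le: "smooth_upto n f" "smooth_upto n g" using Suc.prems smooth_upto_mono le_SucI by blast+
  have d: "smooth_upto n (deriv f)" "smooth_upto n (deriv g)" using Suc.prems by (auto simp: smooth_upto_Suc)
  have "smooth_upto n (\<lambda>x. deriv f x * g x + deriv g x * f x)"
    by (intro smooth_upto_add Suc.IH le d)
  then show ?case
    using Suc.prems
    by (intro smooth_upto_DERIV[where f' = "\<lambda>x. deriv f x * g x + deriv g x * f x"])
       (auto simp: smooth_upto_Suc intro!: DERIV_mult simp flip: DERIV_deriv_iff_field_differentiable)
qed simp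

lemma smooth_upto_const: "smooth_upto n (\<lambda>x. c)"
proof (induction n arbitrary: c)
  case (Suc n)
  then show ?case by (intro smooth_upto_DERIV[where f' = "\<lambda>_. 0"]) auto
qed simp

lemma smooth_upto_affine: "smooth_upto n f \<Longrightarrow> smooth_upto n (\<lambda>x. f (a * x + b))"
proof (induction n arbitrary: f)
  case (Suc n)
  have d: "(f has_field_derivative deriv f x) (at x)" for x
    using Suc.prems by (auto simp: smooth_upto_Suc DERIV_deriv_iff_field_differentiable)
  have D: "((\<lambda>x. f (a * x + b)) has_field_derivative deriv f (a * x + b) * a) (at x)" for x
    by (rule DERIV_chain2[OF d]) (auto intro!: derivative_eq_intros)
  have "smooth_upto n (\<lambda>x. deriv f (a * x + b) * a)"
    using Suc.IH[of "deriv f"] Suc.prems by (intro smooth_upto_mult smooth_upto_const) (auto simp: smooth_upto_Suc)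
  then show ?case using D by (rule smooth_upto_DERIV[rotated])
qed simp

section \<open>A smooth step function built from exp (- 1 / x)\<close>

text \<open>With the polynomial factor the family is closed under differentiation, so one induction
  over all p proves smoothness. The case p = 1 is the classical flat function.\<close>

definition flat :: "real poly \<Rightarrow> real \<Rightarrow> real" where
  "flat p x = (if x > 0 then poly p (1 / x) * exp (- (1 / x)) else 0)"

lemma tendsto_poly_mult_exp_minus: "((\<lambda>y. poly p y * exp (- y)) \<longlongrightarrow> 0) at_top" for p :: "real poly"
proof -
  have "((\<lambda>y. \<Sum>i\<le>degree p. coeff p i * (y ^ i / exp y)) \<longlongrightarrow> (\<Sum>i\<le>degree p. coeff p i * 0)) at_top"
    by (intro tendsto_intros tendsto_power_div_exp_0)
  then show ?thesis
    by (simp add: poly_altdef sum_distrib_right exp_minus divide_inverse mult.assoc)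
qed

lemma flat_DERIV:
  "(flat p has_field_derivative flat ([:0, 0, 1:] * (p - pderiv p)) x) (at x)"
proof -
  let ?q = "[:0, 0, 1:] * (p - pderiv p)"
  consider "x > 0" | "x < 0" | "x = 0" by linarith
  then show ?thesis
  proof cases
    case 1
    have "((\<lambda>x. poly p (1 / x) * exp (- (1 / x))) has_field_derivative flat ?q x) (at x)"
      using 1 by (auto intro!: derivative_eq_intros DERIV_chain2[OF poly_DERIV] simp: flat_def field_simps power2_eq_square)
    then show ?thesis
      by (rule has_field_derivative_transform_within_open[where S = "{0<..}"]) (use 1 in \<open>auto simp: flat_def\<close>)
  next
    case 2
    have "((\<lambda>x. 0) has_field_derivative flat ?q x) (at x)"
      using 2 by (auto simp: flat_def)
    then show ?thesis
      by (rule has_field_derivative_transform_within_open[where S = "{..<0}"]) (use 2 in \<open>auto simp: flat_def\<close>)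
  next
    case 3
    \<comment> \<open>With y = 1 / h the difference quotient at 0 is y p(y) exp (- y).\<close>
    have r: "((\<lambda>h. poly ([:0, 1:] * p) (inverse h) * exp (- inverse h)) \<longlongrightarrow> 0) (at_right 0)"
      by (rule filterlim_compose[OF tendsto_poly_mult_exp_minus filterlim_inverse_at_top_right])
    have "((\<lambda>h. (flat p (0 + h) - flat p 0) / h) \<longlongrightarrow> 0) (at_right 0)"
      by (rule Lim_transform_eventually[OF r])
         (auto simp: eventually_at_filter flat_def field_simps intro!: always_eventually)
    moreover have "((\<lambda>h. (flat p (0 + h) - flat p 0) / h) \<longlongrightarrow> 0) (at_left 0)"
      by (rule tendsto_eventually) (auto simp: eventually_at_filter flat_def)
    ultimately have "((\<lambda>h. (flat p (0 + h) - flat p 0) / h) \<longlongrightarrow> 0) (at 0)"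
      by (simp add: filterlim_at_split)
    moreover have "flat ?q 0 = 0" by (simp add: flat_def)
    ultimately show ?thesis unfolding 3 by (simp add: DERIV_def)
  qed
qed

lemma smooth_upto_flat: "smooth_upto n (flat p)"
proof (induction n arbitrary: p)
  case (Suc n)
  then show ?case using flat_DERIV by (rule smooth_upto_DERIV[rotated])
qed simp

lemma smooth_step_exists:
  obtains H :: "real \<Rightarrow> real" where "\<And>n. smooth_upto n H" "\<And>x. x \<le> 0 \<Longrightarrow> H x = 0" "\<And>x. 1 \<le> x \<Longrightarrow> H x = 1"
    "\<And>x. 0 \<le> H x" "\<And>x. H x \<le> 1" "\<And>x. 0 \<le> deriv H x"
proof -
  define \<psi> where "\<psi> x = flat 1 x * flat 1 (- 1 * x + 1)" for x
  have s\<psi>: "smooth_upto n \<psi>" for n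
    unfolding \<psi>_def by (intro smooth_upto_mult smooth_upto_affine smooth_upto_flat)
  have \<psi>0: "\<psi> x \<ge> 0" for x by (simp add: \<psi>_def flat_def)
  have \<psi>z: "\<psi> x = 0" if "x \<le> 0 \<or> 1 \<le> x" for x using that by (auto simp: \<psi>_def flat_def)
  have \<psi>pos: "\<psi> x > 0" if "0 < x" "x < 1" for x using that by (auto simp: \<psi>_def flat_def)
  have "\<psi> field_differentiable (at x)" for x using s\<psi>[of 1] by (auto simp: smooth_upto_def)
  then have cont: "continuous_on S \<psi>" for S
    by (meson continuous_at_imp_continuous_on field_differentiable_imp_continuous_at)
  have int: "\<psi> integrable_on {a..b}" for a b by (intro integrable_continuous_interval cont)
  \<comment> \<open>The base point -1 rather than 0 makes 0 an interior point, so that G has a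
    two-sided derivative there.\<close>
  define G where "G x = integral {-1..x} \<psi>" for x
  have Gneg: "G x = 0" if "x \<le> 0" for x
  proof -
    have "G x = integral {-1..x} (\<lambda>_. 0)" unfolding G_def using that \<psi>z by (intro integral_cong) auto
    then show ?thesis by simp
  qed
  have dG: "(G has_field_derivative \<psi> x) (at x)" for x
  proof (cases "x < 0")
    case True
    have "((\<lambda>x. 0) has_field_derivative \<psi> x) (at x)" using True \<psi>z[of x] by auto
    then show ?thesis
      by (rule has_field_derivative_transform_within_open[where S = "{..<0}"]) (use True Gneg in auto)
  next
    case False
    have "(G has_real_derivative \<psi> x) (at x within {-1..x + 1})"
      unfolding G_def using False by (intro integral_has_real_derivative cont) auto
    then show ?thesis using False by (simp add: at_within_Icc_at)
  qed
  have mono: "G x \<le> G y" if "x \<le> y" for x y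
    unfolding G_def using that \<psi>0 by (intro integral_subset_le int) auto
  define c where "c = G 1"
  have Gone: "G x = c" if "1 \<le> x" for x
  proof -
    have "integral {-1..1} \<psi> + integral {1..x} \<psi> = G x"
      unfolding G_def using that by (intro Henstock_Kurzweil_Integration.integral_combine int) auto
    moreover have "integral {1..x} \<psi> = integral {1..x} (\<lambda>_. 0)" using \<psi>z by (intro integral_cong) auto
    ultimately show ?thesis by (simp add: c_def G_def)
  qed
  have "c > 0"
  proof -
    have "c \<noteq> 0"
    proof
      assume "c = 0"
      then have "integral {-1..1} \<psi> = 0" by (simp add: c_def G_def)
      then have "\<psi> (1/2) = 0"
        using integral_eq_0_iff[of "-1" 1 \<psi>] cont \<psi>0 by auto
      then show False using \<psi>pos[of "1/2"] by simp
    qed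
    moreover have "0 \<le> c" using mono[of 0 1] Gneg[of 0] by (simp add: c_def)
    ultimately show ?thesis by simp
  qed
  show thesis
  proof (rule that[of "\<lambda>x. G x * (1 / c)"])
    have "smooth_upto n G" for n
      using smooth_upto_mono[OF smooth_upto_DERIV[OF dG s\<psi>], of n n] by simp
    then show "smooth_upto n (\<lambda>x. G x * (1 / c))" for n
      by (intro smooth_upto_mult smooth_upto_const)
    show "G x * (1 / c) = 0" if "x \<le> 0" for x using Gneg[OF that] by simp
    show "G x * (1 / c) = 1" if "1 \<le> x" for x using Gone[OF that] \<open>c > 0\<close> by simp
    show "0 \<le> G x * (1 / c)" for x
      using mono[of "min 0 x" x] Gneg[of "min 0 x"] \<open>c > 0\<close> by simp
    show "G x * (1 / c) \<le> 1" for x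
      using mono[of x "max 1 x"] Gone[of "max 1 x"] \<open>c > 0\<close> by (simp add: field_simps)
    show "0 \<le> deriv (\<lambda>x. G x * (1 / c)) x" for x
      using DERIV_imp_deriv[OF DERIV_cmult_right[OF dG, of "1 / c" x]] \<psi>0[of x] \<open>c > 0\<close> by simp
  qed
qed

lemma test_function_iff:
  "test_function \<phi> \<longleftrightarrow> (\<forall>n. smooth_upto n \<phi>) \<and>
     compact (closure {x. \<phi> x \<noteq> 0}) \<and> closure {x. \<phi> x \<noteq> 0} \<subseteq> I01"
  unfolding test_function_def smooth_upto_def by blast

lemma test_function_deriv:
  assumes "test_function \<phi>"
  shows "(\<phi> has_field_derivative deriv \<phi> x) (at x)" "continuous_on S \<phi>" "continuous_on S (deriv \<phi>)"
    "x \<notin> I01 \<Longrightarrow> \<phi> x = 0" "test_function (deriv \<phi>)"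
proof -
  have s: "smooth_upto n \<phi>" for n using assms by (simp add: test_function_iff)
  have s': "smooth_upto n (deriv \<phi>)" for n using s[of "Suc n"] by (simp add: smooth_upto_Suc)
  show d: "(\<phi> has_field_derivative deriv \<phi> x) (at x)" for x
    using s[of 1] by (simp add: smooth_upto_def DERIV_deriv_iff_field_differentiable)
  have "deriv \<phi> field_differentiable (at x)" for x using s'[of 1] by (simp add: smooth_upto_def)
  then show "continuous_on S (deriv \<phi>)"
    by (meson continuous_at_imp_continuous_on field_differentiable_imp_continuous_at)
  show "continuous_on S \<phi>" using d by (meson DERIV_isCont continuous_at_imp_continuous_on)
  show "\<phi> x = 0" if "x \<notin> I01" using that assms closure_subset[of "{x. \<phi> x \<noteq> 0}"] by (auto simp: test_function_def)
  have sub: "closure {x. deriv \<phi> x \<noteq> 0} \<subseteq> closure {x. \<phi> x \<noteq> 0}"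
  proof (rule closure_minimal)
    show "{x. deriv \<phi> x \<noteq> 0} \<subseteq> closure {x. \<phi> x \<noteq> 0}"
    proof (clarify, rule ccontr)
      fix x assume x: "deriv \<phi> x \<noteq> 0" "x \<notin> closure {x. \<phi> x \<noteq> 0}"
      have "((\<lambda>x. 0) has_field_derivative 0) (at x)" by auto
      then have "(\<phi> has_field_derivative 0) (at x)"
        by (rule has_field_derivative_transform_within_open[where S = "- closure {x. \<phi> x \<noteq> 0}"])
           (use x closure_subset[of "{x. \<phi> x \<noteq> 0}"] in auto)
      then show False using x DERIV_imp_deriv by blast
    qed
  qed auto
  have "compact (closure {x. deriv \<phi> x \<noteq> 0})"
    using compact_Int_closed[of "closure {x. \<phi> x \<noteq> 0}" "closure {x. deriv \<phi> x \<noteq> 0}"] assms sub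
    by (auto simp: test_function_def Int_absorb1)
  then show "test_function (deriv \<phi>)"
    using assms sub s' by (auto simp: test_function_iff)
qed

section \<open>Weak derivatives and primitives\<close>

text \<open>Integration by parts; the boundary terms vanish with the test function. Here f may
  differ from F on a null set because \<open>arclength_deriv \<gamma> \<gamma>\<close> equals the
  unit tangent only almost everywhere.\<close>

lemma has_weak_deriv_of_primitive:
  fixes F g :: "real \<Rightarrow> 'a::euclidean_space"
  assumes F: "primitive_on 0 1 F g" and N: "negligible {x \<in> I01. f x \<noteq> F x}"
  shows "has_weak_deriv 1 f g"
  unfolding has_weak_deriv_def
proof (intro conjI allI impI)
  have ga: "g absolutely_integrable_on {0..1}" using F by (simp add: primitive_on_def)
  have cF: "continuous_on {0..1} F" using F by (rule continuous_on_primitive)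
  have Fa: "F absolutely_integrable_on {0..1}" using cF by (rule absolutely_integrable_continuous_real)
  have sub: "h absolutely_integrable_on K" if "h absolutely_integrable_on {0..1}" "compact K" "K \<subseteq> I01"
    for h :: "real \<Rightarrow> 'a" and K
    by (rule set_integrable_subset[OF that(1)]) (use that in \<open>auto intro: lmeasurable_compact fmeasurableD\<close>)
  show "locally_integrable g" unfolding locally_integrable_def using ga sub by blast
  show "locally_integrable f" unfolding locally_integrable_def
  proof (intro allI impI)
    fix K assume K: "compact K" "K \<subseteq> I01"
    show "f absolutely_integrable_on K"
      by (rule absolutely_integrable_spike[OF sub[OF Fa K] N]) (use K in auto)
  qed
  fix \<phi> assume \<phi>: "test_function \<phi>"
  note t = test_function_deriv[OF \<phi>]
  have parts: "((\<lambda>x. deriv \<phi> x *\<^sub>R F x + \<phi> x *\<^sub>R g x) has_integral (\<phi> 1 *\<^sub>R F 1 - \<phi> 0 *\<^sub>R F 0)) {0..1}"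
    using t by (intro integration_by_parts_primitive F) (auto intro: has_field_derivative_at_within)
  have a1: "(\<lambda>x. deriv \<phi> x *\<^sub>R F x) absolutely_integrable_on {0..1}"
    and a2: "(\<lambda>x. \<phi> x *\<^sub>R g x) absolutely_integrable_on {0..1}"
    using t Fa ga by (auto intro: absolutely_integrable_continuous_scaleR)
  have "integral {0..1} (\<lambda>x. deriv \<phi> x *\<^sub>R F x) + integral {0..1} (\<lambda>x. \<phi> x *\<^sub>R g x) = 0"
    using integral_unique[OF parts] t(4)[of 0] t(4)[of 1]
      Henstock_Kurzweil_Integration.integral_add[OF a1[THEN set_lebesgue_integral_eq_integral(1)] a2[THEN set_lebesgue_integral_eq_integral(1)]]
    by simp
  moreover have "(LINT x:I01|lebesgue. \<phi> x *\<^sub>R g x) = integral {0..1} (\<lambda>x. \<phi> x *\<^sub>R g x)"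
    using a2 by (simp add: absolutely_integrable_on_Icc_iff_Ioo set_lebesgue_integral_eq_integral(2) integral_open_interval_real)
  moreover have "(LINT x:I01|lebesgue. deriv \<phi> x *\<^sub>R f x) = integral {0..1} (\<lambda>x. deriv \<phi> x *\<^sub>R F x)"
  proof -
    have "(\<lambda>x. deriv \<phi> x *\<^sub>R f x) absolutely_integrable_on I01"
      using absolutely_integrable_spike[OF a1[unfolded absolutely_integrable_on_Icc_iff_Ioo] N, of "\<lambda>x. deriv \<phi> x *\<^sub>R f x"] by auto
    then have "(LINT x:I01|lebesgue. deriv \<phi> x *\<^sub>R f x) = integral I01 (\<lambda>x. deriv \<phi> x *\<^sub>R f x)"
      by (rule set_lebesgue_integral_eq_integral(2))
    also have "\<dots> = integral I01 (\<lambda>x. deriv \<phi> x *\<^sub>R F x)"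
      by (rule integral_spike[OF N]) auto
    finally show ?thesis by (simp add: integral_open_interval_real)
  qed
  ultimately show "(LINT x:I01|lebesgue. (deriv ^^ 1) \<phi> x *\<^sub>R f x)
          = (-1) ^ 1 *\<^sub>R (LINT x:I01|lebesgue. \<phi> x *\<^sub>R g x)"
    by (simp add: eq_neg_iff_add_eq_0)
qed

text \<open>The lemma of du Bois-Reymond, tested on smooth approximations of the indicator of \<open>(a, b]\<close>.\<close>
lemma primitive_of_has_weak_deriv:
  fixes F g :: "real \<Rightarrow> 'a::euclidean_space"
  assumes w: "has_weak_deriv 1 f g" and N: "negligible {x \<in> I01. f x \<noteq> F x}"
    and F: "continuous_on I01 F" and cd: "0 < c" "d < 1"
  shows "primitive_on c d F g"
  unfolding primitive_on_def
proof (intro conjI allI impI)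
  have loc: "f absolutely_integrable_on {a..b}" "g absolutely_integrable_on {a..b}" if "0 < a" "b < 1" for a b
  proof -
    have "{a..b} \<subseteq> I01" using that by auto
    then show "f absolutely_integrable_on {a..b}" "g absolutely_integrable_on {a..b}"
      using w by (simp_all add: has_weak_deriv_def locally_integrable_def)
  qed
  show "g absolutely_integrable_on {c..d}" using loc cd by blast
  fix a b assume "c \<le> a" "a \<le> b" "b \<le> d"
  then have ab: "0 < a" "a \<le> b" "b < 1" using cd by auto
  obtain H where H: "\<And>n. smooth_upto n H" "\<And>x. x \<le> 0 \<Longrightarrow> H x = 0" "\<And>x. 1 \<le> x \<Longrightarrow> H x = 1"
    "\<And>x. 0 \<le> H x" "\<And>x. H x \<le> 1" "\<And>x. 0 \<le> deriv H x"
    using smooth_step_exists by blast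
  have dH: "(H has_field_derivative deriv H x) (at x)" for x
    using H(1)[of 1] by (simp add: smooth_upto_def DERIV_deriv_iff_field_differentiable)
  have cdH: "continuous_on S (deriv H)" for S
  proof -
    have "deriv H field_differentiable (at x)" for x using H(1)[of 2] unfolding smooth_upto_def by (auto dest: spec[of _ 1])
    then show ?thesis by (meson continuous_at_imp_continuous_on field_differentiable_imp_continuous_at)
  qed
  have dH0: "deriv H x = 0" if "x \<le> 0 \<or> 1 \<le> x" for x
  proof -
    have "(H has_field_derivative 0) (at x)" if "x < 0 \<or> 1 < x" for x
      using that
    proof
      assume "x < 0"
      then show ?thesis
        by (intro has_field_derivative_transform_within_open[of "\<lambda>_. 0" _ _ "{..<0}" H]) (auto simp: H)
    next
      assume "1 < x"
      then show ?thesis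
        by (intro has_field_derivative_transform_within_open[of "\<lambda>_. 1" _ _ "{1<..}" H]) (auto simp: H)
    qed
    then have z: "deriv H x = 0" if "x \<in> {..<0} \<union> {1<..}" for x using that DERIV_imp_deriv by blast
    have "closure ({..<0} \<union> {1<..}) = {..0} \<union> {1::real..}" by (simp add: closure_lessThan closure_greaterThan)
    then show ?thesis
      using continuous_constant_on_closure[of "{..<0} \<union> {1<..}" "deriv H" 0 x] cdH z that by auto
  qed
  \<comment> \<open>Room to the right of b: for large n the steps have reached 1 before e < 1, so
    the approximations are supported in [a, e].\<close>
  define e where "e = (b + 1) / 2"
  have e: "b < e" "e < 1" using ab by (auto simp: e_def)
  \<comment> \<open>\<open>W s n\<close> is the derivative of the step rising on [s, s + 1 / n]: an
    approximate identity at s from the right.\<close>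
  define W where "W s n x = real n * deriv H (real n * x + - (real n * s))" for s n x
  define \<phi> where "\<phi> n x = H (real n * x + - (real n * a)) - H (real n * x + - (real n * b))" for n x
  have dHs: "((\<lambda>x. H (real n * x + - (real n * s))) has_field_derivative W s n x) (at x within S)" for n s x S
    unfolding W_def
    by (rule has_field_derivative_at_within, rule DERIV_chain2[OF dH, THEN DERIV_cong]) (auto intro!: derivative_eq_intros)
  have d\<phi>: "(\<phi> n has_field_derivative W a n x - W b n x) (at x)" for n x
    unfolding \<phi>_def by (intro DERIV_diff dHs)
  then have deriv\<phi>: "deriv (\<phi> n) = (\<lambda>x. W a n x - W b n x)" for n
    using DERIV_imp_deriv by blast
  have cW: "continuous_on S (W s n)" for S s n
    unfolding W_def by (intro continuous_intros continuous_on_compose2[OF cdH[of UNIV]]) auto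
  obtain n0 :: nat where n0: "1 / (e - b) < real n0" using reals_Archimedean2 by blast
  have n: "n > 0" "1 / real n < e - b" if "n \<ge> n0" for n
  proof -
    have "1 / (e - b) < real n" using n0 that by (meson less_le_trans of_nat_le_iff)
    moreover have "0 < 1 / (e - b)" using e by simp
    ultimately have "0 < real n" by linarith
    moreover have "1 < real n * (e - b)"
      using \<open>1 / (e - b) < real n\<close> e by (simp add: divide_less_eq)
    ultimately show "n > 0" "1 / real n < e - b" by (auto simp: field_simps)
  qed
  have big: "1 \<le> real n * x + - (real n * s)" if "n \<ge> n0" "s \<le> b" "e \<le> x" for n x s
  proof -
    have "real n * (e - b) \<le> real n * (x - s)" using that by (intro mult_left_mono) auto
    moreover have "1 < real n * (e - b)" using n[OF that(1)] by (simp add: field_simps)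
    ultimately show ?thesis by (simp add: algebra_simps)
  qed
  have small: "real n * x + - (real n * s) \<le> 0" if "x \<le> s" for n x s
    using that by (simp add: mult_left_mono)
  have \<phi>z: "\<phi> n x = 0" if "n \<ge> n0" "x \<notin> {a..e}" for n x
  proof (cases "x < a")
    case True
    then show ?thesis using small[of x a n] small[of x b n] ab by (simp add: \<phi>_def H)
  next
    case False
    then show ?thesis using big[OF that(1), of a x] big[OF that(1), of b x] that ab by (simp add: \<phi>_def H)
  qed
  have Wz: "W s n x = 0" if "n \<ge> n0" "a \<le> s" "s \<le> b" "x \<notin> {a..e}" for n x s
  proof (cases "x < a")
    case True
    then show ?thesis using small[of x s n] that by (simp add: W_def dH0)
  next
    case False
    then show ?thesis using big[OF that(1), of s x] that by (simp add: W_def dH0)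
  qed
  have tst: "test_function (\<phi> n)" if "n \<ge> n0" for n
  proof -
    have "smooth_upto k (\<lambda>x. H (real n * x + - (real n * a)) + - 1 * H (real n * x + - (real n * b)))" for k
      by (intro smooth_upto_add smooth_upto_mult smooth_upto_const smooth_upto_affine H)
    then have s: "smooth_upto k (\<phi> n)" for k by (simp add: \<phi>_def[abs_def])
    have "{x. \<phi> n x \<noteq> 0} \<subseteq> {a..e}" using \<phi>z[OF that] by blast
    then have "closure {x. \<phi> n x \<noteq> 0} \<subseteq> {a..e}" by (intro closure_minimal) auto
    moreover have "compact (closure {x. \<phi> n x \<noteq> 0})"
      using calculation by (metis closed_closure compact_Icc compact_Int_closed inf.absorb_iff2)
    ultimately show ?thesis using s ab e by (force simp: test_function_iff)
  qed
  have restrict: "(LINT x:I01|lebesgue. h x) = integral {a..e} h"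
    if "h absolutely_integrable_on {a..e}" "\<And>x. x \<notin> {a..e} \<Longrightarrow> h x = 0" for h :: "real \<Rightarrow> 'a"
  proof -
    have "(LINT x:I01|lebesgue. h x) = (LINT x:{a..e}|lebesgue. h x)"
      unfolding set_lebesgue_integral_def using that(2) ab e
      by (intro Bochner_Integration.integral_cong) (auto simp: indicator_def)
    then show ?thesis using that(1) by (simp add: set_lebesgue_integral_eq_integral(2))
  qed
  have e01: "{a..e} \<subseteq> I01" using ab e by auto
  have cFe: "continuous_on {a..e} F" using F e01 by (rule continuous_on_subset)
  have A: "integral {a..e} (\<lambda>x. W a n x *\<^sub>R F x) - integral {a..e} (\<lambda>x. W b n x *\<^sub>R F x)
    = - integral {a..e} (\<lambda>x. \<phi> n x *\<^sub>R g x)" if nn: "n \<ge> n0" for n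
  proof -
    have a1: "(\<lambda>x. deriv (\<phi> n) x *\<^sub>R f x) absolutely_integrable_on {a..e}"
      using loc[of a e] ab e unfolding deriv\<phi> by (intro absolutely_integrable_continuous_scaleR continuous_intros cW) auto
    have a2: "(\<lambda>x. \<phi> n x *\<^sub>R g x) absolutely_integrable_on {a..e}"
      using loc[of a e] ab e test_function_deriv(2)[OF tst[OF nn]] by (intro absolutely_integrable_continuous_scaleR) auto
    have "(LINT x:I01|lebesgue. deriv (\<phi> n) x *\<^sub>R f x) = - (LINT x:I01|lebesgue. \<phi> n x *\<^sub>R g x)"
      using w tst[OF nn] unfolding has_weak_deriv_def by auto
    moreover have "(LINT x:I01|lebesgue. deriv (\<phi> n) x *\<^sub>R f x) = integral {a..e} (\<lambda>x. deriv (\<phi> n) x *\<^sub>R f x)"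
      using Wz[OF nn] ab by (intro restrict a1) (auto simp: deriv\<phi>)
    moreover have "(LINT x:I01|lebesgue. \<phi> n x *\<^sub>R g x) = integral {a..e} (\<lambda>x. \<phi> n x *\<^sub>R g x)"
      using \<phi>z[OF nn] by (intro restrict a2) auto
    moreover have "integral {a..e} (\<lambda>x. deriv (\<phi> n) x *\<^sub>R f x) = integral {a..e} (\<lambda>x. deriv (\<phi> n) x *\<^sub>R F x)"
      using e01 by (intro integral_spike[OF N]) auto
    moreover have "integral {a..e} (\<lambda>x. deriv (\<phi> n) x *\<^sub>R F x)
       = integral {a..e} (\<lambda>x. W a n x *\<^sub>R F x) - integral {a..e} (\<lambda>x. W b n x *\<^sub>R F x)"
      unfolding deriv\<phi> scaleR_diff_left
      by (intro Henstock_Kurzweil_Integration.integral_diff integrable_continuous_interval continuous_intros cW cFe)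
    ultimately show ?thesis by simp
  qed
  \<comment> \<open>\<open>W s n\<close> is nonnegative with mass 1 and concentrates at s, where F
    is continuous.\<close>
  have lim_F: "(\<lambda>n. integral {a..e} (\<lambda>x. W s n x *\<^sub>R F x)) \<longlonglongrightarrow> F s" if s: "a \<le> s" "s \<le> b" for s
  proof (rule LIMSEQ_I)
    fix r :: real assume r: "r > 0"
    have "isCont F s" using F s ab by (simp add: continuous_on_eq_continuous_at)
    then obtain \<delta> where \<delta>: "\<delta> > 0" "\<And>x. norm (x - s) < \<delta> \<Longrightarrow> norm (F x - F s) < r / 2"
      using r by (metis half_gt_zero isCont_iff continuous_at_eps_delta dist_norm)
    obtain n1 :: nat where n1: "1 / \<delta> < real n1" using reals_Archimedean2 by blast
    have "norm (integral {a..e} (\<lambda>x. W s n x *\<^sub>R F x) - F s) < r" if nn: "n \<ge> max n0 n1" for n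
    proof -
      have W1: "(W s n has_integral 1) {a..e}"
      proof -
        have "(W s n has_integral (H (real n * e + - (real n * s)) - H (real n * a + - (real n * s)))) {a..e}"
          using dHs ab e s
          by (intro fundamental_theorem_of_calculus) (auto simp flip: has_real_derivative_iff_has_vector_derivative)
        then show ?thesis using H(2)[OF small[of a s n]] H(3)[OF big[of n s e]] s nn by simp
      qed
      have i: "(\<lambda>x. W s n x *\<^sub>R F x) integrable_on {a..e}"
        by (intro integrable_continuous_interval continuous_intros cW cFe)
      have "((\<lambda>x. W s n x *\<^sub>R F x - W s n x *\<^sub>R F s) has_integral (integral {a..e} (\<lambda>x. W s n x *\<^sub>R F x) - 1 *\<^sub>R F s)) {a..e}"
        by (intro has_integral_diff integrable_integral i has_integral_scaleR_left W1)
      then have D: "((\<lambda>x. W s n x *\<^sub>R (F x - F s)) has_integral (integral {a..e} (\<lambda>x. W s n x *\<^sub>R F x) - F s)) {a..e}"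
        by (simp add: scaleR_diff_right)
      have "norm (integral {a..e} (\<lambda>x. W s n x *\<^sub>R (F x - F s))) \<le> integral {a..e} (\<lambda>x. W s n x * (r / 2))"
      proof (rule integral_norm_bound_integral)
        show "(\<lambda>x. W s n x *\<^sub>R (F x - F s)) integrable_on {a..e}" using D by blast
        show "(\<lambda>x. W s n x * (r / 2)) integrable_on {a..e}" using has_integral_mult_left[OF W1] by blast
        fix x assume x: "x \<in> {a..e}"
        have W0: "W s n x \<ge> 0" by (simp add: W_def H)
        show "norm (W s n x *\<^sub>R (F x - F s)) \<le> W s n x * (r / 2)"
        proof (cases "norm (x - s) < \<delta>")
          case True
          then have "norm (F x - F s) \<le> r / 2" using \<delta>(2) by (simp add: less_imp_le)
          then show ?thesis using W0 mult_left_mono[of "norm (F x - F s)" "r / 2" "W s n x"] by simp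
        next
          case False
          have "W s n x = 0"
          proof (cases "x \<le> s")
            case True
            then show ?thesis using small[of x s n] by (simp add: W_def dH0)
          next
            case F: False
            have "1 < real n * \<delta>"
            proof -
              have "1 < real n1 * \<delta>" using n1 \<delta> by (simp add: field_simps)
              also have "\<dots> \<le> real n * \<delta>" using nn \<delta> by (intro mult_right_mono) auto
              finally show ?thesis .
            qed
            also have "\<dots> \<le> real n * (x - s)" using False F by (intro mult_left_mono) auto
            finally show ?thesis by (simp add: W_def dH0 algebra_simps)
          qed
          then show ?thesis by simp
        qed
      qed
      also have "\<dots> = r / 2" using integral_unique[OF has_integral_mult_left[OF W1, of "r / 2"]] by simp
      finally show ?thesis using integral_unique[OF D] r by simp
    qed
    then show "\<exists>no. \<forall>n\<ge>no. norm (integral {a..e} (\<lambda>x. W s n x *\<^sub>R F x) - F s) < r" by blast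
  qed
  have gi: "g absolutely_integrable_on {a..e}" using loc[of a e] ab e by auto
  have lim_g: "(\<lambda>n. integral {a..e} (\<lambda>x. \<phi> n x *\<^sub>R g x)) \<longlonglongrightarrow> integral {a..e} (\<lambda>x. if x \<in> {a<..b} then g x else 0)"
  proof (rule dominated_convergence(2))
    show "(\<lambda>x. \<phi> n x *\<^sub>R g x) integrable_on {a..e}" for n
    proof -
      have "continuous_on {a..e} (\<phi> n)" using d\<phi> by (meson DERIV_isCont continuous_at_imp_continuous_on)
      then show ?thesis
        using absolutely_integrable_continuous_scaleR gi set_lebesgue_integral_eq_integral(1) by blast
    qed
    show "(\<lambda>x. norm (g x)) integrable_on {a..e}" using gi by (simp add: absolutely_integrable_on_def)
    show "norm (\<phi> n x *\<^sub>R g x) \<le> norm (g x)" for n x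
    proof -
      have "\<bar>\<phi> n x\<bar> \<le> 1"
        using H(4,5)[of "real n * x + - (real n * a)"] H(4,5)[of "real n * x + - (real n * b)"] unfolding \<phi>_def by linarith
      then show ?thesis by (simp add: mult_left_le_one_le)
    qed
    fix x assume x: "x \<in> {a..e}"
    have ev: "\<forall>\<^sub>F n in sequentially. H (real n * x + - (real n * s)) = (if s < x then 1 else 0)" for s
    proof (cases "s < x")
      case True
      obtain m :: nat where m: "1 / (x - s) < real m" using reals_Archimedean2 by blast
      show ?thesis using eventually_ge_at_top[of m]
      proof eventually_elim
        case (elim n)
        then have "1 / (x - s) < real n" using m by (meson less_le_trans of_nat_le_iff)
        then have "1 < real n * (x - s)" using True by (simp add: field_simps)
        then show ?case using True by (simp add: H algebra_simps)
      qed
    next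
      case False
      then show ?thesis using small[of x s] by (auto simp: H)
    qed
    have "\<forall>\<^sub>F n in sequentially. \<phi> n x *\<^sub>R g x = (if x \<in> {a<..b} then g x else 0)"
      using ev[of a] ev[of b]
    proof eventually_elim
      case (elim n)
      then show ?case using ab x unfolding \<phi>_def by auto
    qed
    then show "(\<lambda>n. \<phi> n x *\<^sub>R g x) \<longlonglongrightarrow> (if x \<in> {a<..b} then g x else 0)"
      by (rule tendsto_eventually)
  qed
  have "integral {a..e} (\<lambda>x. if x \<in> {a<..b} then g x else 0) = integral {a..e} (\<lambda>x. if x \<in> {a..b} then g x else 0)"
    by (rule integral_spike[of "{a}"]) auto
  also have "\<dots> = integral ({a..b} \<inter> {a..e}) g"
    by (rule integral_restrict_Int)
  also have "{a..b} \<inter> {a..e} = {a..b}" using e by auto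
  finally have lim_g': "(\<lambda>n. - integral {a..e} (\<lambda>x. \<phi> n x *\<^sub>R g x)) \<longlonglongrightarrow> - integral {a..b} g"
    using tendsto_minus[OF lim_g] by simp
  have "(\<lambda>n. integral {a..e} (\<lambda>x. W a n x *\<^sub>R F x) - integral {a..e} (\<lambda>x. W b n x *\<^sub>R F x)) \<longlonglongrightarrow> F a - F b"
    using ab by (intro tendsto_diff lim_F) auto
  then have "(\<lambda>n. - integral {a..e} (\<lambda>x. \<phi> n x *\<^sub>R g x)) \<longlonglongrightarrow> F a - F b"
    by (rule Lim_transform_eventually) (use A in \<open>auto simp: eventually_sequentially intro!: exI[of _ n0]\<close>)
  then have "- integral {a..b} g = F a - F b" using lim_g' LIMSEQ_unique by blast
  then show "F b - F a = integral {a..b} g" by (simp add: algebra_simps minus_equation_iff)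
qed

section \<open>\<open>H\<^sup>2\<close>-curves and their unit tangents\<close>

text \<open>The difference of F and the integral of g is constant on the open interval and
  continuous on the closed one.\<close>

lemma primitive_on_closure:
  fixes F g :: "real \<Rightarrow> 'a::euclidean_space"
  assumes F: "continuous_on {0..1} F" and g: "g absolutely_integrable_on {0..1}"
    and inner: "\<And>c d. 0 < c \<Longrightarrow> d < 1 \<Longrightarrow> primitive_on c d F g"
  shows "primitive_on 0 1 F g"
proof (rule primitive_onI[OF g])
  define h where "h x = F x - integral {0..x} g" for x
  have gi: "g integrable_on {0..1}" using g by (simp add: absolutely_integrable_on_def)
  have ch: "continuous_on {0..1} h"
    unfolding h_def using gi by (intro continuous_intros F indefinite_integral_continuous_1)
  have eq: "h x = h y" if "x \<in> I01" "y \<in> I01" "x \<le> y" for x y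
  proof -
    have "F y - F x = integral {x..y} g" using inner[of x y] that by (auto simp: primitive_on_def)
    moreover have "integral {0..x} g + integral {x..y} g = integral {0..y} g"
      using that integrable_on_subinterval[OF gi, of 0 y] by (intro Henstock_Kurzweil_Integration.integral_combine) auto
    ultimately show ?thesis by (simp add: h_def algebra_simps)
  qed
  have cl: "closure I01 = {0..1::real}" by simp
  have const: "h x = h (1/2)" if "x \<in> I01" for x using eq[of x "1/2"] eq[of "1/2" x] that by (cases "x \<le> 1/2") auto
  have h: "h x = h (1/2)" if "x \<in> {0..1}" for x
    by (rule continuous_constant_on_closure[of I01 h, unfolded cl, OF ch const that])
  fix x :: real assume x: "x \<in> {0..1}"
  have "h x = h 0" by (rule trans[OF h[OF x] h[symmetric]]) simp
  then show "F x = F 0 + integral {0..x} g" by (simp add: h_def algebra_simps)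
qed

lemma H1_increment_le:
  fixes F g :: "real \<Rightarrow> 'a::euclidean_space"
  assumes F: "H1_deriv F g" and ab: "0 \<le> a" "a \<le> b" "b \<le> 1"
  shows "(norm (F b - F a))\<^sup>2 \<le> (b - a) * integral {a..b} (\<lambda>x. (norm (g x))\<^sup>2)"
proof -
  have p: "primitive_on 0 1 F g" and q: "(\<lambda>x. (norm (g x))\<^sup>2) integrable_on {0..1}"
    using F by (auto simp: H1_deriv_iff_primitive)
  have q': "(\<lambda>x. (norm (g x))\<^sup>2) integrable_on {a..b}"
    using integrable_on_subinterval[OF q] ab by auto
  have "norm (F b - F a) \<le> integral {a..b} (\<lambda>x. norm (g x))"
    using primitive_on_norm_le[OF p ab] .
  then have "(norm (F b - F a))\<^sup>2 \<le> (integral {a..b} (\<lambda>x. norm (g x)))\<^sup>2"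
    by (intro power_mono) auto
  also have "\<dots> \<le> integral {a..b} (\<lambda>_. 1) * integral {a..b} (\<lambda>x. (norm (g x))\<^sup>2)"
    using primitive_on_integrable[OF p ab(1,3)] q'
    by (intro integral_Cauchy_Schwarz) (auto simp: integrable_const_ivl)
  finally show ?thesis using ab by simp
qed

lemma integral_sum_partition:
  fixes h :: "real \<Rightarrow> real"
  assumes p: "\<And>j. j < n \<Longrightarrow> p j \<le> p (Suc j)" and h: "h integrable_on {p 0..p n}"
  shows "(\<Sum>j<n. integral {p j..p (Suc j)} h) = integral {p 0..p n} h"
proof -
  have mono: "m \<le> n \<Longrightarrow> p 0 \<le> p m" for m by (induction m) (use p in \<open>auto intro: order_trans\<close>)
  have mono': "m \<le> n \<Longrightarrow> p (n - m) \<le> p n" for m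
  proof (induction m)
    case (Suc m)
    have "p (n - Suc m) \<le> p (Suc (n - Suc m))" using Suc.prems by (intro p) auto
    also have "Suc (n - Suc m) = n - m" using Suc.prems by simp
    finally show ?case using Suc by simp
  qed simp
  have le: "p m \<le> p n" if "m \<le> n" for m using mono'[of "n - m"] that by simp
  have "m \<le> n \<Longrightarrow> (\<Sum>j<m. integral {p j..p (Suc j)} h) = integral {p 0..p m} h" for m
  proof (induction m)
    case (Suc m)
    have "integral {p 0..p m} h + integral {p m..p (Suc m)} h = integral {p 0..p (Suc m)} h"
      using Suc.prems mono[of m] p[of m] le[of "Suc m"] integrable_on_subinterval[OF h, of "p 0" "p (Suc m)"]
      by (intro Henstock_Kurzweil_Integration.integral_combine) auto
    then show ?case using Suc by simp
  qed simp
  then show ?thesis by simp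
qed

lemma dyadic_energy_alt:
  "dyadic_energy F k = (\<Sum>j<2 ^ k. 2 ^ k * (norm (F (real (Suc j) / 2 ^ k) - F (real j / 2 ^ k)))\<^sup>2)"
  unfolding dyadic_energy_def dyadic_slope_def
  by (intro sum.cong) (auto simp: power_mult_distrib power2_eq_square)

text \<open>The easy half of Riesz's criterion: Cauchy-Schwarz on each dyadic interval, then
  summation.\<close>

lemma dyadic_energy_le:
  fixes F g :: "real \<Rightarrow> 'a::euclidean_space"
  assumes F: "H1_deriv F g"
  shows "dyadic_energy F k \<le> integral {0..1} (\<lambda>x. (norm (g x))\<^sup>2)"
proof -
  let ?p = "\<lambda>j. real j / 2 ^ k"
  have "dyadic_energy F k \<le> (\<Sum>j<2 ^ k. integral {?p j..?p (Suc j)} (\<lambda>x. (norm (g x))\<^sup>2))"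
    unfolding dyadic_energy_alt
  proof (rule sum_mono)
    fix j :: nat assume "j \<in> {..<2 ^ k}"
    then have "0 \<le> ?p j" "?p j \<le> ?p (Suc j)" "?p (Suc j) \<le> 1"
      using dyadic_interval_subset[of j k] by (auto simp: divide_right_mono)
    from H1_increment_le[OF F this]
    show "2 ^ k * (norm (F (?p (Suc j)) - F (?p j)))\<^sup>2 \<le> integral {?p j..?p (Suc j)} (\<lambda>x. (norm (g x))\<^sup>2)"
      by (simp add: diff_divide_distrib[symmetric] field_simps)
  qed
  also have "\<dots> = integral {?p 0..?p (2 ^ k)} (\<lambda>x. (norm (g x))\<^sup>2)"
    using F by (intro integral_sum_partition) (auto simp: divide_right_mono H1_deriv_def)
  finally show ?thesis by simp
qed

text \<open>Replaces a chain rule: a bound on dyadic energies passes from G to every F whose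
  increments are controlled by those of G, with no map being differentiated. It serves with G the
  velocity, and with G the identity for the double bubble.\<close>

lemma dyadic_energy_Lipschitz:
  assumes K: "\<And>x y. x \<in> {0..1} \<Longrightarrow> y \<in> {0..1} \<Longrightarrow> norm (F y - F x) \<le> K * norm (G y - G x)"
  shows "dyadic_energy F k \<le> K\<^sup>2 * dyadic_energy G k"
  unfolding dyadic_energy_alt sum_distrib_left
proof (rule sum_mono)
  fix j :: nat assume j: "j \<in> {..<2 ^ k}"
  have "real j / 2 ^ k \<in> {0..1}" "real (Suc j) / 2 ^ k \<in> {0..1}"
    using j dyadic_interval_subset[of j k] by (auto simp: divide_right_mono)
  then have "(norm (F (real (Suc j) / 2 ^ k) - F (real j / 2 ^ k)))\<^sup>2
    \<le> (K * norm (G (real (Suc j) / 2 ^ k) - G (real j / 2 ^ k)))\<^sup>2"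
    by (intro power_mono K) auto
  then show "2 ^ k * (norm (F (real (Suc j) / 2 ^ k) - F (real j / 2 ^ k)))\<^sup>2 \<le>
    K\<^sup>2 * (2 ^ k * (norm (G (real (Suc j) / 2 ^ k) - G (real j / 2 ^ k)))\<^sup>2)"
    by (simp add: power_mult_distrib mult_ac)
qed

lemma norm_normalize_diff_le:
  fixes u w :: "'a::real_normed_vector"
  assumes "0 < m" "m \<le> norm u" "w \<noteq> 0"
  shows "norm (u /\<^sub>R norm u - w /\<^sub>R norm w) \<le> 2 / m * norm (u - w)"
proof -
  have u: "norm u > 0" using assms by linarith
  have "u /\<^sub>R norm u - w /\<^sub>R norm w = (u - w) /\<^sub>R norm u + ((norm w - norm u) / norm u) *\<^sub>R (w /\<^sub>R norm w)"
    using u assms(3) by (simp add: algebra_simps divide_inverse)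
  also have "norm \<dots> \<le> norm (u - w) / norm u + \<bar>norm w - norm u\<bar> / norm u"
  proof (rule norm_triangle_le, rule add_mono)
    show "norm ((u - w) /\<^sub>R norm u) \<le> norm (u - w) / norm u" by (simp add: divide_inverse mult.commute)
    have "norm (w /\<^sub>R norm w) = 1" using assms(3) by simp
    then show "norm (((norm w - norm u) / norm u) *\<^sub>R (w /\<^sub>R norm w)) \<le> \<bar>norm w - norm u\<bar> / norm u"
      by (simp only: norm_scaleR) simp
  qed
  also have "\<dots> \<le> norm (u - w) / norm u + norm (u - w) / norm u"
    using u norm_triangle_ineq3[of w u] by (intro add_left_mono divide_right_mono) (auto simp: norm_minus_commute)
  also have "\<dots> \<le> norm (u - w) / m + norm (u - w) / m"
    using assms u by (intro add_mono divide_left_mono) auto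
  finally show ?thesis by simp
qed

lemma L2_imp_integrable:
  fixes g :: "real \<Rightarrow> 'a::euclidean_space"
  assumes "L2 g"
  shows "g absolutely_integrable_on {0..1}" "(\<lambda>x. (norm (g x))\<^sup>2) integrable_on {0..1}"
proof -
  have m: "g \<in> borel_measurable (lebesgue_on I01)" and i: "(\<lambda>x. (norm (g x))\<^sup>2) absolutely_integrable_on I01"
    using assms by (auto simp: L2_def)
  then show "(\<lambda>x. (norm (g x))\<^sup>2) integrable_on {0..1}"
    using set_lebesgue_integral_eq_integral(1)[OF i] by (simp add: integrable_on_open_interval_real)
  have "(\<lambda>x. 1 + (norm (g x))\<^sup>2) integrable_on I01"
    using set_lebesgue_integral_eq_integral(1)[OF i]
    by (intro integrable_add) (auto simp: integrable_on_open_interval_real integrable_const_ivl)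
  moreover have "norm (g x) \<le> 1 + (norm (g x))\<^sup>2" for x
    using sum_squares_bound[of 1 "norm (g x)"] by (simp add: power2_eq_square)
      (smt (verit) mult_left_le norm_ge_zero mult_nonneg_nonneg)
  ultimately have "g absolutely_integrable_on I01"
    using m by (intro measurable_bounded_by_integrable_imp_absolutely_integrable[where g = "\<lambda>x. 1 + (norm (g x))\<^sup>2"]) auto
  then show "g absolutely_integrable_on {0..1}" by (simp add: absolutely_integrable_on_Icc_iff_Ioo)
qed

lemma L2_I:
  fixes g :: "real \<Rightarrow> 'a::euclidean_space"
  assumes "g absolutely_integrable_on {0..1}" "(\<lambda>x. (norm (g x))\<^sup>2) integrable_on {0..1}"
  shows "L2 g"
  unfolding L2_def
proof
  show "g \<in> borel_measurable (lebesgue_on I01)"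
    using assms(1) by (intro absolutely_integrable_imp_borel_measurable) (auto simp: absolutely_integrable_on_Icc_iff_Ioo)
  show "(\<lambda>x. (norm (g x))\<^sup>2) absolutely_integrable_on I01"
    using nonnegative_absolutely_integrable_1[OF assms(2)] by (simp add: absolutely_integrable_on_Icc_iff_Ioo)
qed

text \<open>Holds because \<open>deriv \<phi>\<close> is again a test function, against which the
  first weak derivative may be used.\<close>

lemma has_weak_deriv_2_iff:
  assumes "has_weak_deriv 1 f v"
  shows "has_weak_deriv 2 f g \<longleftrightarrow> has_weak_deriv 1 v g"
proof -
  have "(LINT x:I01|lebesgue. (deriv ^^ 2) \<phi> x *\<^sub>R f x) = - (LINT x:I01|lebesgue. deriv \<phi> x *\<^sub>R v x)"
    if "test_function \<phi>" for \<phi>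
    using assms test_function_deriv(5)[OF that] unfolding has_weak_deriv_def by (auto simp: eval_nat_numeral)
  then show ?thesis
    using assms unfolding has_weak_deriv_def by (auto simp: minus_equation_iff)
qed

lemma has_weak_deriv_weak_derivative:
  "has_weak_deriv 1 f g \<Longrightarrow> has_weak_deriv 1 f (weak_derivative f)"
  unfolding weak_derivative_def by (rule someI[where P = "has_weak_deriv 1 f"])

text \<open>By du Bois-Reymond any choice of weak derivative has F as its primitive on compact
  subintervals, and densities are unique almost everywhere.\<close>

lemma weak_derivative_eq_ae:
  fixes F g :: "real \<Rightarrow> 'a::euclidean_space"
  assumes F: "primitive_on 0 1 F g" and N: "negligible {x \<in> I01. f x \<noteq> F x}"
  shows "negligible {x \<in> I01. weak_derivative f x \<noteq> g x}"
proof (rule primitive_on_unique)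
  have "continuous_on I01 F"
    using continuous_on_primitive[OF F] by (rule continuous_on_subset) auto
  moreover have "has_weak_deriv 1 f (weak_derivative f)"
    using has_weak_deriv_of_primitive[OF F N] by (rule has_weak_deriv_weak_derivative)
  ultimately show "primitive_on c d F (weak_derivative f)" if "0 < c" "d < 1" for c d
    using primitive_of_has_weak_deriv N that by blast
  show "primitive_on c d F g" if "0 < c" "d < 1" for c d
    using primitive_on_subinterval[OF F, of c d] that by auto
qed

text \<open>\<open>W22\<close> yields only a second weak derivative. Du Bois-Reymond makes it a
  density of the velocity on compact subintervals; continuity of the velocity and integrability of
  the density extend this to the endpoints.\<close>

lemma H2_curve_velocity:
  fixes \<gamma> :: "real \<Rightarrow> 'a::euclidean_space"
  assumes "H2_curve \<gamma>"
  shows "continuous_on {0..1} (velocity \<gamma>)" "primitive_on 0 1 \<gamma> (velocity \<gamma>)"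
    "\<And>x. x \<in> {0..1} \<Longrightarrow> (\<gamma> has_vector_derivative velocity \<gamma> x) (at x within {0..1})"
    "\<exists>g. H1_deriv (velocity \<gamma>) g"
proof -
  let ?v = "velocity \<gamma>"
  show cv: "continuous_on {0..1} ?v" using assms by (simp add: H2_curve_def)
  show d: "(\<gamma> has_vector_derivative ?v x) (at x within {0..1})" if "x \<in> {0..1}" for x
    using assms that unfolding velocity_def H2_curve_def differentiable_on_def
    by (simp add: vector_derivative_works[symmetric])
  show p: "primitive_on 0 1 \<gamma> ?v"
  proof (rule primitive_onI)
    show "?v absolutely_integrable_on {0..1}" using cv by (rule absolutely_integrable_continuous_real)
    fix x :: real assume x: "x \<in> {0..1}"
    have "(?v has_integral (\<gamma> x - \<gamma> 0)) {0..x}"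
      using x by (intro fundamental_theorem_of_calculus)
        (auto intro!: has_vector_derivative_within_subset[OF d])
    then show "\<gamma> x = \<gamma> 0 + integral {0..x} ?v" by (simp add: integral_unique)
  qed
  have w1: "has_weak_deriv 1 \<gamma> ?v" by (rule has_weak_deriv_of_primitive[OF p]) simp
  obtain g where g: "L2 g" "has_weak_deriv 2 \<gamma> g" using assms unfolding H2_curve_def W22_def by auto
  then have w2: "has_weak_deriv 1 ?v g" using has_weak_deriv_2_iff[OF w1] by simp
  have "primitive_on 0 1 ?v g"
  proof (rule primitive_on_closure[OF cv])
    show "g absolutely_integrable_on {0..1}" using g by (rule_tac L2_imp_integrable)
    show "primitive_on c d ?v g" if "0 < c" "d < 1" for c d
      using that continuous_on_subset[OF cv, of I01] by (intro primitive_of_has_weak_deriv[OF w2]) fastforce+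
  qed
  then show "\<exists>g. H1_deriv ?v g" using L2_imp_integrable[OF g(1)] by (auto simp: H1_deriv_iff_primitive)
qed

lemma immersed_velocity_lower_bound:
  fixes \<gamma> :: "real \<Rightarrow> 'a::euclidean_space"
  assumes "H2_curve \<gamma>" "immersed \<gamma>"
  obtains m where "m > 0" "\<And>x. x \<in> {0..1} \<Longrightarrow> m \<le> norm (velocity \<gamma> x)"
proof -
  have "continuous_on {0..1} (\<lambda>x. norm (velocity \<gamma> x))"
    using H2_curve_velocity(1)[OF assms(1)] by (rule continuous_on_norm)
  then obtain y where y: "y \<in> {0..1}" "\<And>x. x \<in> {0..1} \<Longrightarrow> norm (velocity \<gamma> y) \<le> norm (velocity \<gamma> x)"
    using continuous_attains_inf[of "{0..1::real}" "\<lambda>x. norm (velocity \<gamma> x)"] by auto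
  then show thesis using that[of "norm (velocity \<gamma> y)"] assms(2) by (auto simp: immersed_def)
qed

lemma continuous_on_unit_tangent:
  fixes \<gamma> :: "real \<Rightarrow> 'a::euclidean_space"
  assumes "H2_curve \<gamma>" "immersed \<gamma>"
  shows "continuous_on {0..1} (unit_tangent \<gamma>)"
  unfolding unit_tangent_def using H2_curve_velocity(1)[OF assms(1)] assms(2)
  by (intro continuous_intros) (auto simp: immersed_def)

lemma norm_unit_tangent:
  assumes "immersed \<gamma>" "x \<in> {0..1}"
  shows "norm (unit_tangent \<gamma> x) = 1"
  using assms by (auto simp: immersed_def unit_tangent_def)

text \<open>Normalising is Lipschitz away from \<open>0\<close>, so Riesz's criterion passes from \<open>\<gamma>'\<close> to the unit tangent.\<close>
lemma unit_tangent_H1: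
  fixes \<gamma> :: "real \<Rightarrow> 'a::euclidean_space"
  assumes "H2_curve \<gamma>" "immersed \<gamma>"
  obtains g where "H1_deriv (unit_tangent \<gamma>) g"
    "negligible {x \<in> I01. curvature \<gamma> x \<noteq> g x /\<^sub>R norm (velocity \<gamma> x)}"
proof -
  obtain m where m: "m > 0" "\<And>x. x \<in> {0..1} \<Longrightarrow> m \<le> norm (velocity \<gamma> x)"
    using immersed_velocity_lower_bound[OF assms] by blast
  obtain h where h: "H1_deriv (velocity \<gamma>) h" using H2_curve_velocity(4)[OF assms(1)] by blast
  have "dyadic_energy (unit_tangent \<gamma>) k \<le> (2 / m)\<^sup>2 * dyadic_energy (velocity \<gamma>) k" for k
    unfolding unit_tangent_def using m assms(2)
    by (intro dyadic_energy_Lipschitz norm_normalize_diff_le) (auto simp: immersed_def)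
  also have "(2 / m)\<^sup>2 * dyadic_energy (velocity \<gamma>) k \<le> (2 / m)\<^sup>2 * integral {0..1} (\<lambda>x. (norm (h x))\<^sup>2)" for k
    by (intro mult_left_mono dyadic_energy_le h) auto
  finally obtain g where g: "H1_deriv (unit_tangent \<gamma>) g"
    using H1_deriv_of_dyadic_energy_bounded[OF continuous_on_unit_tangent[OF assms]] by metis
  have pg: "primitive_on 0 1 (unit_tangent \<gamma>) g" using g by (simp add: H1_deriv_iff_primitive)
  have "negligible {x \<in> I01. weak_derivative \<gamma> x \<noteq> velocity \<gamma> x}"
    using H2_curve_velocity(2)[OF assms(1)] by (rule weak_derivative_eq_ae) simp
  \<comment> \<open>The inner \<open>arclength_deriv\<close> is itself only determined almost
    everywhere, yet its weak derivative does not see the null set.\<close>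
  then have "negligible {x \<in> I01. arclength_deriv \<gamma> \<gamma> x \<noteq> unit_tangent \<gamma> x}"
    by (rule negligible_subset) (auto simp: arclength_deriv_def unit_tangent_def)
  then have "negligible {x \<in> I01. weak_derivative (arclength_deriv \<gamma> \<gamma>) x \<noteq> g x}"
    by (rule weak_derivative_eq_ae[OF pg])
  then have "negligible {x \<in> I01. curvature \<gamma> x \<noteq> g x /\<^sub>R norm (velocity \<gamma> x)}"
    by (rule negligible_subset) (auto simp: curvature_def arclength_deriv_def)
  then show thesis using that g by blast
qed

section \<open>Passing between curves and their unit tangents\<close>

text \<open>With \<kappa> = g / |\<gamma>'| the factor |\<kappa>|^2 |\<gamma>'| becomes |g|^2 /
  |\<gamma>'|. The density g is arbitrary here because \<open>curve_of_tangent\<close> brings its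
  own.\<close>

lemma curve_energy_eq:
  fixes \<gamma> :: "real \<Rightarrow> 'a::euclidean_space"
  assumes \<gamma>: "H2_curve \<gamma>" "immersed \<gamma>" and g: "H1_deriv (unit_tangent \<gamma>) g"
  shows "(\<lambda>x. (norm (g x))\<^sup>2 / norm (velocity \<gamma> x) + norm (velocity \<gamma> x)) integrable_on {0..1}"
    "(\<integral>\<^sup>+ x. ennreal (((norm (curvature \<gamma> x))\<^sup>2 + 1) * norm (velocity \<gamma> x)) \<partial>(lebesgue_on I01))
      = ennreal (integral {0..1} (\<lambda>x. (norm (g x))\<^sup>2 / norm (velocity \<gamma> x) + norm (velocity \<gamma> x)))"
proof -
  let ?v = "velocity \<gamma>"
  let ?e = "\<lambda>x. (norm (g x))\<^sup>2 / norm (?v x) + norm (?v x)"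
  have cv: "continuous_on {0..1} ?v" using H2_curve_velocity(1)[OF \<gamma>(1)] .
  have nz: "?v x \<noteq> 0" if "x \<in> {0..1}" for x using that \<gamma>(2) by (auto simp: immersed_def)
  have "(\<lambda>x. (norm (g x))\<^sup>2) absolutely_integrable_on {0..1}"
    using g by (intro nonnegative_absolutely_integrable_1) (auto simp: H1_deriv_def)
  then have "(\<lambda>x. inverse (norm (?v x)) *\<^sub>R (norm (g x))\<^sup>2) absolutely_integrable_on {0..1}"
    using cv nz by (intro absolutely_integrable_continuous_scaleR continuous_intros) auto
  then have "(\<lambda>x. (norm (g x))\<^sup>2 / norm (?v x)) integrable_on {0..1}"
    by (simp add: absolutely_integrable_on_def divide_inverse mult.commute)
  moreover have "(\<lambda>x. norm (?v x)) integrable_on {0..1}"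
    using cv by (intro integrable_continuous_interval continuous_intros)
  ultimately show int: "?e integrable_on {0..1}" by (rule integrable_add)
  obtain g' where g': "H1_deriv (unit_tangent \<gamma>) g'"
    "negligible {x \<in> I01. curvature \<gamma> x \<noteq> g' x /\<^sub>R norm (?v x)}"
    using unit_tangent_H1[OF \<gamma>] by blast
  have "primitive_on c d (unit_tangent \<gamma>) g" "primitive_on c d (unit_tangent \<gamma>) g'" if "0 < c" "d < 1" for c d
    using g g'(1) that by (auto simp: H1_deriv_iff_primitive intro: primitive_on_subinterval)
  then have "negligible {x \<in> I01. g x \<noteq> g' x}" by (rule primitive_on_unique)
  from negligible_Un[OF this g'(2)]
  have N: "negligible {x \<in> I01. curvature \<gamma> x \<noteq> g x /\<^sub>R norm (?v x)}"
    by (rule negligible_subset) auto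
  have "AE x in lebesgue. x \<notin> {x \<in> I01. curvature \<gamma> x \<noteq> g x /\<^sub>R norm (?v x)}"
    using N by (intro AE_not_in) (simp add: negligible_iff_null_sets)
  then have "AE x in lebesgue_on I01. curvature \<gamma> x = g x /\<^sub>R norm (?v x)"
    by (subst AE_restrict_space_iff) (auto elim: eventually_mono)
  moreover have "AE x in lebesgue_on I01. x \<in> I01" by (rule AE_I2) simp
  ultimately have "(\<integral>\<^sup>+ x. ennreal (((norm (curvature \<gamma> x))\<^sup>2 + 1) * norm (?v x)) \<partial>(lebesgue_on I01))
     = (\<integral>\<^sup>+ x. ennreal (?e x) \<partial>(lebesgue_on I01))"
  proof (intro nn_integral_cong_AE, eventually_elim)
    case (elim x)
    then have "?v x \<noteq> 0" using nz[of x] by auto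
    then have "((norm (curvature \<gamma> x))\<^sup>2 + 1) * norm (?v x) = ?e x"
      using elim by (simp add: power_mult_distrib field_simps power2_eq_square)
    then show ?case by simp
  qed
  also have "\<dots> = ennreal (integral I01 ?e)"
    using int by (intro nn_integral_lebesgue_on_eq_integral) (auto simp: integrable_on_open_interval_real)
  finally show "(\<integral>\<^sup>+ x. ennreal (((norm (curvature \<gamma> x))\<^sup>2 + 1) * norm (?v x)) \<partial>(lebesgue_on I01))
     = ennreal (integral {0..1} ?e)" by (simp add: integral_open_interval_real)
qed

text \<open>The curve runs with constant speed L, so x is arclength divided by L; this turns the
  energy into Dirichlet integral over L plus L.\<close>

lemma curve_of_tangent:
  fixes \<tau> h :: "real \<Rightarrow> 'a::euclidean_space"
  assumes h: "H1_deriv \<tau> h" and \<tau>: "\<And>x. x \<in> {0..1} \<Longrightarrow> norm (\<tau> x) = 1" and L: "L > 0"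
    and \<gamma>: "\<And>x. \<gamma> x = L *\<^sub>R integral {0..x} \<tau>"
  shows "H2_curve \<gamma>" "immersed \<gamma>" "\<And>x. x \<in> {0..1} \<Longrightarrow> unit_tangent \<gamma> x = \<tau> x"
    "(\<integral>\<^sup>+ x. ennreal (((norm (curvature \<gamma> x))\<^sup>2 + 1) * norm (velocity \<gamma> x)) \<partial>(lebesgue_on I01))
      = ennreal (integral {0..1} (\<lambda>x. (norm (h x))\<^sup>2) / L + L)"
proof -
  have ph: "primitive_on 0 1 \<tau> h" and h2: "(\<lambda>x. (norm (h x))\<^sup>2) integrable_on {0..1}"
    and ha: "h absolutely_integrable_on {0..1}"
    using h by (auto simp: H1_deriv_iff_primitive primitive_on_def)
  have c\<tau>: "continuous_on {0..1} \<tau>" using ph by (rule continuous_on_primitive)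
  have d: "(\<gamma> has_vector_derivative L *\<^sub>R \<tau> x) (at x within {0..1})" if "x \<in> {0..1}" for x
    unfolding \<gamma>[abs_def]
    by (rule bounded_linear.has_vector_derivative[OF bounded_linear_scaleR_right integral_has_vector_derivative[OF c\<tau> that]])
  then have v: "velocity \<gamma> x = L *\<^sub>R \<tau> x" if "x \<in> {0..1}" for x
    unfolding velocity_def using that d[OF that] by (intro vector_derivative_within_closed_interval) auto
  have cv: "continuous_on {0..1} (velocity \<gamma>)"
    by (rule continuous_on_eq[of _ "\<lambda>x. L *\<^sub>R \<tau> x"]) (use v c\<tau> in \<open>auto intro!: continuous_intros\<close>)
  have diff: "\<gamma> differentiable_on {0..1}"
    unfolding differentiable_on_def using d by (blast intro: differentiableI_vector)
  have c\<gamma>: "continuous_on {0..1} \<gamma>" using diff by (rule differentiable_imp_continuous_on)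
  have L2c: "L2 f" if "continuous_on {0..1} f" for f :: "real \<Rightarrow> 'a"
    using that by (intro L2_I absolutely_integrable_continuous_real integrable_continuous_interval continuous_intros)
  have p\<gamma>: "primitive_on 0 1 \<gamma> (velocity \<gamma>)"
  proof (rule primitive_onI)
    show "velocity \<gamma> absolutely_integrable_on {0..1}" using cv by (rule absolutely_integrable_continuous_real)
    fix x :: real assume x: "x \<in> {0..1}"
    have "integral {0..x} (velocity \<gamma>) = integral {0..x} (\<lambda>x. L *\<^sub>R \<tau> x)"
      using x v by (intro integral_cong) auto
    then show "\<gamma> x = \<gamma> 0 + integral {0..x} (velocity \<gamma>)" by (simp add: \<gamma>)
  qed
  have pv: "primitive_on 0 1 (velocity \<gamma>) (\<lambda>x. L *\<^sub>R h x)"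
    unfolding primitive_on_def
  proof (intro conjI allI impI)
    show "(\<lambda>x. L *\<^sub>R h x) absolutely_integrable_on {0..1}" using ha by (rule set_integrable_scaleR_right)
    show "velocity \<gamma> y - velocity \<gamma> x = integral {x..y} (\<lambda>x. L *\<^sub>R h x)" if "0 \<le> x" "x \<le> y" "y \<le> 1" for x y
      using that v[of x] v[of y] ph by (simp add: primitive_on_def scaleR_diff_right[symmetric])
  qed
  have w1: "has_weak_deriv 1 \<gamma> (velocity \<gamma>)" by (rule has_weak_deriv_of_primitive[OF p\<gamma>]) simp
  have "has_weak_deriv 1 (velocity \<gamma>) (\<lambda>x. L *\<^sub>R h x)" by (rule has_weak_deriv_of_primitive[OF pv]) simp
  then have w2: "has_weak_deriv 2 \<gamma> (\<lambda>x. L *\<^sub>R h x)" using has_weak_deriv_2_iff[OF w1] by simp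
  have "L2 (\<lambda>x. L *\<^sub>R h x)"
    using pv h2 by (intro L2_I) (auto simp: primitive_on_def power_mult_distrib intro: integrable_on_mult_right)
  then show H: "H2_curve \<gamma>"
    unfolding H2_curve_def W22_def using w1 w2 L2c cv c\<gamma> diff by auto
  show I: "immersed \<gamma>" unfolding immersed_def
  proof
    fix x :: real assume x: "x \<in> {0..1}"
    then have "\<tau> x \<noteq> 0" using \<tau>[OF x] by auto
    then show "velocity \<gamma> x \<noteq> 0" using v[OF x] L by simp
  qed
  show T: "unit_tangent \<gamma> x = \<tau> x" if "x \<in> {0..1}" for x
    using L by (simp add: unit_tangent_def v[OF that] \<tau>[OF that])
  have hT: "H1_deriv (unit_tangent \<gamma>) h"
  proof -
    have "unit_tangent \<gamma> x = unit_tangent \<gamma> 0 + integral {0..x} h" if "x \<in> {0..1}" for x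
    proof -
      have "\<tau> x = \<tau> 0 + integral {0..x} h" using h that unfolding H1_deriv_def by blast
      moreover have "unit_tangent \<gamma> 0 = \<tau> 0" by (rule T) simp
      ultimately show ?thesis using T[OF that] by simp
    qed
    then show ?thesis using h unfolding H1_deriv_def by blast
  qed
  have "integral {0..1} (\<lambda>x. (norm (h x))\<^sup>2 / norm (velocity \<gamma> x) + norm (velocity \<gamma> x))
    = integral {0..1} (\<lambda>x. (norm (h x))\<^sup>2 / L + L)"
    using v \<tau> L by (intro integral_cong) auto
  also have "\<dots> = integral {0..1} (\<lambda>x. (norm (h x))\<^sup>2) / L + L"
    using h2 by (subst integral_add) (auto intro: integrable_on_divide simp: integrable_const_ivl)
  finally show "(\<integral>\<^sup>+ x. ennreal (((norm (curvature \<gamma> x))\<^sup>2 + 1) * norm (velocity \<gamma> x)) \<partial>(lebesgue_on I01))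
      = ennreal (integral {0..1} (\<lambda>x. (norm (h x))\<^sup>2) / L + L)"
    using curve_energy_eq(2)[OF H I hT] by simp
qed

text \<open>The tangent is reparametrised by the inverse \<sigma> of normalised arclength. Of
  \<sigma> only continuity and monotonicity matter: Cauchy-Schwarz for increments bounds the dyadic
  energies by the very number C that appears in the energy.\<close>

lemma tangent_of_curve:
  fixes \<gamma> :: "real \<Rightarrow> 'a::euclidean_space"
  assumes \<gamma>: "H2_curve \<gamma>" "immersed \<gamma>"
  obtains \<tau> L C where "L > 0" "continuous_on {0..1} \<tau>" "\<And>x. x \<in> {0..1} \<Longrightarrow> norm (\<tau> x) = 1"
    "\<And>k. dyadic_energy \<tau> k \<le> C" "\<tau> 0 = unit_tangent \<gamma> 0" "\<tau> 1 = unit_tangent \<gamma> 1"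
    "L *\<^sub>R integral {0..1} \<tau> = \<gamma> 1 - \<gamma> 0"
    "(\<integral>\<^sup>+ x. ennreal (((norm (curvature \<gamma> x))\<^sup>2 + 1) * norm (velocity \<gamma> x)) \<partial>(lebesgue_on I01))
      = ennreal (C / L + L)"
proof -
  let ?v = "velocity \<gamma>" and ?T = "unit_tangent \<gamma>"
  obtain m where m: "m > 0" "\<And>x. x \<in> {0..1} \<Longrightarrow> m \<le> norm (?v x)"
    using immersed_velocity_lower_bound[OF \<gamma>] by blast
  obtain g where g: "H1_deriv ?T g" using unit_tangent_H1[OF \<gamma>] by blast
  have pg: "primitive_on 0 1 ?T g" using g by (simp add: H1_deriv_iff_primitive)
  have cv: "continuous_on {0..1} ?v" using H2_curve_velocity(1)[OF \<gamma>(1)] .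
  have cnv: "continuous_on {0..1} (\<lambda>x. norm (?v x))" using cv by (rule continuous_on_norm)
  have iv: "(\<lambda>x. norm (?v x)) integrable_on {x..y}" if "0 \<le> x" "y \<le> 1" for x y
    using that by (intro integrable_continuous_interval continuous_on_subset[OF cnv]) auto
  define L where "L = integral {0..1} (\<lambda>x. norm (?v x))"
  define s where "s x = integral {0..x} (\<lambda>x. norm (?v x)) / L" for x
  have incr: "integral {0..x} (\<lambda>x. norm (?v x)) + integral {x..y} (\<lambda>x. norm (?v x)) = integral {0..y} (\<lambda>x. norm (?v x))"
    if "0 \<le> x" "x \<le> y" "y \<le> 1" for x y
    using that iv[of 0 y] by (intro Henstock_Kurzweil_Integration.integral_combine) auto
  have low: "m * (y - x) \<le> integral {x..y} (\<lambda>x. norm (?v x))" if "0 \<le> x" "x \<le> y" "y \<le> 1" for x y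
  proof -
    have "integral {x..y} (\<lambda>_. m) \<le> integral {x..y} (\<lambda>x. norm (?v x))"
      using that m iv[of x y] by (intro integral_le) (auto simp: integrable_const_ivl)
    then show ?thesis using that by (simp add: mult.commute)
  qed
  have L: "L > 0" using low[of 0 1] m by (simp add: L_def)
  have s01: "s 0 = 0" "s 1 = 1" using L by (auto simp: s_def L_def)
  have sdiff: "s y - s x = integral {x..y} (\<lambda>x. norm (?v x)) / L" if "0 \<le> x" "x \<le> y" "y \<le> 1" for x y
    using incr[OF that] by (simp add: s_def diff_divide_distrib[symmetric])
  have sless: "s x < s y" if "0 \<le> x" "x < y" "y \<le> 1" for x y
  proof -
    have "0 < m * (y - x)" using m that by simp
    also have "\<dots> \<le> integral {x..y} (\<lambda>x. norm (?v x))" using low that by auto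
    finally have "0 < integral {x..y} (\<lambda>x. norm (?v x)) / L" using L by simp
    then show ?thesis using sdiff[of x y] that by simp
  qed
  have ds: "(s has_field_derivative norm (?v x) / L) (at x within {0..1})" if "x \<in> {0..1}" for x
    unfolding s_def using integral_has_real_derivative[OF cnv that] by (rule DERIV_cdivide)
  have cs: "continuous_on {0..1} s" using ds by (rule DERIV_continuous_on)
  have inj: "inj_on s {0..1}"
    by (rule inj_onI) (metis atLeastAtMost_iff linorder_neqE_linordered_idom order_less_irrefl sless)
  have img: "s ` {0..1} = {0..1}"
  proof
    show "s ` {0..1} \<subseteq> {0..1}"
    proof clarify
      fix x :: real assume x: "x \<in> {0..1}"
      show "s x \<in> {0..1}" using sless[of 0 x] sless[of x 1] s01 x by (cases "x = 0"; cases "x = 1") auto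
    qed
    show "{0..1} \<subseteq> s ` {0..1}"
    proof
      fix y :: real assume "y \<in> {0..1}"
      then have "\<exists>x\<ge>0. x \<le> 1 \<and> s x = y" using s01 cs by (intro IVT') auto
      then show "y \<in> s ` {0..1}" by force
    qed
  qed
  define \<sigma> where "\<sigma> = inv_into {0..1} s"
  have \<sigma>s: "\<sigma> (s x) = x" if "x \<in> {0..1}" for x unfolding \<sigma>_def using inj that by (rule inv_into_f_f)
  have s\<sigma>: "s (\<sigma> y) = y" "\<sigma> y \<in> {0..1}" if "y \<in> {0..1}" for y
    unfolding \<sigma>_def using that img by (auto intro: f_inv_into_f inv_into_into simp del: atLeastAtMost_iff)
  have \<sigma>01: "\<sigma> 0 = 0" "\<sigma> 1 = 1" using \<sigma>s[of 0] \<sigma>s[of 1] s01 by auto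
  have c\<sigma>: "continuous_on {0..1} \<sigma>"
    using continuous_on_inv[of "{0..1}" s \<sigma>] cs \<sigma>s img by auto
  have \<sigma>mono: "\<sigma> x \<le> \<sigma> y" if "0 \<le> x" "x \<le> y" "y \<le> 1" for x y
  proof (rule ccontr)
    assume "\<not> \<sigma> x \<le> \<sigma> y"
    then have "s (\<sigma> y) < s (\<sigma> x)" using s\<sigma>(2)[of x] s\<sigma>(2)[of y] that by (intro sless) auto
    then show False using s\<sigma>(1)[of x] s\<sigma>(1)[of y] that by auto
  qed
  define \<tau> where "\<tau> x = ?T (\<sigma> x)" for x
  define q where "q x = (norm (g x))\<^sup>2 / norm (?v x)" for x
  have q0: "q x \<ge> 0" for x by (simp add: q_def)
  have iqv: "(\<lambda>x. q x + norm (?v x)) integrable_on {0..1}"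
    unfolding q_def by (rule curve_energy_eq(1)[OF \<gamma> g])
  have iq1: "q integrable_on {0..1}"
    using integrable_diff[OF iqv iv[of 0 1]] by simp
  have iq: "q integrable_on {x..y}" if "0 \<le> x" "y \<le> 1" for x y
    using integrable_on_subinterval[OF iq1] that by auto
  have c\<tau>: "continuous_on {0..1} \<tau>"
    unfolding \<tau>_def using s\<sigma>
    by (intro continuous_on_compose2[OF continuous_on_unit_tangent[OF \<gamma>] c\<sigma>]) auto
  \<comment> \<open>Cauchy-Schwarz with the speed as weight: the first factor is then the arclength
    from x to y, which at dyadic values of s is L / 2 ^ k.\<close>
  have T2: "(norm (?T y - ?T x))\<^sup>2 \<le> L * (s y - s x) * integral {x..y} q" if "0 \<le> x" "x \<le> y" "y \<le> 1" for x y
  proof -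
    have "norm (?T y - ?T x) \<le> integral {x..y} (\<lambda>x. norm (g x))"
      using primitive_on_norm_le[OF pg] that by auto
    then have "(norm (?T y - ?T x))\<^sup>2 \<le> (integral {x..y} (\<lambda>x. norm (g x)))\<^sup>2" by (intro power_mono) auto
    also have "\<dots> \<le> integral {x..y} (\<lambda>x. norm (?v x)) * integral {x..y} q"
    proof (rule integral_Cauchy_Schwarz)
      fix t assume "t \<in> {x..y}"
      then have "norm (?v t) > 0" using m(1) m(2)[of t] that by auto
      then show "(norm (g t))\<^sup>2 \<le> norm (?v t) * q t" by (simp add: q_def)
    qed (use that iv iq primitive_on_integrable[OF pg, of x y] q0 in auto)
    finally show ?thesis using sdiff[OF that] L by simp
  qed
  have dy: "dyadic_energy \<tau> k \<le> L * integral {0..1} q" for k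
  proof -
    let ?p = "\<lambda>j. real j / 2 ^ k"
    have bd: "0 \<le> ?p j" "?p j \<le> ?p (Suc j)" "?p (Suc j) \<le> 1" if "j < 2 ^ k" for j
      using dyadic_interval_subset[OF that] by (auto simp: divide_right_mono)
    have "dyadic_energy \<tau> k \<le> (\<Sum>j<2 ^ k. L * integral {\<sigma> (?p j)..\<sigma> (?p (Suc j))} q)"
      unfolding dyadic_energy_alt
    proof (rule sum_mono)
      fix j :: nat assume "j \<in> {..<2 ^ k}"
      then have j: "j < 2 ^ k" by simp
      have "(norm (\<tau> (?p (Suc j)) - \<tau> (?p j)))\<^sup>2 \<le> L * (?p (Suc j) - ?p j) * integral {\<sigma> (?p j)..\<sigma> (?p (Suc j))} q"
      proof -
        have "?p j \<in> {0..1}" "?p (Suc j) \<in> {0..1}" using bd[OF j] by (auto simp del: of_nat_Suc)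
        note s\<sigma>[OF this(1)] s\<sigma>[OF this(2)]
        then show ?thesis
          using T2[of "\<sigma> (?p j)" "\<sigma> (?p (Suc j))"] \<sigma>mono[OF bd[OF j]]
          by (simp add: \<tau>_def)
      qed
      then show "2 ^ k * (norm (\<tau> (?p (Suc j)) - \<tau> (?p j)))\<^sup>2 \<le> L * integral {\<sigma> (?p j)..\<sigma> (?p (Suc j))} q"
        by (simp add: diff_divide_distrib[symmetric] field_simps)
    qed
    also have "\<dots> = L * (\<Sum>j<2 ^ k. integral {\<sigma> (?p j)..\<sigma> (?p (Suc j))} q)" by (simp add: sum_distrib_left)
    \<comment> \<open>The images of the dyadic points under \<sigma> again partition [0,1].\<close>
    also have "(\<Sum>j<2 ^ k. integral {\<sigma> (?p j)..\<sigma> (?p (Suc j))} q) = integral {\<sigma> (?p 0)..\<sigma> (?p (2 ^ k))} q"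
      using bd \<sigma>mono iq1 \<sigma>01 by (intro integral_sum_partition[of _ "\<lambda>j. \<sigma> (?p j)"]) auto
    finally show ?thesis using \<sigma>01 by simp
  qed
  \<comment> \<open>Substituting s in the mean of \<tau> brings in the factor |\<gamma>'| / L, which
    undoes the normalisation of the tangent.\<close>
  have "((\<lambda>x. (norm (?v x) / L) *\<^sub>R \<tau> (s x)) has_integral integral {s 0..s 1} \<tau>) {0..1}"
    using ds c\<tau> s01 img by (intro has_integral_substitution[where c = 0 and d = 1]) auto
  moreover have "(norm (?v x) / L) *\<^sub>R \<tau> (s x) = (1 / L) *\<^sub>R ?v x" if "x \<in> {0..1}" for x
  proof -
    have "norm (?v x) \<noteq> 0" using m(1) m(2)[OF that] by linarith
    then show ?thesis using that by (simp add: \<tau>_def \<sigma>s unit_tangent_def divide_inverse)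
  qed
  ultimately have "((\<lambda>x. (1 / L) *\<^sub>R ?v x) has_integral integral {0..1} \<tau>) {0..1}"
    by (subst (asm) has_integral_cong[where g = "\<lambda>x. (1 / L) *\<^sub>R ?v x"]) (simp_all add: s01)
  moreover have "((\<lambda>x. (1 / L) *\<^sub>R ?v x) has_integral (1 / L) *\<^sub>R (\<gamma> 1 - \<gamma> 0)) {0..1}"
    using H2_curve_velocity(2)[OF \<gamma>(1)] cv
    by (intro has_integral_cmul) (auto simp: primitive_on_def has_integral_iff intro: integrable_continuous_interval)
  ultimately have "integral {0..1} \<tau> = (1 / L) *\<^sub>R (\<gamma> 1 - \<gamma> 0)" by (rule has_integral_unique)
  then have disp: "L *\<^sub>R integral {0..1} \<tau> = \<gamma> 1 - \<gamma> 0" using L by simp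
  have "integral {0..1} (\<lambda>x. q x + norm (?v x)) = (L * integral {0..1} q) / L + L"
    using iq1 iv[of 0 1] L by (subst integral_add) (auto simp: L_def)
  then have en: "(\<integral>\<^sup>+ x. ennreal (((norm (curvature \<gamma> x))\<^sup>2 + 1) * norm (?v x)) \<partial>(lebesgue_on I01))
      = ennreal ((L * integral {0..1} q) / L + L)"
    using curve_energy_eq(2)[OF \<gamma> g] by (simp add: q_def)
  show thesis
    by (rule that[of L \<tau> "L * integral {0..1} q"])
       (use L c\<tau> dy disp en norm_unit_tangent[OF \<gamma>(2)] s\<sigma> \<sigma>01 in \<open>auto simp: \<tau>_def\<close>)
qed

section \<open>Bending energy of loops\<close>

text \<open>The triangle inequality for angles on the sphere, in terms of cosines. It is
  Cauchy-Schwarz for the components of u and w orthogonal to v, whose norms are the sines of the two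
  angles.\<close>

lemma cos_angle_add_le_inner:
  fixes u v w :: "'a::real_inner"
  assumes "norm u = 1" "norm v = 1" "norm w = 1"
    and \<alpha>\<beta>: "0 \<le> \<alpha>" "0 \<le> \<beta>" "\<alpha> + \<beta> \<le> pi" and u: "cos \<alpha> \<le> u \<bullet> v" and w: "cos \<beta> \<le> v \<bullet> w"
  shows "cos (\<alpha> + \<beta>) \<le> u \<bullet> w"
proof -
  define a b where "a = arccos (u \<bullet> v)" and "b = arccos (v \<bullet> w)"
  have uv: "-1 \<le> u \<bullet> v" "u \<bullet> v \<le> 1" and vw: "-1 \<le> v \<bullet> w" "v \<bullet> w \<le> 1"
    using Cauchy_Schwarz_ineq2[of u v] Cauchy_Schwarz_ineq2[of v w] assms(1-3) by auto
  have ca: "cos a = u \<bullet> v" and cb: "cos b = v \<bullet> w" using uv vw by (auto simp: a_def b_def)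
  have a: "0 \<le> a" "a \<le> pi" and b: "0 \<le> b" "b \<le> pi"
    using arccos_bounded[OF uv] arccos_bounded[OF vw] by (auto simp: a_def b_def)
  have "a \<le> \<alpha>" using cos_mono_le_eq[of \<alpha> a] a \<alpha>\<beta> u ca by auto
  moreover have "b \<le> \<beta>" using cos_mono_le_eq[of \<beta> b] b \<alpha>\<beta> w cb by auto
  ultimately have "cos (\<alpha> + \<beta>) \<le> cos (a + b)"
    using a b \<alpha>\<beta> by (intro cos_monotone_0_pi_le) auto
  also have "cos (a + b) \<le> u \<bullet> w"
  proof -
    have vv: "v \<bullet> v = 1" "u \<bullet> u = 1" "w \<bullet> w = 1" using assms(1-3) by (auto simp: norm_eq_1)
    have n1: "norm (u - cos a *\<^sub>R v) = sin a"
    proof -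
      have "(norm (u - cos a *\<^sub>R v))\<^sup>2 = 1 - (cos a)\<^sup>2"
        unfolding power2_norm_eq_inner
        by (simp add: inner_diff_left inner_diff_right vv ca inner_commute power2_eq_square)
      then have "(norm (u - cos a *\<^sub>R v))\<^sup>2 = (sin a)\<^sup>2" by (simp add: sin_squared_eq)
      then show ?thesis using sin_ge_zero[OF a] by (simp add: power2_eq_iff_nonneg)
    qed
    have n2: "norm (w - cos b *\<^sub>R v) = sin b"
    proof -
      have "(norm (w - cos b *\<^sub>R v))\<^sup>2 = 1 - (cos b)\<^sup>2"
        unfolding power2_norm_eq_inner
        by (simp add: inner_diff_left inner_diff_right vv cb inner_commute power2_eq_square)
      then have "(norm (w - cos b *\<^sub>R v))\<^sup>2 = (sin b)\<^sup>2" by (simp add: sin_squared_eq)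
      then show ?thesis using sin_ge_zero[OF b] by (simp add: power2_eq_iff_nonneg)
    qed
    have "(u - cos a *\<^sub>R v) \<bullet> (w - cos b *\<^sub>R v) = u \<bullet> w - cos a * cos b"
      by (simp add: inner_diff_left inner_diff_right vv ca cb inner_commute algebra_simps)
    moreover have "- (sin a * sin b) \<le> (u - cos a *\<^sub>R v) \<bullet> (w - cos b *\<^sub>R v)"
      using Cauchy_Schwarz_ineq2[of "u - cos a *\<^sub>R v" "w - cos b *\<^sub>R v"] n1 n2 by simp
    ultimately show ?thesis by (simp add: cos_add)
  qed
  finally show ?thesis .
qed

text \<open>A chord of length x of the unit sphere has angle cosine 1 - x^2 / 2. Its angle exceeds
  x, but for short chords by less than any prescribed factor 1 + e.\<close>

lemma cos_stretched_le:
  fixes e :: real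
  assumes "e > 0"
  obtains d where "d > 0" "\<And>x. 0 \<le> x \<Longrightarrow> x < d \<Longrightarrow> cos ((1 + e) * x) \<le> 1 - x\<^sup>2 / 2"
proof -
  have "(sin has_real_derivative 1) (at 0)" using DERIV_sin[of "0::real"] by simp
  then have "((\<lambda>h. sin h / h) \<longlongrightarrow> 1) (at (0::real))" by (simp add: DERIV_def)
  then have "\<forall>\<^sub>F h in at (0::real). sin h / h > 1 / (1 + e)"
    using assms by (intro order_tendstoD) auto
  then obtain r where r: "r > 0" "\<And>h. h \<noteq> 0 \<Longrightarrow> \<bar>h\<bar> < r \<Longrightarrow> sin h / h > 1 / (1 + e)"
    by (auto simp: eventually_at dist_real_def)
  show thesis
  proof (rule that[of "2 * r / (1 + e)"])
    show "2 * r / (1 + e) > 0" using r assms by simp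
    fix x :: real assume x: "0 \<le> x" "x < 2 * r / (1 + e)"
    let ?h = "(1 + e) * x / 2"
    have "x / 2 \<le> sin ?h"
    proof (cases "x = 0")
      case False
      then have h: "?h > 0" using x assms by simp
      have "?h < r" using x assms by (simp add: field_simps)
      then have "1 / (1 + e) < sin ?h / ?h" using h by (intro r(2)) linarith+
      then have "1 / (1 + e) * ?h < sin ?h" using h by (simp add: less_divide_eq)
      then show ?thesis using assms by simp
    qed simp
    then have "(x / 2)\<^sup>2 \<le> (sin ?h)\<^sup>2" using x by (intro power_mono) auto
    moreover have "cos ((1 + e) * x) = 1 - 2 * (sin ?h)\<^sup>2" using cos_double_sin[of ?h] by simp
    ultimately show "cos ((1 + e) * x) \<le> 1 - x\<^sup>2 / 2" by (simp add: power_divide)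
  qed
qed

text \<open>A curve on the unit sphere covers an angle at most its length: sum the angles of a fine inscribed polygon.\<close>
lemma cos_length_le_inner:
  fixes \<tau> g :: "real \<Rightarrow> 'a::euclidean_space"
  assumes p: "primitive_on a b \<tau> g" and ab: "a \<le> b" and \<tau>: "\<And>x. x \<in> {a..b} \<Longrightarrow> norm (\<tau> x) = 1"
    and len: "integral {a..b} (\<lambda>x. norm (g x)) < pi"
  shows "cos (integral {a..b} (\<lambda>x. norm (g x))) \<le> \<tau> a \<bullet> \<tau> b"
proof -
  define V where "V x = integral {a..x} (\<lambda>x. norm (g x))" for x
  note ig = primitive_on_integrable[OF p]
  have cV: "continuous_on {a..b} V" unfolding V_def
    using ig(2)[of a b] by (intro indefinite_integral_continuous_1) auto
  have dV: "V y - V x = integral {x..y} (\<lambda>x. norm (g x))" if "a \<le> x" "x \<le> y" "y \<le> b" for x y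
  proof -
    have "V x + integral {x..y} (\<lambda>x. norm (g x)) = V y"
      unfolding V_def using that ig(2)[of a y] by (intro Henstock_Kurzweil_Integration.integral_combine) auto
    then show ?thesis by simp
  qed
  have Vmono: "V x \<le> V y" if "a \<le> x" "x \<le> y" "y \<le> b" for x y
    using dV[OF that] that ig(2)[of x y] integral_nonneg[of "\<lambda>x. norm (g x)" "{x..y}"] by auto
  have Va: "V a = 0" by (simp add: V_def)
  have *: "cos ((1 + e) * V b) \<le> \<tau> a \<bullet> \<tau> b" if e: "e > 0" and small: "(1 + e) * V b \<le> pi" for e
  proof -
    obtain d where d: "d > 0" "\<And>x. 0 \<le> x \<Longrightarrow> x < d \<Longrightarrow> cos ((1 + e) * x) \<le> 1 - x\<^sup>2 / 2"
      using cos_stretched_le[OF e] by blast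
    have "uniformly_continuous_on {a..b} V" using cV by (intro compact_uniformly_continuous) auto
    then obtain r where r: "r > 0" "\<And>x y. x \<in> {a..b} \<Longrightarrow> y \<in> {a..b} \<Longrightarrow> \<bar>y - x\<bar> < r \<Longrightarrow> \<bar>V y - V x\<bar> < d"
      using d(1) unfolding uniformly_continuous_on_def dist_real_def by metis
    obtain n :: nat where n: "(b - a) / r < real n" using reals_Archimedean2 by blast
    have n0: "0 < real n" using n ab r by (smt (verit) divide_nonneg_pos)
    define q where "q j = a + (b - a) * (real j / real n)" for j
    have q0: "q 0 = a" "q n = b" using n0 by (auto simp: q_def)
    have qb: "a \<le> q j" "q j \<le> b" if "j \<le> n" for j
    proof -
      have "(b - a) * (real j / real n) \<le> (b - a) * 1" using that ab n0 by (intro mult_left_mono) auto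
      then show "q j \<le> b" by (simp add: q_def)
      show "a \<le> q j" using ab by (simp add: q_def)
    qed
    have qs: "q (Suc j) - q j = (b - a) / real n" for j by (simp add: q_def add_divide_distrib algebra_simps)
    have qr: "(b - a) / real n < r" using n n0 r by (simp add: field_simps)
    have qm: "q j \<le> q (Suc j)" for j using qs[of j] ab n0 by (smt (verit) divide_nonneg_pos)
    have "j \<le> n \<Longrightarrow> cos ((1 + e) * V (q j)) \<le> \<tau> a \<bullet> \<tau> (q j)" for j
    proof (induction j)
      case 0
      have "\<tau> a \<bullet> \<tau> a = 1" using \<tau>[of a] ab by (simp add: norm_eq_1)
      then show ?case by (simp add: q0 Va)
    next
      case (Suc j)
      let ?D = "V (q (Suc j)) - V (q j)"
      have bj: "a \<le> q j" "q j \<le> q (Suc j)" "q (Suc j) \<le> b" "q j \<le> b" "a \<le> q (Suc j)"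
        using qb[of j] qb[of "Suc j"] qm[of j] Suc.prems by auto
      have D0: "0 \<le> ?D" using Vmono bj by auto
      have "?D < d" using r(2)[of "q j" "q (Suc j)"] bj qs[of j] qr by auto
      then have "cos ((1 + e) * ?D) \<le> 1 - ?D\<^sup>2 / 2" using d D0 by blast
      also have "\<dots> \<le> 1 - (norm (\<tau> (q (Suc j)) - \<tau> (q j)))\<^sup>2 / 2"
      proof -
        have "norm (\<tau> (q (Suc j)) - \<tau> (q j)) \<le> ?D"
          using primitive_on_norm_le[OF p bj(1-3)] dV[OF bj(1-3)] by simp
        then show ?thesis by (intro diff_left_mono divide_right_mono power_mono) auto
      qed
      also have "\<dots> = \<tau> (q j) \<bullet> \<tau> (q (Suc j))"
      proof -
        have "\<tau> (q j) \<bullet> \<tau> (q j) = 1" "\<tau> (q (Suc j)) \<bullet> \<tau> (q (Suc j)) = 1"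
          using \<tau>[of "q j"] \<tau>[of "q (Suc j)"] bj by (auto simp: norm_eq_1)
        then show ?thesis
          by (simp add: power2_norm_eq_inner inner_diff_left inner_diff_right inner_commute diff_divide_distrib)
      qed
      finally have step: "cos ((1 + e) * ?D) \<le> \<tau> (q j) \<bullet> \<tau> (q (Suc j))" .
      have "(1 + e) * V (q j) + (1 + e) * ?D = (1 + e) * V (q (Suc j))" by (simp add: algebra_simps)
      moreover have "(1 + e) * V (q j) + (1 + e) * ?D \<le> pi"
      proof -
        have "(1 + e) * V (q (Suc j)) \<le> (1 + e) * V b"
          using Vmono[of "q (Suc j)" b] bj e by (intro mult_left_mono) auto
        then show ?thesis using small by (simp add: algebra_simps)
      qed
      moreover have "0 \<le> V (q j)" using Vmono[of a "q j"] bj Va by auto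
      moreover have "cos ((1 + e) * V (q j) + (1 + e) * ?D) \<le> \<tau> a \<bullet> \<tau> (q (Suc j))"
        by (rule cos_angle_add_le_inner[OF \<tau> \<tau> \<tau> _ _ _ Suc.IH step])
           (use bj ab Suc.prems calculation D0 e in auto)
      ultimately show ?case by simp
    qed
    from this[of n] show ?thesis by (simp add: q0)
  qed
  have Vb: "0 \<le> V b" "V b < pi" using Vmono[of a b] ab Va len by (auto simp: V_def)
  \<comment> \<open>The stretching factor is now removed; since V b < pi strictly, all small e
    satisfy the side condition.\<close>
  have lim: "((\<lambda>e. cos ((1 + e) * V b)) \<longlongrightarrow> cos ((1 + 0) * V b)) (at_right 0)"
    by (intro tendsto_intros)
  have "((\<lambda>e. (1 + e) * V b) \<longlongrightarrow> (1 + 0) * V b) (at_right 0)" by (intro tendsto_intros)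
  then have "\<forall>\<^sub>F e in at_right 0. (1 + e) * V b < pi" using Vb by (intro order_tendstoD) auto
  moreover have "\<forall>\<^sub>F e in at_right (0::real). 0 < e" by (simp add: eventually_at_right_less)
  ultimately have "\<forall>\<^sub>F e in at_right 0. cos ((1 + e) * V b) \<le> \<tau> a \<bullet> \<tau> b"
    by eventually_elim (use * in auto)
  then have "cos ((1 + 0) * V b) \<le> \<tau> a \<bullet> \<tau> b"
    by (rule tendsto_upperbound[OF lim]) simp
  then show ?thesis by (simp add: V_def)
qed

section \<open>Quantitative lower bound for the bending of loops\<close>

lemma sin_ge_chord:
  assumes "0 \<le> x" "x \<le> pi / 2"
  shows "2 * x / pi \<le> sin x"
proof -
  have "convex_on {0..pi/2} (\<lambda>x. - sin x)"
    by (rule f''_ge0_imp_convex[where f' = "\<lambda>x. - cos x" and f'' = sin])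
       (auto intro!: derivative_eq_intros sin_ge_zero)
  from convex_onD[OF this, of "2 * x / pi" 0 "pi / 2"] show ?thesis
    using assms by (simp add: field_simps)
qed

text \<open>The tangent at \<open>\<pi>/2\<close> of the convex function \<open>t \<mapsto> cos (\<surd>t)\<close>.\<close>
lemma cos_ge_quadratic:
  assumes "0 \<le> x" "x \<le> pi"
  shows "pi / 4 - x\<^sup>2 / pi \<le> cos x"
proof -
  define f where "f x = cos x + x\<^sup>2 / pi - pi / 4" for x
  have d: "(f has_real_derivative (2 * x / pi - sin x)) (at x)" for x
    unfolding f_def by (auto intro!: derivative_eq_intros)
  have mid: "f (pi / 2) = 0" by (simp add: f_def power2_eq_square field_simps)
  have "0 \<le> f x"
  proof (cases "x \<le> pi / 2")
    case True
    have "f (pi / 2) \<le> f x"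
    proof (rule DERIV_nonpos_imp_nonincreasing[OF True])
      fix y assume "x \<le> y" "y \<le> pi / 2"
      then show "\<exists>z. DERIV f y :> z \<and> z \<le> 0" using d[of y] sin_ge_chord[of y] assms by force
    qed
    then show ?thesis using mid by simp
  next
    case False
    have "f (pi / 2) \<le> f x"
    proof (rule DERIV_nonneg_imp_nondecreasing[of "pi / 2" x f])
      fix y assume "pi / 2 \<le> y" "y \<le> x"
      then have "1 \<le> 2 * y / pi" by (simp add: field_simps)
      then have "0 \<le> 2 * y / pi - sin y" using sin_le_one[of y] by linarith
      then show "\<exists>z. DERIV f y :> z \<and> 0 \<le> z" using d[of y] by blast
    qed (use False in simp)
    then show ?thesis using mid by simp
  qed
  then show ?thesis by (simp add: f_def)
qed

text \<open>Once the length reaches pi, the left-hand side is at most -3 pi / 4 < -1 and the bound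
  is trivial. So the estimate can be integrated along the curve for any length.\<close>

lemma inner_ge_quadratic_length:
  fixes \<tau> g :: "real \<Rightarrow> 'a::euclidean_space"
  assumes p: "primitive_on a b \<tau> g" and ab: "a \<le> b" and \<tau>: "\<And>x. x \<in> {a..b} \<Longrightarrow> norm (\<tau> x) = 1"
  shows "pi / 4 - (integral {a..b} (\<lambda>x. norm (g x)))\<^sup>2 / pi \<le> \<tau> a \<bullet> \<tau> b"
proof (cases "integral {a..b} (\<lambda>x. norm (g x)) < pi")
  case True
  have "0 \<le> integral {a..b} (\<lambda>x. norm (g x))"
    using primitive_on_integrable[OF p, of a b] by (intro integral_nonneg) auto
  then show ?thesis
    using cos_ge_quadratic[of "integral {a..b} (\<lambda>x. norm (g x))"] True cos_length_le_inner[OF p ab \<tau> True] by auto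
next
  case False
  then have "pi\<^sup>2 \<le> (integral {a..b} (\<lambda>x. norm (g x)))\<^sup>2" by (intro power_mono) auto
  then have "pi \<le> (integral {a..b} (\<lambda>x. norm (g x)))\<^sup>2 / pi" by (simp add: field_simps power2_eq_square)
  moreover have "-1 \<le> \<tau> a \<bullet> \<tau> b" using Cauchy_Schwarz_ineq2[of "\<tau> a" "\<tau> b"] \<tau>[of a] \<tau>[of b] ab by auto
  ultimately show ?thesis using pi_gt3 by linarith
qed

text \<open>Schur test with weight \<open>cos (3 (t - a))\<close>. The sharp constant \<open>1/\<pi>\<^sup>2\<close> would require a weight vanishing
  at the right endpoint; \<open>1/9\<close> is enough.\<close>
lemma Poincare_left_endpoint:
  fixes h :: "real \<Rightarrow> real"
  assumes h: "h absolutely_integrable_on {a..a + 1/2}" "(\<lambda>x. (h x)\<^sup>2) integrable_on {a..a + 1/2}"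
  shows "integral {a..a + 1/2} (\<lambda>t. (integral {a..t} h)\<^sup>2) \<le> (1/9) * integral {a..a + 1/2} (\<lambda>x. (h x)\<^sup>2)"
proof -
  let ?b = "a + 1/2"
  have pi32: "3/2 < pi / 2" using pi_gt3 by simp
  have cpos: "cos (3 * (t - a)) > 0" if "t \<in> {a..?b}" for t
    using that pi32 by (intro cos_gt_zero_pi) auto
  have cmono: "cos (3/2) \<le> cos (3 * (t - a))" if "t \<in> {a..?b}" for t
    using that pi32 by (intro cos_monotone_0_pi_le) auto
  have c32: "cos (3/2::real) > 0" using pi32 by (intro cos_gt_zero_pi) auto
  define W where "W t = sin (3 * (t - a))" for t
  \<comment> \<open>W is the integral of the weight 3 cos (3 (t - a)), and \<phi> is the primitive
    of W that vanishes at the right endpoint; as P vanishes at a, integration by parts leaves no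
    boundary terms. The frequency 3 is below pi, which keeps the cosine positive on an interval of
    length 1/2.\<close>
  define \<phi> where "\<phi> t = (cos (3/2) - cos (3 * (t - a))) / 3" for t
  define p where "p t = (h t)\<^sup>2 / (3 * cos (3 * (t - a)))" for t
  have hi: "h integrable_on {a..t}" if "t \<le> ?b" for t
    using integrable_on_subinterval[OF h(1)[THEN set_lebesgue_integral_eq_integral(1)]] that by auto
  have h2a: "(\<lambda>x. (h x)\<^sup>2) absolutely_integrable_on {a..?b}"
    using h(2) by (intro nonnegative_absolutely_integrable_1) auto
  have cc: "continuous_on {a..?b} (\<lambda>t. inverse (3 * cos (3 * (t - a))))"
    using cpos by (intro continuous_intros) (auto simp: less_imp_neq[symmetric])
  have pa: "p absolutely_integrable_on {a..?b}"
  proof -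
    have "p = (\<lambda>t. inverse (3 * cos (3 * (t - a))) *\<^sub>R (h t)\<^sup>2)"
      unfolding p_def divide_inverse real_scaleR_def by (rule ext, rule mult.commute)
    then show ?thesis using absolutely_integrable_continuous_scaleR[OF cc h2a] by (simp only:)
  qed
  define P where "P t = integral {a..t} p" for t
  have pP: "primitive_on a ?b P p" using pa by (rule primitive_onI) (simp add: P_def)
  have pi_int: "p integrable_on {a..t}" if "t \<le> ?b" for t
    using integrable_on_subinterval[OF pa[THEN set_lebesgue_integral_eq_integral(1)]] that by auto
  have cP: "continuous_on {a..?b} P" using pP by (rule continuous_on_primitive)
  have cW: "continuous_on {a..?b} W" unfolding W_def by (intro continuous_intros)
  have sq: "(integral {a..t} h)\<^sup>2 \<le> W t * P t" if t: "t \<in> {a..?b}" for t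
  proof -
    have w: "((\<lambda>t. 3 * cos (3 * (t - a))) has_integral (W t - W a)) {a..t}"
      using t unfolding W_def
      by (intro fundamental_theorem_of_calculus)
         (auto intro!: derivative_eq_intros simp flip: has_real_derivative_iff_has_vector_derivative)
    have "(integral {a..t} h)\<^sup>2 \<le> integral {a..t} (\<lambda>t. 3 * cos (3 * (t - a))) * integral {a..t} p"
    proof (rule integral_Cauchy_Schwarz)
      fix x assume "x \<in> {a..t}"
      then have c: "cos (3 * (x - a)) > 0" using cpos t by auto
      then show "0 \<le> 3 * cos (3 * (x - a))" "0 \<le> p x" "(h x)\<^sup>2 \<le> 3 * cos (3 * (x - a)) * p x"
        by (auto simp: p_def)
    qed (use w t hi pi_int in auto)
    then show ?thesis using integral_unique[OF w] by (simp add: P_def W_def)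
  qed
  have parts: "((\<lambda>t. W t *\<^sub>R P t + \<phi> t *\<^sub>R p t) has_integral (\<phi> ?b *\<^sub>R P ?b - \<phi> a *\<^sub>R P a)) {a..?b}"
    unfolding \<phi>_def W_def
    by (rule integration_by_parts_primitive[OF _ pP]) (auto intro!: derivative_eq_intros continuous_intros)
  have iWP: "(\<lambda>t. W t * P t) integrable_on {a..?b}"
    by (intro integrable_continuous_interval continuous_intros cW cP)
  have "integral {a..?b} (\<lambda>t. (integral {a..t} h)\<^sup>2) \<le> integral {a..?b} (\<lambda>t. W t * P t)"
  proof (rule integral_le[OF _ iWP sq])
    show "(\<lambda>t. (integral {a..t} h)\<^sup>2) integrable_on {a..?b}"
      using hi[of ?b] by (intro integrable_continuous_interval[OF continuous_on_power[OF indefinite_integral_continuous_1]]) auto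
  qed auto
  also have "\<dots> = integral {a..?b} (\<lambda>t. - (\<phi> t * p t))"
  proof -
    have "((\<lambda>t. (W t * P t + \<phi> t * p t) - W t * P t) has_integral (0 - integral {a..?b} (\<lambda>t. W t * P t))) {a..?b}"
      using parts by (intro has_integral_diff integrable_integral[OF iWP]) (simp add: \<phi>_def P_def)
    from has_integral_neg[OF this]
    have "((\<lambda>t. - (\<phi> t * p t)) has_integral integral {a..?b} (\<lambda>t. W t * P t)) {a..?b}" by simp
    then show ?thesis by (rule integral_unique[symmetric])
  qed
  also have "\<dots> \<le> integral {a..?b} (\<lambda>t. (1/9) * (h t)\<^sup>2)"
  proof (rule integral_le)
    have "continuous_on {a..?b} (\<lambda>t. - \<phi> t)" unfolding \<phi>_def by (intro continuous_intros) auto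
    from absolutely_integrable_continuous_scaleR[OF this pa]
    show "(\<lambda>t. - (\<phi> t * p t)) integrable_on {a..?b}" by (simp add: absolutely_integrable_on_def)
    show "(\<lambda>t. (1/9) * (h t)\<^sup>2) integrable_on {a..?b}" using h(2) by (rule integrable_on_mult_right)
    fix t assume t: "t \<in> {a..?b}"
    let ?c = "cos (3 * (t - a))"
    \<comment> \<open>The constant 1/9 is the product of the factors 1/3 in \<phi> and in p; the
      remaining quotient is at most 1.\<close>
    have "- (\<phi> t * p t) = ((?c - cos (3/2)) / ?c) * ((1/9) * (h t)\<^sup>2)"
      using cpos[OF t] by (simp add: \<phi>_def p_def field_simps)
    also have "\<dots> \<le> 1 * ((1/9) * (h t)\<^sup>2)"
      using cpos[OF t] c32 by (intro mult_right_mono) auto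
    finally show "- (\<phi> t * p t) \<le> (1/9) * (h t)\<^sup>2" by simp
  qed
  finally show ?thesis by simp
qed

text \<open>Made for one half of a loop seen from its midpoint. The length travelled up to t is the
  integral of \<open>norm (g x)\<close>, whose mean square is bounded by the Poincare inequality; pi
  / 8 is pi / 4 over an interval of length 1/2.\<close>

lemma integral_inner_tangent_ge:
  fixes \<tau> g :: "real \<Rightarrow> 'a::euclidean_space"
  assumes p: "primitive_on a (a + 1/2) \<tau> g" and \<tau>: "\<And>x. x \<in> {a..a + 1/2} \<Longrightarrow> norm (\<tau> x) = 1"
    and g2: "(\<lambda>x. (norm (g x))\<^sup>2) integrable_on {a..a + 1/2}"
  shows "pi / 8 - integral {a..a + 1/2} (\<lambda>x. (norm (g x))\<^sup>2) / (9 * pi) \<le> integral {a..a + 1/2} (\<lambda>t. \<tau> a \<bullet> \<tau> t)"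
proof -
  let ?b = "a + 1/2"
  have ga: "(\<lambda>x. norm (g x)) absolutely_integrable_on {a..?b}"
    using p by (intro absolutely_integrable_norm[unfolded o_def]) (simp add: primitive_on_def)
  have iK: "(\<lambda>t. (integral {a..t} (\<lambda>x. norm (g x)))\<^sup>2) integrable_on {a..?b}"
    using primitive_on_integrable[OF p, of a ?b]
    by (intro integrable_continuous_interval[OF continuous_on_power[OF indefinite_integral_continuous_1]]) auto
  have "integral {a..?b} (\<lambda>t. pi / 4 - (1 / pi) * (integral {a..t} (\<lambda>x. norm (g x)))\<^sup>2) \<le> integral {a..?b} (\<lambda>t. \<tau> a \<bullet> \<tau> t)"
  proof (rule integral_le)
    show "(\<lambda>t. pi / 4 - (1 / pi) * (integral {a..t} (\<lambda>x. norm (g x)))\<^sup>2) integrable_on {a..?b}"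
      by (rule integrable_diff[OF integrable_const_ivl integrable_on_mult_right[OF iK]])
    show "(\<lambda>t. \<tau> a \<bullet> \<tau> t) integrable_on {a..?b}"
      by (intro integrable_continuous_interval continuous_intros continuous_on_primitive[OF p])
    show "pi / 4 - (1 / pi) * (integral {a..t} (\<lambda>x. norm (g x)))\<^sup>2 \<le> \<tau> a \<bullet> \<tau> t" if "t \<in> {a..?b}" for t
      using inner_ge_quadratic_length[OF primitive_on_subinterval[OF p, of a t]] that \<tau> by auto
  qed
  also have "integral {a..?b} (\<lambda>t. pi / 4 - (1 / pi) * (integral {a..t} (\<lambda>x. norm (g x)))\<^sup>2)
    = pi / 8 - (1 / pi) * integral {a..?b} (\<lambda>t. (integral {a..t} (\<lambda>x. norm (g x)))\<^sup>2)"
  proof -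
    have "((\<lambda>t. pi / 4 - (1 / pi) * (integral {a..t} (\<lambda>x. norm (g x)))\<^sup>2) has_integral
      ((1/2) *\<^sub>R (pi / 4) - (1 / pi) * integral {a..?b} (\<lambda>t. (integral {a..t} (\<lambda>x. norm (g x)))\<^sup>2))) {a..?b}"
      using has_integral_const_real[of "pi / 4" a ?b]
      by (intro has_integral_diff has_integral_mult_right integrable_integral iK) simp
    then show ?thesis by (simp add: integral_unique)
  qed
  finally have 1: "pi / 8 - (1 / pi) * integral {a..?b} (\<lambda>t. (integral {a..t} (\<lambda>x. norm (g x)))\<^sup>2)
    \<le> integral {a..?b} (\<lambda>t. \<tau> a \<bullet> \<tau> t)" .
  have "integral {a..?b} (\<lambda>t. (integral {a..t} (\<lambda>x. norm (g x)))\<^sup>2) \<le> (1/9) * integral {a..?b} (\<lambda>x. (norm (g x))\<^sup>2)"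
    by (rule Poincare_left_endpoint[OF ga g2])
  then have "(1 / pi) * integral {a..?b} (\<lambda>t. (integral {a..t} (\<lambda>x. norm (g x)))\<^sup>2) \<le>
     (1 / pi) * ((1/9) * integral {a..?b} (\<lambda>x. (norm (g x))\<^sup>2))"
    by (intro mult_left_mono) auto
  then show ?thesis using 1 by simp
qed

text \<open>For a unit-speed loop of length \<open>L\<close> this gives \<open>L \<integral>|\<kappa>|\<^sup>2 \<ge> 9\<pi>\<^sup>2/4\<close>; the optimal constant in this
  Li--Yau type inequality is about \<open>28.1\<close>.\<close>
lemma loop_bending_ge:
  fixes \<tau> g :: "real \<Rightarrow> 'a::euclidean_space"
  assumes H: "H1_deriv \<tau> g" and \<tau>: "\<And>x. x \<in> {0..1} \<Longrightarrow> norm (\<tau> x) = 1" and loop: "integral {0..1} \<tau> = 0"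
  shows "9 * pi\<^sup>2 / 4 \<le> integral {0..1} (\<lambda>x. (norm (g x))\<^sup>2)"
proof -
  have p: "primitive_on 0 1 \<tau> g" and g2: "(\<lambda>x. (norm (g x))\<^sup>2) integrable_on {0..1}"
    using H by (auto simp: H1_deriv_iff_primitive)
  have c\<tau>: "continuous_on {0..1} \<tau>" using p by (rule continuous_on_primitive)
  have g2': "(\<lambda>x. (norm (g x))\<^sup>2) integrable_on {0..1/2}" "(\<lambda>x. (norm (g x))\<^sup>2) integrable_on {1/2..1}"
    using integrable_on_subinterval[OF g2] by auto
  \<comment> \<open>Closedness is tested against the tangent at the midpoint: no parameter is
    farther than 1/2 from it, and the Poincare constant scales with the square of that
    distance.\<close>
  let ?e = "\<tau> (1/2)"
  have right: "pi / 8 - integral {1/2..1} (\<lambda>x. (norm (g x))\<^sup>2) / (9 * pi) \<le> integral {1/2..1} (\<lambda>t. ?e \<bullet> \<tau> t)"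
    using integral_inner_tangent_ge[of "1/2" \<tau> g] primitive_on_subinterval[OF p, of "1/2" 1] \<tau> g2' by auto
  \<comment> \<open>The left half is reflected, so that it too starts at the midpoint, now at
    parameter -1/2.\<close>
  have left: "pi / 8 - integral {0..1/2} (\<lambda>x. (norm (g x))\<^sup>2) / (9 * pi) \<le> integral {0..1/2} (\<lambda>t. ?e \<bullet> \<tau> t)"
  proof -
    have r: "integral {- 1/2..0} (\<lambda>x. f (- x)) = integral {0..1/2} f" for f :: "real \<Rightarrow> real"
      using Henstock_Kurzweil_Integration.integral_reflect_real[of "1/2" 0 f] by simp
    have pr: "primitive_on (- 1/2) 0 (\<lambda>x. \<tau> (- x)) (\<lambda>x. - g (- x))"
      unfolding primitive_on_def
    proof (intro conjI allI impI)
      have "g absolutely_integrable_on {0..1/2}"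
        using primitive_on_subinterval[OF p, of 0 "1/2"] by (simp add: primitive_on_def)
      then have "(\<lambda>x. g (- x)) absolutely_integrable_on {- (1/2)..- 0}"
        by (subst absolutely_integrable_reflect_real)
      then show "(\<lambda>x. - g (- x)) absolutely_integrable_on {- 1/2..0}"
        using absolutely_integrable_on_scaleR_iff[where c = "-1" and f = "\<lambda>x. g (- x)" and S = "{- 1/2..0}"] by simp
      show "\<tau> (- y) - \<tau> (- x) = integral {x..y} (\<lambda>x. - g (- x))" if "- 1/2 \<le> x" "x \<le> y" "y \<le> 0" for x y
      proof -
        have "integral {x..y} (\<lambda>x. g (- x)) = integral {- y..- x} g"
          using Henstock_Kurzweil_Integration.integral_reflect_real[of "- x" "- y" g] by simp
        moreover have "\<tau> (- x) - \<tau> (- y) = integral {- y..- x} g"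
          using p that by (auto simp: primitive_on_def)
        ultimately show ?thesis by (simp add: algebra_simps minus_equation_iff)
      qed
    qed
    have "(\<lambda>x. (norm (g (- x)))\<^sup>2) integrable_on {- (1/2)..- 0}"
      by (rule iffD2[OF Henstock_Kurzweil_Integration.integrable_reflect_real[where f = "\<lambda>x. (norm (g x))\<^sup>2"] g2'(1)])
    then have "pi / 8 - integral {- 1/2..0} (\<lambda>x. (norm (g (- x)))\<^sup>2) / (9 * pi) \<le> integral {- 1/2..0} (\<lambda>t. ?e \<bullet> \<tau> (- t))"
      using integral_inner_tangent_ge[of "- 1/2" "\<lambda>x. \<tau> (- x)" "\<lambda>x. - g (- x)"] pr \<tau> by auto
    then show ?thesis using r[of "\<lambda>x. (norm (g x))\<^sup>2"] r[of "\<lambda>t. ?e \<bullet> \<tau> t"] by simp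
  qed
  have ie: "(\<lambda>t. ?e \<bullet> \<tau> t) integrable_on {0..1}"
    by (intro integrable_continuous_interval continuous_intros c\<tau>)
  have "integral {0..1/2} (\<lambda>t. ?e \<bullet> \<tau> t) + integral {1/2..1} (\<lambda>t. ?e \<bullet> \<tau> t) = integral {0..1} (\<lambda>t. ?e \<bullet> \<tau> t)"
    using ie by (intro Henstock_Kurzweil_Integration.integral_combine) auto
  also have "\<dots> = ?e \<bullet> integral {0..1} \<tau>"
    using integral_linear[OF integrable_continuous_interval[OF c\<tau>] bounded_linear_inner_right[of ?e]] by (simp add: o_def)
  finally have "integral {0..1/2} (\<lambda>t. ?e \<bullet> \<tau> t) + integral {1/2..1} (\<lambda>t. ?e \<bullet> \<tau> t) = 0" by (simp add: loop)
  moreover have I: "integral {0..1/2} (\<lambda>x. (norm (g x))\<^sup>2) + integral {1/2..1} (\<lambda>x. (norm (g x))\<^sup>2)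
    = integral {0..1} (\<lambda>x. (norm (g x))\<^sup>2)"
    using g2 by (intro Henstock_Kurzweil_Integration.integral_combine) auto
  moreover have "integral {0..1/2} (\<lambda>x. (norm (g x))\<^sup>2) / (9 * pi) + integral {1/2..1} (\<lambda>x. (norm (g x))\<^sup>2) / (9 * pi)
    = integral {0..1} (\<lambda>x. (norm (g x))\<^sup>2) / (9 * pi)"
    unfolding I[symmetric] by (rule add_divide_distrib[symmetric])
  ultimately have "pi / 4 \<le> integral {0..1} (\<lambda>x. (norm (g x))\<^sup>2) / (9 * pi)"
    using left right by linarith
  then show ?thesis by (simp add: field_simps power2_eq_square)
qed

section \<open>Networks as triples of unit tangent curves\<close>

text \<open>\<open>C i\<close> is an upper bound for the Dirichlet integral of \<open>\<tau> i\<close>. Zero lengths are admitted so that the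
  class is closed under limits.\<close>
definition theta_data :: "(3 \<Rightarrow> real \<Rightarrow> 'a::euclidean_space) \<Rightarrow> (3 \<Rightarrow> real) \<Rightarrow> (3 \<Rightarrow> real) \<Rightarrow> bool" where
  "theta_data \<tau> L C \<longleftrightarrow>
     (\<forall>i. 0 \<le> L i \<and> continuous_on {0..1} (\<tau> i) \<and> (\<forall>x\<in>{0..1}. norm (\<tau> i x) = 1) \<and>
       (\<forall>k. dyadic_energy (\<tau> i) k \<le> C i)) \<and>
     (\<forall>i j. L i *\<^sub>R integral {0..1} (\<tau> i) = L j *\<^sub>R integral {0..1} (\<tau> j)) \<and>
     (\<forall>x\<in>{0, 1}. \<forall>i j. i \<noteq> j \<longrightarrow> \<tau> i x \<bullet> \<tau> j x = - 1 / 2)"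

text \<open>For \<open>L i = 0\<close> the quotient is 0 by the convention for division, so values
  are compared only among data with positive lengths.\<close>

definition data_energy :: "(3 \<Rightarrow> real) \<Rightarrow> (3 \<Rightarrow> real) \<Rightarrow> real" where
  "data_energy L C = (\<Sum>i\<in>UNIV. C i / L i + L i)"

lemma dyadic_energy_nonneg: "0 \<le> dyadic_energy F k"
  by (auto simp: dyadic_energy_def intro: sum_nonneg)

lemma theta_dataD:
  assumes "theta_data \<tau> L C"
  shows "0 \<le> L i" "continuous_on {0..1} (\<tau> i)" "\<And>x. x \<in> {0..1} \<Longrightarrow> norm (\<tau> i x) = 1"
    "dyadic_energy (\<tau> i) k \<le> C i" "L i *\<^sub>R integral {0..1} (\<tau> i) = L j *\<^sub>R integral {0..1} (\<tau> j)"
    "i \<noteq> j \<Longrightarrow> \<tau> i 0 \<bullet> \<tau> j 0 = - 1 / 2" "0 \<le> C i"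
proof -
  show "0 \<le> L i" "continuous_on {0..1} (\<tau> i)" "\<And>x. x \<in> {0..1} \<Longrightarrow> norm (\<tau> i x) = 1"
    using assms by (simp_all add: theta_data_def)
  show dy: "dyadic_energy (\<tau> i) k \<le> C i" for k using assms by (simp add: theta_data_def)
  show "L i *\<^sub>R integral {0..1} (\<tau> i) = L j *\<^sub>R integral {0..1} (\<tau> j)"
    using assms unfolding theta_data_def by blast
  show "i \<noteq> j \<Longrightarrow> \<tau> i 0 \<bullet> \<tau> j 0 = - 1 / 2" using assms by (simp add: theta_data_def)
  show "0 \<le> C i" using dyadic_energy_nonneg dy by (rule order_trans)
qed

lemma theta_data_H1:
  assumes "theta_data \<tau> L C"
  obtains h where "H1_deriv (\<tau> i) h" "integral {0..1} (\<lambda>x. (norm (h x))\<^sup>2) \<le> C i"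
  using H1_deriv_of_dyadic_energy_bounded[of "\<tau> i" "C i"] theta_dataD[OF assms] by metis

lemma cos_2pi_3: "cos (2 * pi / 3) = - 1 / 2" and sin_2pi_3: "sin (2 * pi / 3) = sqrt 3 / 2"
proof -
  have e: "2 * pi / 3 = pi - pi / 3" by simp
  show "cos (2 * pi / 3) = - 1 / 2" unfolding e cos_pi_minus cos_60 by simp
  show "sin (2 * pi / 3) = sqrt 3 / 2" unfolding e sin_pi_minus sin_60 by simp
qed

lemma angle_unit_eq_iff:
  assumes "norm u = 1" "norm v = 1"
  shows "angle u v = 2 * pi / 3 \<longleftrightarrow> u \<bullet> v = - 1 / 2"
proof -
  have "\<bar>u \<bullet> v\<bar> \<le> 1" using Cauchy_Schwarz_ineq2[of u v] assms by simp
  then have c: "cos (arccos (u \<bullet> v)) = u \<bullet> v" by (intro cos_arccos) auto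
  have a: "angle u v = arccos (u \<bullet> v)" by (simp add: angle_def assms)
  have "arccos (cos (2 * pi / 3)) = 2 * pi / 3" by (intro arccos_cos) auto
  then show ?thesis unfolding a using c cos_2pi_3 by metis
qed

lemma theta_network_data:
  fixes \<Gamma> :: "3 \<Rightarrow> real \<Rightarrow> real ^ 'n"
  assumes "\<Gamma> \<in> Theta_networks"
  obtains \<tau> :: "3 \<Rightarrow> real \<Rightarrow> real ^ 'n" and L C where
    "theta_data \<tau> L C" "\<And>i. 0 < L i" "energy \<Gamma> = ennreal (data_energy L C)"
proof -
  note T = assms[unfolded Theta_networks_def mem_Collect_eq]
  note \<Gamma> = T[THEN conjunct1, rule_format, THEN conjunct1] T[THEN conjunct1, rule_format, THEN conjunct2]
    T[THEN conjunct2, THEN conjunct1, rule_format] T[THEN conjunct2, THEN conjunct2, rule_format]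
  let ?E = "\<lambda>i. \<integral>\<^sup>+ x. ennreal (((norm (curvature (\<Gamma> i) x))\<^sup>2 + 1) * norm (velocity (\<Gamma> i) x)) \<partial>(lebesgue_on I01)"
  let ?P = "\<lambda>i \<tau> L C. L > 0 \<and> continuous_on {0..1} \<tau> \<and> (\<forall>x\<in>{0..1}. norm (\<tau> x) = 1) \<and>
    (\<forall>k. dyadic_energy \<tau> k \<le> C) \<and> \<tau> 0 = unit_tangent (\<Gamma> i) 0 \<and> \<tau> 1 = unit_tangent (\<Gamma> i) 1 \<and>
    L *\<^sub>R integral {0..1} \<tau> = \<Gamma> i 1 - \<Gamma> i 0 \<and> ?E i = ennreal (C / L + L)"
  have "\<exists>\<tau> L C. ?P i \<tau> L C" for i
  proof (rule tangent_of_curve[OF \<Gamma>(1,2)[of i]])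
    fix \<tau> L C
    assume a: "L > 0" "continuous_on {0..1} \<tau>" "\<And>x. x \<in> {0..1} \<Longrightarrow> norm (\<tau> x) = 1"
      "\<And>k. dyadic_energy \<tau> k \<le> C" "\<tau> 0 = unit_tangent (\<Gamma> i) 0" "\<tau> 1 = unit_tangent (\<Gamma> i) 1"
      "L *\<^sub>R integral {0..1} \<tau> = \<Gamma> i 1 - \<Gamma> i 0" "?E i = ennreal (C / L + L)"
    show ?thesis
      by (intro exI[of _ \<tau>] exI[of _ L] exI[of _ C] conjI allI ballI a)
  qed
  then have "\<forall>i. \<exists>t. ?P i (fst t) (fst (snd t)) (snd (snd t))" by auto
  then obtain t where t: "\<And>i. ?P i (fst (t i)) (fst (snd (t i))) (snd (snd (t i)))"
    using choice[of "\<lambda>i t. ?P i (fst t) (fst (snd t)) (snd (snd t))"] by blast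
  define \<tau> L C where "\<tau> i = fst (t i)" and "L i = fst (snd (t i))" and "C i = snd (snd (t i))" for i
  have P: "?P i (\<tau> i) (L i) (C i)" for i unfolding \<tau>_def L_def C_def by (rule t)
  have ne: "norm (unit_tangent (\<Gamma> i) x) = 1" if "x \<in> {0, 1}" for i x
    using that by (intro norm_unit_tangent \<Gamma>) auto
  have ang: "unit_tangent (\<Gamma> i) x \<bullet> unit_tangent (\<Gamma> j) x = - 1 / 2" if "x \<in> {0, 1}" "i \<noteq> j" for i j x
    using \<Gamma>(4)[OF that] angle_unit_eq_iff[OF ne ne] that by blast
  have disp: "\<Gamma> i 1 - \<Gamma> i 0 = \<Gamma> j 1 - \<Gamma> j 0" for i j
    using \<Gamma>(3)[of 0 i j] \<Gamma>(3)[of 1 i j] by simp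
  have "theta_data \<tau> L C"
    unfolding theta_data_def
  proof (intro conjI allI ballI impI)
    show "0 \<le> L i" for i using P[of i] by simp
    show "L i *\<^sub>R integral {0..1} (\<tau> i) = L j *\<^sub>R integral {0..1} (\<tau> j)" for i j
      using P[of i] P[of j] disp[of i j] by simp
    show "\<tau> i x \<bullet> \<tau> j x = - 1 / 2" if "x \<in> {0, 1}" "i \<noteq> j" for i j x
      using P[of i] P[of j] ang[OF that] that by auto
  qed (use P in blast)+
  moreover have "energy \<Gamma> = ennreal (data_energy L C)"
  proof -
    have C0: "0 \<le> C i" for i using P dyadic_energy_nonneg order_trans by blast
    have "energy \<Gamma> = (\<Sum>i\<in>UNIV. ennreal (C i / L i + L i))"
      unfolding energy_def using P by (intro sum.cong) auto
    also have "\<dots> = ennreal (data_energy L C)"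
      unfolding data_energy_def using P C0 by (intro sum_ennreal) (auto intro!: add_nonneg_nonneg divide_nonneg_nonneg simp: less_imp_le)
    finally show ?thesis .
  qed
  ultimately show thesis using that P by blast
qed

text \<open>Only an inequality, because \<open>C i\<close> may exceed the Dirichlet integral of
  \<open>\<tau> i\<close>. With the equality in \<open>theta_network_data\<close> it is enough:
  minimal data produce a minimal network.\<close>

lemma theta_network_of_data:
  fixes \<tau> :: "3 \<Rightarrow> real \<Rightarrow> real ^ 'n"
  assumes D: "theta_data \<tau> L C" and L: "\<And>i. 0 < L i"
  obtains \<Gamma> :: "3 \<Rightarrow> real \<Rightarrow> real ^ 'n" where "\<Gamma> \<in> Theta_networks" "energy \<Gamma> \<le> ennreal (data_energy L C)"
proof -
  note d = theta_dataD[OF D]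
  have "\<exists>h. H1_deriv (\<tau> i) h \<and> integral {0..1} (\<lambda>x. (norm (h x))\<^sup>2) \<le> C i" for i
    using theta_data_H1[OF D] by metis
  then obtain h where h: "\<And>i. H1_deriv (\<tau> i) (h i)" "\<And>i. integral {0..1} (\<lambda>x. (norm (h i x))\<^sup>2) \<le> C i" by metis
  define \<Gamma> where "\<Gamma> i x = L i *\<^sub>R integral {0..x} (\<tau> i)" for i x
  note c = curve_of_tangent[of "\<tau> i" "h i" "L i" "\<Gamma> i" for i, OF h(1) d(3) L \<Gamma>_def]
  have "angle (unit_tangent (\<Gamma> i) x) (unit_tangent (\<Gamma> j) x) = 2 * pi / 3" if "x \<in> {0, 1}" "i \<noteq> j" for i j x
  proof -
    have x: "x \<in> {0..1}" using that by auto
    have "\<tau> i x \<bullet> \<tau> j x = - 1 / 2" using D that unfolding theta_data_def by blast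
    then show ?thesis using angle_unit_eq_iff[OF d(3)[OF x] d(3)[OF x]] c(3)[OF _ x] by simp
  qed
  moreover have "\<Gamma> i x = \<Gamma> j x" if "x \<in> {0, 1}" for i j x
    using that d(5)[of i j] by (auto simp: \<Gamma>_def)
  ultimately have "\<Gamma> \<in> Theta_networks"
    unfolding Theta_networks_def using c(1,2) by simp
  moreover have "energy \<Gamma> \<le> ennreal (data_energy L C)"
  proof -
    have "energy \<Gamma> = (\<Sum>i\<in>UNIV. ennreal (integral {0..1} (\<lambda>x. (norm (h i x))\<^sup>2) / L i + L i))"
      unfolding energy_def using c(4) by (intro sum.cong) auto
    also have "\<dots> \<le> (\<Sum>i\<in>UNIV. ennreal (C i / L i + L i))"
      using h(2) L by (intro sum_mono ennreal_leI add_right_mono divide_right_mono) (auto simp: less_imp_le)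
    also have "\<dots> = ennreal (data_energy L C)"
      unfolding data_energy_def using L d(7)
      by (intro sum_ennreal) (auto intro!: add_nonneg_nonneg divide_nonneg_nonneg simp: less_imp_le)
    finally show ?thesis .
  qed
  ultimately show thesis using that by blast
qed

text \<open>The competitor is the standard double bubble: a chord of length \<open>\<surd>3\<close> and two unit circular arcs
  of angle \<open>4\<pi>/3\<close>.\<close>
lemma double_bubble_data:
  fixes u w :: "'a::euclidean_space"
  assumes uw: "norm u = 1" "norm w = 1" "u \<bullet> w = 0"
  obtains \<tau> :: "3 \<Rightarrow> real \<Rightarrow> 'a" and L C where "theta_data \<tau> L C" "\<And>i. 0 < L i" "data_energy L C < 6 * pi"
proof -
  \<comment> \<open>The tangent angle of an arc turns linearly from 2 pi / 3 to - 2 pi / 3. The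
    factor \<sigma> selects the chord (0) and the two mirror-image arcs (1 and -1).\<close>
  define f where "f x = 2 * pi / 3 - 4 * pi / 3 * x" for x :: real
  define \<sigma> :: "3 \<Rightarrow> real" where "\<sigma> i = (if i = 1 then 0 else if i = 2 then 1 else - 1)" for i
  define \<tau> where "\<tau> i x = cos (\<sigma> i * f x) *\<^sub>R u + sin (\<sigma> i * f x) *\<^sub>R w" for i x
  \<comment> \<open>A unit arc of angle 4 pi / 3 has chord 2 sin (2 pi / 3) = sqrt 3, so all three
    displacements are sqrt 3 times u.\<close>
  define L :: "3 \<Rightarrow> real" where "L i = (if i = 1 then sqrt 3 else 4 * pi / 3)" for i
  define C :: "3 \<Rightarrow> real" where "C i = (\<sigma> i * (4 * pi / 3))\<^sup>2" for i
  have uu: "u \<bullet> u = 1" "w \<bullet> w = 1" "w \<bullet> u = 0" using uw by (auto simp: norm_eq_1 inner_commute)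
  have inn: "\<tau> i x \<bullet> \<tau> j y = cos (\<sigma> i * f x - \<sigma> j * f y)" for i j x y
    by (simp add: \<tau>_def inner_add_left inner_add_right uw uu cos_diff)
  have n1: "norm (\<tau> i x) = 1" for i x by (simp add: norm_eq_1 inn)
  have lip: "norm (\<tau> i y - \<tau> i x) \<le> \<bar>\<sigma> i * (4 * pi / 3)\<bar> * norm (y - x)" for i x y
  proof (rule power2_le_imp_le)
    define d where "d = \<sigma> i * f y - \<sigma> i * f x"
    have "(norm (\<tau> i y - \<tau> i x))\<^sup>2 = 2 - 2 * cos d"
      unfolding power2_norm_eq_inner inner_diff_left inner_diff_right inn
      using cos_minus[of d] by (simp add: d_def)
    also have "\<dots> = 4 * (sin (d / 2))\<^sup>2" using cos_double_sin[of "d / 2"] by simp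
    also have "\<dots> \<le> 4 * (d / 2)\<^sup>2"
      by (intro mult_left_mono iffD1[OF abs_le_square_iff] abs_sin_x_le_abs_x) auto
    also have "\<dots> = (\<bar>\<sigma> i * (4 * pi / 3)\<bar> * norm (y - x))\<^sup>2"
    proof -
      have "d = - (\<sigma> i * (4 * pi / 3) * (y - x))" by (simp add: d_def f_def field_simps)
      then show ?thesis by (simp add: power_mult_distrib power_divide)
    qed
    finally show "(norm (\<tau> i y - \<tau> i x))\<^sup>2 \<le> (\<bar>\<sigma> i * (4 * pi / 3)\<bar> * norm (y - x))\<^sup>2" .
  qed simp
  have dy: "dyadic_energy (\<tau> i) k \<le> C i" for i k
  proof -
    have "dyadic_energy (\<lambda>x::real. x) k = 1"
      by (simp add: dyadic_energy_alt diff_divide_distrib[symmetric] power2_eq_square)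
    then show ?thesis using dyadic_energy_Lipschitz[of "\<tau> i" _ "\<lambda>x. x" k, OF lip] unfolding C_def power2_abs by simp
  qed
  have cont: "continuous_on {0..1} (\<tau> i)" for i
    unfolding \<tau>_def f_def by (intro continuous_intros) auto
  have disp: "L i *\<^sub>R integral {0..1} (\<tau> i) = sqrt 3 *\<^sub>R u" for i
  proof (cases "i = 1")
    case True
    then have "\<tau> i = (\<lambda>_. u)" by (auto simp: \<tau>_def \<sigma>_def)
    then show ?thesis using True by (simp add: L_def)
  next
    case False
    then have s: "\<sigma> i = 1 \<or> \<sigma> i = -1" by (auto simp: \<sigma>_def)
    define G where "G x = (- (3 / (4 * pi)) * \<sigma> i * sin (\<sigma> i * f x)) *\<^sub>R u + ((3 / (4 * pi)) * \<sigma> i * cos (\<sigma> i * f x)) *\<^sub>R w" for x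
    have "(\<tau> i has_integral (G 1 - G 0)) {0..1}"
    proof (rule fundamental_theorem_of_calculus)
      fix x :: real
      have d1: "((\<lambda>x. - (3 / (4 * pi)) * \<sigma> i * sin (\<sigma> i * f x)) has_real_derivative cos (\<sigma> i * f x)) (at x within {0..1})"
        using s unfolding f_def by (auto intro!: derivative_eq_intros)
      have d2: "((\<lambda>x. (3 / (4 * pi)) * \<sigma> i * cos (\<sigma> i * f x)) has_real_derivative sin (\<sigma> i * f x)) (at x within {0..1})"
        using s unfolding f_def by (auto intro!: derivative_eq_intros)
      show "(G has_vector_derivative \<tau> i x) (at x within {0..1})"
        unfolding G_def \<tau>_def
        by (intro has_vector_derivative_add bounded_linear.has_vector_derivative[OF bounded_linear_scaleR_left]
            d1[unfolded has_real_derivative_iff_has_vector_derivative]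
            d2[unfolded has_real_derivative_iff_has_vector_derivative])
    qed simp
    then have "integral {0..1} (\<tau> i) = G 1 - G 0" by (rule integral_unique)
    also have "\<dots> = (3 * sqrt 3 / (4 * pi)) *\<^sub>R u"
    proof -
      have f01: "f 0 = 2 * pi / 3" "f 1 = - (2 * pi / 3)" by (auto simp: f_def field_simps)
      show ?thesis using s unfolding G_def f01
        by (auto simp: sin_2pi_3 cos_2pi_3 scaleR_add_left[symmetric] simp del: scaleR_add_left simp flip: scaleR_diff_left)
    qed
    finally show ?thesis using False by (simp add: L_def)
  qed
  have "theta_data \<tau> L C"
    unfolding theta_data_def
  proof (intro conjI allI ballI impI)
    show "0 \<le> L i" for i by (simp add: L_def)
    show "L i *\<^sub>R integral {0..1} (\<tau> i) = L j *\<^sub>R integral {0..1} (\<tau> j)" for i j by (simp add: disp)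
    fix x :: real and i j :: 3 assume x: "x \<in> {0, 1}" and ij: "i \<noteq> j"
    have 4: "cos (4 * pi / 3) = - 1 / 2"
    proof -
      have "cos (4 * pi / 3) = cos (2 * pi - 2 * pi / 3)" by (simp add: field_simps)
      then show ?thesis using cos_2pi_3 by (simp only: cos_2pi_minus)
    qed
    have c: "cos (r * f x) = - 1 / 2" if "r \<in> {1, -1, 2, -2}" for r
    proof -
      have "f x = 2 * pi / 3 \<or> f x = - (2 * pi / 3)" using x by (auto simp: f_def field_simps)
      then have "r * f x \<in> {2 * pi / 3, - (2 * pi / 3), 4 * pi / 3, - (4 * pi / 3)}" using that by auto
      then show ?thesis using cos_2pi_3 4 by (auto simp only: insert_iff empty_iff cos_minus)
    qed
    \<comment> \<open>At both ends the three tangent angles thus differ by 2 pi / 3 or 4 pi / 3 up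
      to sign, and these angles have the same cosine.\<close>
    have "\<sigma> i - \<sigma> j \<in> {1, -1, 2, -2}"
      using ij exhaust_3[of i] exhaust_3[of j] by (auto simp: \<sigma>_def)
    from c[OF this] show "\<tau> i x \<bullet> \<tau> j x = - 1 / 2" by (simp add: inn left_diff_distrib)
  qed (use n1 dy cont in auto)
  moreover have "0 < L i" for i by (simp add: L_def)
  moreover have "data_energy L C < 6 * pi"
  proof -
    have "data_energy L C = sqrt 3 + 2 * (4 * pi / 3 + 4 * pi / 3)"
      unfolding data_energy_def sum_3 by (simp add: L_def C_def \<sigma>_def power2_eq_square)
    \<comment> \<open>The crude bound suffices: 16 pi / 3 + 2 < 6 pi says precisely that 3 <
      pi.\<close>
    also have "sqrt 3 < 2" by (rule real_less_lsqrt) auto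
    finally show ?thesis using pi_gt3 by simp
  qed
  ultimately show thesis using that by blast
qed

section \<open>Compactness and existence\<close>

text \<open>Cauchy-Schwarz gives the Hoelder exponent 1/2, and squaring avoids roots. A common bound
  on C makes this the equicontinuity for Arzela-Ascoli, while \<open>C i = 0\<close> freezes the
  tangent.\<close>

lemma theta_data_Hoelder:
  assumes D: "theta_data \<tau> L C" and xy: "x \<in> {0..1}" "y \<in> {0..1}"
  shows "(norm (\<tau> i y - \<tau> i x))\<^sup>2 \<le> C i * \<bar>y - x\<bar>"
proof -
  obtain h where h: "H1_deriv (\<tau> i) h" "integral {0..1} (\<lambda>x. (norm (h x))\<^sup>2) \<le> C i"
    using theta_data_H1[OF D] by blast
  have *: "(norm (\<tau> i t - \<tau> i s))\<^sup>2 \<le> C i * (t - s)" if "0 \<le> s" "s \<le> t" "t \<le> 1" for s t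
  proof -
    have h2: "(\<lambda>x. (norm (h x))\<^sup>2) integrable_on {0..1}" using h(1) by (simp add: H1_deriv_def)
    have "integral {s..t} (\<lambda>x. (norm (h x))\<^sup>2) \<le> integral {0..1} (\<lambda>x. (norm (h x))\<^sup>2)"
      using that integrable_on_subinterval[OF h2, of s t] h2 by (intro integral_subset_le) auto
    then have "(t - s) * integral {s..t} (\<lambda>x. (norm (h x))\<^sup>2) \<le> (t - s) * C i"
      using h(2) that by (intro mult_left_mono) auto
    then show ?thesis using H1_increment_le[OF h(1) that] by (simp add: mult.commute)
  qed
  show ?thesis
    using *[of x y] *[of y x] xy by (cases "x \<le> y") (auto simp: norm_minus_commute)
qed

lemma norm_vec_le_sum: "norm (x :: 'a::real_normed_vector ^ 'n) \<le> (\<Sum>i\<in>UNIV. norm (x $ i))"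
  unfolding norm_vec_def by (rule L2_set_le_sum) simp

lemma bounded_subsequence_functions:
  fixes A :: "nat \<Rightarrow> 'n::finite \<Rightarrow> real"
  assumes "\<And>k i. \<bar>A k i\<bar> \<le> M"
  obtains r a where "strict_mono (r :: nat \<Rightarrow> nat)" "\<And>i. (\<lambda>k. A (r k) i) \<longlonglongrightarrow> a i"
proof -
  let ?v = "\<lambda>k. (\<chi> i. A k i) :: real ^ 'n"
  have "norm (?v k) \<le> (\<Sum>i\<in>(UNIV :: 'n set). M)" for k
    by (rule order_trans[OF norm_vec_le_sum sum_mono]) (use assms in simp)
  then have "bounded (range ?v)" unfolding bounded_iff by blast
  then obtain l r where r: "strict_mono (r :: nat \<Rightarrow> nat)" "(?v \<circ> r) \<longlonglongrightarrow> l"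
    using bounded_imp_convergent_subsequence by blast
  have "(\<lambda>k. A (r k) i) \<longlonglongrightarrow> l $ i" for i
    using tendsto_vec_nth[OF r(2), of i] by (simp add: o_def)
  then show thesis using that[of r "\<lambda>i. l $ i"] r(1) by blast
qed

text \<open>Every clause of \<open>theta_data\<close> survives pointwise convergence: dyadic
  energies involve finitely many values, the angle condition involves endpoint values, and
  displacements converge by dominated convergence.\<close>

lemma theta_data_compact:
  fixes \<tau> :: "nat \<Rightarrow> 3 \<Rightarrow> real \<Rightarrow> 'a::euclidean_space"
  assumes D: "\<And>k. theta_data (\<tau> k) (L k) (C k)" and bL: "\<And>k i. L k i \<le> M" and bC: "\<And>k i. C k i \<le> M"
  obtains r \<tau>' L' C' where "strict_mono (r :: nat \<Rightarrow> nat)" "theta_data \<tau>' L' C'"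
    "\<And>i. (\<lambda>k. L (r k) i) \<longlonglongrightarrow> L' i" "\<And>i. (\<lambda>k. C (r k) i) \<longlonglongrightarrow> C' i"
    "\<And>i. (\<lambda>k. integral {0..1} (\<tau> (r k) i)) \<longlonglongrightarrow> integral {0..1} (\<tau>' i)"
proof -
  note d = theta_dataD[OF D]
  have M0: "0 \<le> M" using d(1)[of 0 1] bL[of 0 1] by linarith
  \<comment> \<open>The three tangents are packed into one vector-valued map, so that a single
    extraction serves all of them.\<close>
  define F where "F k x = (\<chi> i. \<tau> k i x)" for k x
  have bound: "norm (F k x) \<le> 3" if "x \<in> {0..1}" for k x
    using norm_vec_le_sum[of "F k x"] d(3)[OF that] by (simp add: F_def)
  have equi: "\<exists>\<delta>>0. \<forall>k y. y \<in> {0..1} \<and> norm (x - y) < \<delta> \<longrightarrow> norm (F k x - F k y) < e"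
    if x: "x \<in> {0..1}" and e: "0 < e" for x e
  proof (intro exI conjI allI impI)
    \<comment> \<open>The factor e / 3 is the share of each of the three components; M + 1 keeps the
      denominator positive when M = 0.\<close>
    let ?\<delta> = "(e / 3)\<^sup>2 / (M + 1)"
    show "0 < ?\<delta>" using e M0 by simp
    fix k y assume y: "y \<in> {0..1} \<and> norm (x - y) < ?\<delta>"
    have "norm (\<tau> k i x - \<tau> k i y) < e / 3" for i
    proof (rule power2_less_imp_less)
      have "(norm (\<tau> k i x - \<tau> k i y))\<^sup>2 \<le> C k i * \<bar>x - y\<bar>"
        using theta_data_Hoelder[OF D] x y by auto
      also have "\<dots> \<le> (M + 1) * \<bar>x - y\<bar>" using bC[of k i] by (intro mult_right_mono) auto
      also have "\<dots> < (e / 3)\<^sup>2" using y M0 by (simp add: field_simps)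
      finally show "(norm (\<tau> k i x - \<tau> k i y))\<^sup>2 < (e / 3)\<^sup>2" .
    qed (use e in auto)
    then have "(\<Sum>i\<in>UNIV. norm (\<tau> k i x - \<tau> k i y)) < (\<Sum>i\<in>(UNIV :: 3 set). e / 3)"
      by (intro sum_strict_mono) auto
    then show "norm (F k x - F k y) < e"
      using norm_vec_le_sum[of "F k x - F k y"] by (simp add: F_def)
  qed
  have "\<exists>g r. continuous_on {0..1} g \<and> strict_mono (r :: nat \<Rightarrow> nat) \<and>
    (\<forall>e>0. \<exists>N. \<forall>n x. n \<ge> N \<and> x \<in> {0..1} \<longrightarrow> norm (F (r n) x - g x) < e)"
    by (rule Arzela_Ascoli[of "{0..1}" F 3]) (use bound equi in auto)
  then obtain g r1 where g: "continuous_on {0..1} g" and r1: "strict_mono (r1 :: nat \<Rightarrow> nat)"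
    and conv: "\<And>e. e > 0 \<Longrightarrow> \<exists>N. \<forall>n x. n \<ge> N \<and> x \<in> {0..1} \<longrightarrow> norm (F (r1 n) x - g x) < e" by blast
  have "\<bar>L (r1 k) i\<bar> \<le> M" for k i using d(1) bL by (simp add: abs_of_nonneg)
  then obtain r2 L' where r2: "strict_mono (r2 :: nat \<Rightarrow> nat)" "\<And>i. (\<lambda>k. L (r1 (r2 k)) i) \<longlonglongrightarrow> L' i"
    using bounded_subsequence_functions[of "\<lambda>k. L (r1 k)" M] by blast
  have "\<bar>C (r1 (r2 k)) i\<bar> \<le> M" for k i using d(7) bC by (simp add: abs_of_nonneg)
  then obtain r3 C' where r3: "strict_mono (r3 :: nat \<Rightarrow> nat)" "\<And>i. (\<lambda>k. C (r1 (r2 (r3 k))) i) \<longlonglongrightarrow> C' i"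
    using bounded_subsequence_functions[of "\<lambda>k. C (r1 (r2 k))" M] by blast
  define r where "r k = r1 (r2 (r3 k))" for k
  define \<tau>' where "\<tau>' i x = g x $ i" for i x
  have r: "strict_mono r" unfolding r_def using r1 r2(1) r3(1) by (simp add: strict_mono_def)
  have limL: "(\<lambda>k. L (r k) i) \<longlonglongrightarrow> L' i" for i
    using LIMSEQ_subseq_LIMSEQ[OF r2(2) r3(1)] by (simp add: r_def o_def)
  have limC: "(\<lambda>k. C (r k) i) \<longlonglongrightarrow> C' i" for i using r3(2) by (simp add: r_def)
  have lim\<tau>: "(\<lambda>k. \<tau> (r k) i x) \<longlonglongrightarrow> \<tau>' i x" if x: "x \<in> {0..1}" for i x
  proof -
    have "(\<lambda>k. F (r1 k) x) \<longlonglongrightarrow> g x" using conv x by (fastforce intro!: LIMSEQ_I)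
    moreover have "strict_mono (\<lambda>k. r2 (r3 k))" using r2(1) r3(1) by (simp add: strict_mono_def)
    ultimately have "((\<lambda>k. F (r1 k) x) \<circ> (\<lambda>k. r2 (r3 k))) \<longlonglongrightarrow> g x" by (rule LIMSEQ_subseq_LIMSEQ)
    from tendsto_vec_nth[OF this, of i] show ?thesis by (simp add: o_def F_def r_def \<tau>'_def)
  qed
  have limI: "(\<lambda>k. integral {0..1} (\<tau> (r k) i)) \<longlonglongrightarrow> integral {0..1} (\<tau>' i)" for i
    by (rule dominated_convergence(2)[where h = "\<lambda>_. 1"])
       (use d(2,3) lim\<tau> in \<open>auto simp: integrable_const_ivl intro: integrable_continuous_interval\<close>)
  have "theta_data \<tau>' L' C'"
    unfolding theta_data_def
  proof (intro conjI allI ballI impI)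
    show "0 \<le> L' i" for i by (rule LIMSEQ_le_const[OF limL]) (use d(1) in auto)
    show "continuous_on {0..1} (\<tau>' i)" for i unfolding \<tau>'_def using g by (intro continuous_intros)
    show "norm (\<tau>' i x) = 1" if "x \<in> {0..1}" for i x
      using tendsto_norm[OF lim\<tau>[OF that]] d(3)[OF that] LIMSEQ_unique[OF _ tendsto_const] by fastforce
    show "dyadic_energy (\<tau>' i) k \<le> C' i" for i k
    proof (rule LIMSEQ_le[OF _ limC])
      have "real (Suc j) / 2 ^ k \<in> {0..1}" "real j / 2 ^ k \<in> {0..1}" if "j < 2 ^ k" for j
        using dyadic_interval_subset[OF that] that by (auto simp: divide_right_mono)
      then show "(\<lambda>n. dyadic_energy (\<tau> (r n) i) k) \<longlonglongrightarrow> dyadic_energy (\<tau>' i) k"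
        unfolding dyadic_energy_alt by (intro tendsto_intros lim\<tau>) auto
    qed (use d(4) in auto)
    show "L' i *\<^sub>R integral {0..1} (\<tau>' i) = L' j *\<^sub>R integral {0..1} (\<tau>' j)" for i j
    proof (rule LIMSEQ_unique)
      show "(\<lambda>k. L (r k) i *\<^sub>R integral {0..1} (\<tau> (r k) i)) \<longlonglongrightarrow> L' i *\<^sub>R integral {0..1} (\<tau>' i)"
        by (intro tendsto_intros limL limI)
      show "(\<lambda>k. L (r k) i *\<^sub>R integral {0..1} (\<tau> (r k) i)) \<longlonglongrightarrow> L' j *\<^sub>R integral {0..1} (\<tau>' j)"
        unfolding d(5)[of _ i j] by (intro tendsto_intros limL limI)
    qed
    show "\<tau>' i x \<bullet> \<tau>' j x = - 1 / 2" if x: "x \<in> {0, 1}" and ij: "i \<noteq> j" for i j x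
    proof (rule LIMSEQ_unique)
      have x01: "x \<in> {0..1}" using x by auto
      show "(\<lambda>k. \<tau> (r k) i x \<bullet> \<tau> (r k) j x) \<longlonglongrightarrow> \<tau>' i x \<bullet> \<tau>' j x"
        by (intro tendsto_intros lim\<tau> x01)
      have "\<tau> k i x \<bullet> \<tau> k j x = - 1 / 2" for k using D[of k] x ij unfolding theta_data_def by blast
      then show "(\<lambda>k. \<tau> (r k) i x \<bullet> \<tau> (r k) j x) \<longlonglongrightarrow> - 1 / 2" by simp
    qed
  qed
  then show thesis using that r limL limC limI by blast
qed

text \<open>AM-GM gives C / L + L >= 2 sqrt C for every length, and the bound on loops says sqrt C
  >= 3 pi / 2.\<close>

lemma loop_energy_ge:
  assumes D: "theta_data \<tau> L C" and L: "0 < L i" and loop: "integral {0..1} (\<tau> i) = 0"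
  shows "3 * pi \<le> C i / L i + L i"
proof -
  obtain h where h: "H1_deriv (\<tau> i) h" "integral {0..1} (\<lambda>x. (norm (h x))\<^sup>2) \<le> C i"
    using theta_data_H1[OF D] by blast
  have "9 * pi\<^sup>2 / 4 \<le> C i"
    using loop_bending_ge[OF h(1) theta_dataD(3)[OF D] loop] h(2) by linarith
  then have "(3 * pi / 2)\<^sup>2 \<le> C i" by (simp add: power2_eq_square)
  moreover have "2 * (3 * pi / 2) * L i \<le> (3 * pi / 2)\<^sup>2 + (L i)\<^sup>2" by (rule sum_squares_bound)
  ultimately have "3 * pi * L i \<le> C i + L i * L i" by (simp add: power2_eq_square)
  then have "3 * pi \<le> (C i + L i * L i) / L i" using L by (simp add: le_divide_eq)
  then show ?thesis using L by (simp add: add_divide_distrib)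
qed

lemma constant_tangent:
  assumes D: "theta_data \<tau> L C" and C: "C i = 0"
  shows "integral {0..1} (\<tau> i) = \<tau> i 0"
proof -
  have c: "\<tau> i x = \<tau> i 0" if "x \<in> {0..1}" for x
    using theta_data_Hoelder[OF D, of 0 x i] that C by simp
  have "integral {0..1} (\<tau> i) = integral {0..1::real} (\<lambda>_. \<tau> i 0)" by (intro integral_cong c)
  then show ?thesis by simp
qed

text \<open>If a curve shrinks to a point, then its tangent becomes constant. Two shrinking curves would have almost
  parallel chords at angle \<open>2\<pi>/3\<close>, so the other two curves survive, as loops, and the energy is at least \<open>6\<pi>\<close>.\<close>
lemma theta_data_limit_nondegenerate:
  fixes \<tau> :: "nat \<Rightarrow> 3 \<Rightarrow> real \<Rightarrow> 'a::euclidean_space"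
  assumes D: "\<And>k. theta_data (\<tau> k) (L k) (C k)" and pos: "\<And>k i. 0 < L k i"
    and D': "theta_data \<tau>' L' C'" and limL: "\<And>i. (\<lambda>k. L k i) \<longlonglongrightarrow> L' i" and limC: "\<And>i. (\<lambda>k. C k i) \<longlonglongrightarrow> C' i"
    and limI: "\<And>i. (\<lambda>k. integral {0..1} (\<tau> k i)) \<longlonglongrightarrow> integral {0..1} (\<tau>' i)"
    and E: "(\<lambda>k. data_energy (L k) (C k)) \<longlonglongrightarrow> m" and bE: "\<And>k. data_energy (L k) (C k) \<le> B" and m: "m < 6 * pi"
  shows "0 < L' i"
proof (rule ccontr)
  note d = theta_dataD[OF D] and d' = theta_dataD[OF D']
  assume "\<not> 0 < L' i"
  then have Li: "L' i = 0" using d'(1)[of i] by linarith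
  have term_nonneg: "0 \<le> C k j / L k j + L k j" for k j
    using d(7)[of k j] pos[of k j] by (intro add_nonneg_nonneg divide_nonneg_nonneg) auto
  have Czero: "C' j = 0" if "L' j = 0" for j
  proof -
    \<comment> \<open>Bounded energy controls C by the length, so a vanishing length forces a
      vanishing Dirichlet bound in the limit.\<close>
    have "C k j \<le> B * L k j" for k
    proof -
      have "C k j / L k j \<le> C k j / L k j + L k j" using pos[of k j] by simp
      also have "\<dots> \<le> data_energy (L k) (C k)"
        unfolding data_energy_def using term_nonneg by (intro member_le_sum) auto
      also have "\<dots> \<le> B" by (rule bE)
      finally show ?thesis using pos[of k j] by (simp add: divide_le_eq)
    qed
    then have "C' j \<le> B * L' j" by (intro LIMSEQ_le[OF limC tendsto_mult_left[OF limL]]) auto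
    then show ?thesis using that d'(7)[of j] by simp
  qed
  have other: "0 < L' j" if j: "j \<noteq> i" for j
  proof (rule ccontr)
    assume "\<not> 0 < L' j"
    then have "L' j = 0" using d'(1)[of j] by linarith
    then have "integral {0..1} (\<tau>' i) \<bullet> integral {0..1} (\<tau>' j) = - 1 / 2"
      using constant_tangent[OF D' Czero] Li d'(6)[of i j] j by auto
    moreover have "(\<lambda>k. integral {0..1} (\<tau> k i) \<bullet> integral {0..1} (\<tau> k j)) \<longlonglongrightarrow>
      integral {0..1} (\<tau>' i) \<bullet> integral {0..1} (\<tau>' j)" by (intro tendsto_intros limI)
    ultimately have "\<forall>\<^sub>F k in sequentially. integral {0..1} (\<tau> k i) \<bullet> integral {0..1} (\<tau> k j) < 0"
      by (intro order_tendstoD) auto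
    then obtain k where k: "integral {0..1} (\<tau> k i) \<bullet> integral {0..1} (\<tau> k j) < 0"
      using eventually_happens' sequentially_bot by blast
    \<comment> \<open>Chords i and j have the same displacement, hence the two mean tangents are
      positive multiples of a common vector and cannot have a negative inner product.\<close>
    have "L k i * (integral {0..1} (\<tau> k i) \<bullet> integral {0..1} (\<tau> k i))
      = integral {0..1} (\<tau> k i) \<bullet> (L k i *\<^sub>R integral {0..1} (\<tau> k i))" by simp
    also have "\<dots> = L k j * (integral {0..1} (\<tau> k i) \<bullet> integral {0..1} (\<tau> k j))"
      unfolding d(5)[of k i j] by simp
    also have "\<dots> < 0" using k pos[of k j] by (simp add: mult_pos_neg)
    finally show False
      using pos[of k i] inner_ge_zero[of "integral {0..1} (\<tau> k i)"] by (simp add: mult_less_0_iff)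
  qed
  have loop: "3 * pi \<le> C' j / L' j + L' j" if j: "j \<noteq> i" for j
  proof (rule loop_energy_ge[OF D' other[OF j]])
    show "integral {0..1} (\<tau>' j) = 0" using d'(5)[of j i] Li other[OF j] by simp
  qed
  \<comment> \<open>The shrinking curve is dropped before the limit, since its quotient C / L need
    not converge; its term is nonnegative.\<close>
  have "(\<Sum>j\<in>UNIV - {i}. C' j / L' j + L' j) \<le> m"
  proof (rule LIMSEQ_le[OF _ E])
    show "(\<lambda>k. \<Sum>j\<in>UNIV - {i}. C k j / L k j + L k j) \<longlonglongrightarrow> (\<Sum>j\<in>UNIV - {i}. C' j / L' j + L' j)"
      using other by (intro tendsto_intros limL limC) force
    show "\<exists>N. \<forall>k\<ge>N. (\<Sum>j\<in>UNIV - {i}. C k j / L k j + L k j) \<le> data_energy (L k) (C k)"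
      unfolding data_energy_def using term_nonneg by (intro exI allI impI sum_mono2) auto
  qed
  moreover have "(\<Sum>j\<in>UNIV - {i}. 3 * pi) \<le> (\<Sum>j\<in>UNIV - {i}. C' j / L' j + L' j)"
    using loop by (intro sum_mono) auto
  moreover have "(\<Sum>j\<in>UNIV - {i}. 3 * pi) = 6 * pi" by (simp add: card_Diff_singleton)
  ultimately show False using m by linarith
qed

section \<open>The direct method\<close>

lemma theta_data_minimizer:
  fixes \<tau>0 :: "3 \<Rightarrow> real \<Rightarrow> 'a::euclidean_space"
  assumes D0: "theta_data \<tau>0 L0 C0" "\<And>i. 0 < L0 i" "data_energy L0 C0 < 6 * pi"
  obtains \<tau> :: "3 \<Rightarrow> real \<Rightarrow> 'a" and L C where "theta_data \<tau> L C" "\<And>i. 0 < L i"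
    "\<And>(\<tau>' :: 3 \<Rightarrow> real \<Rightarrow> 'a) L' C'. theta_data \<tau>' L' C' \<Longrightarrow> (\<And>i. 0 < L' i) \<Longrightarrow> data_energy L C \<le> data_energy L' C'"
proof -
  define S where "S = {data_energy L C |(\<tau> :: 3 \<Rightarrow> real \<Rightarrow> 'a) L C. theta_data \<tau> L C \<and> (\<forall>i. 0 < L i)}"
  have memS: "data_energy L C \<in> S" if "theta_data \<tau> L C" "\<And>i. 0 < L i" for \<tau> :: "3 \<Rightarrow> real \<Rightarrow> 'a" and L C
    using that unfolding S_def by blast
  have nonneg: "0 \<le> C i / L i + L i" if "theta_data \<tau> L C" for \<tau> :: "3 \<Rightarrow> real \<Rightarrow> 'a" and L C i
    using theta_dataD(1,7)[OF that] by (intro add_nonneg_nonneg divide_nonneg_nonneg)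
  have bdd: "bdd_below S"
    unfolding S_def data_energy_def by (rule bdd_belowI[of _ 0]) (auto intro!: sum_nonneg nonneg)
  have ne: "S \<noteq> {}" using memS[OF D0(1,2)] by blast
  define m where "m = Inf S"
  have m_le: "m \<le> data_energy L C" if "theta_data \<tau> L C" "\<And>i. 0 < L i" for \<tau> :: "3 \<Rightarrow> real \<Rightarrow> 'a" and L C
    unfolding m_def by (rule cInf_lower[OF memS bdd]) (use that in auto)
  have m6: "m < 6 * pi" using m_le[OF D0(1,2)] D0(3) by linarith
  let ?Q = "\<lambda>k t. theta_data (fst t :: 3 \<Rightarrow> real \<Rightarrow> 'a) (fst (snd t)) (snd (snd t)) \<and> (\<forall>i. 0 < fst (snd t) i) \<and>
    data_energy (fst (snd t)) (snd (snd t)) < m + 1 / real (Suc k)"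
  have "\<exists>t. ?Q k t" for k
  proof -
    have "Inf S < m + 1 / real (Suc k)" by (simp add: m_def)
    then obtain e where "e \<in> S" "e < m + 1 / real (Suc k)" using cInf_lessD[OF ne] by blast
    then show ?thesis unfolding S_def by auto
  qed
  then obtain t where t: "\<And>k. ?Q k (t k)" using choice[of ?Q] by blast
  define \<tau> L C where "\<tau> k = fst (t k)" and "L k = fst (snd (t k))" and "C k = snd (snd (t k))" for k
  have D: "theta_data (\<tau> k) (L k) (C k)" and pos: "0 < L k i" and
    E: "data_energy (L k) (C k) < m + 1 / real (Suc k)" for k i
    using t[of k] by (auto simp: \<tau>_def L_def C_def)
  define B where "B = m + 1"
  have bE: "data_energy (L k) (C k) \<le> B" for k
  proof -
    have "1 / real (Suc k) \<le> 1" by simp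
    then show ?thesis using E[of k] unfolding B_def by linarith
  qed
  have bterm: "C k i / L k i + L k i \<le> B" for k i
  proof -
    have "C k i / L k i + L k i \<le> data_energy (L k) (C k)"
      unfolding data_energy_def using nonneg[OF D] by (intro member_le_sum) auto
    then show ?thesis using bE[of k] by linarith
  qed
  have C0: "0 \<le> C k i" for k i using theta_dataD(7)[OF D] .
  \<comment> \<open>Bounded energy bounds L directly, and then C by B L, which is at most
    B^2.\<close>
  have LB: "L k i \<le> B" for k i
    using bterm[of k i] divide_nonneg_pos[OF C0 pos, of k i k i] by linarith
  have CB: "C k i \<le> B * B" for k i
  proof -
    have "C k i / L k i \<le> B" using bterm[of k i] pos[of k i] by linarith
    then have "C k i \<le> B * L k i" using pos[of k i] by (simp add: divide_le_eq)
    also have "\<dots> \<le> B * B" using LB[of k i] pos[of k i] by (intro mult_left_mono) auto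
    finally show ?thesis .
  qed
  obtain r \<tau>' L' C' where r: "strict_mono r" and D': "theta_data \<tau>' L' C'"
    and limL: "\<And>i. (\<lambda>k. L (r k) i) \<longlonglongrightarrow> L' i" and limC: "\<And>i. (\<lambda>k. C (r k) i) \<longlonglongrightarrow> C' i"
    and limI: "\<And>i. (\<lambda>k. integral {0..1} (\<tau> (r k) i)) \<longlonglongrightarrow> integral {0..1} (\<tau>' i)"
    by (rule theta_data_compact[of \<tau> L C "max B (B * B)", OF D]) (use LB CB in \<open>auto simp: le_max_iff_disj\<close>)
  have limE: "(\<lambda>k. data_energy (L k) (C k)) \<longlonglongrightarrow> m"
  proof (rule tendsto_sandwich[of "\<lambda>_. m" _ _ "\<lambda>k. m + 1 / real (Suc k)"])
    show "\<forall>\<^sub>F k in sequentially. m \<le> data_energy (L k) (C k)" using m_le[OF D pos] by simp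
    show "\<forall>\<^sub>F k in sequentially. data_energy (L k) (C k) \<le> m + 1 / real (Suc k)"
      using E by (simp add: less_imp_le)
    show "(\<lambda>k. m + 1 / real (Suc k)) \<longlonglongrightarrow> m"
      using tendsto_add[OF tendsto_const[of m] LIMSEQ_inverse_real_of_nat] by (simp add: inverse_eq_divide)
  qed simp
  have limE': "(\<lambda>k. data_energy (L (r k)) (C (r k))) \<longlonglongrightarrow> m"
    using LIMSEQ_subseq_LIMSEQ[OF limE r] by (simp add: o_def)
  have pos': "0 < L' i" for i
    by (rule theta_data_limit_nondegenerate[OF D pos D' limL limC limI limE' bE m6])
  have "(\<lambda>k. data_energy (L (r k)) (C (r k))) \<longlonglongrightarrow> data_energy L' C'"
    unfolding data_energy_def using pos' by (intro tendsto_intros limL limC) (simp add: less_imp_neq[symmetric])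
  then have "data_energy L' C' = m" using limE' LIMSEQ_unique by blast
  then show thesis using that[OF D' pos'] m_le by simp
qed

theorem theorem5p1:
  assumes "CARD('n::finite) \<ge> 2"
  shows "\<exists>\<Gamma>bar \<in> (Theta_networks :: (3 \<Rightarrow> real \<Rightarrow> real ^ 'n) set).
           energy \<Gamma>bar = (INF \<Gamma> \<in> (Theta_networks :: (3 \<Rightarrow> real \<Rightarrow> real ^ 'n) set). energy \<Gamma>)"
proof -
  obtain a b :: 'n where ab: "a \<noteq> b"
  proof -
    have "\<not> is_singleton (UNIV :: 'n set)" using assms by (auto simp: is_singleton_altdef)
    then show thesis using that by (metis UNIV_I UNIV_eq_I is_singletonI' empty_not_UNIV)
  qed
  \<comment> \<open>The double bubble is planar; two coordinate axes span its plane, and this is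
    where n >= 2 enters.\<close>
  have "norm (axis a 1 :: real ^ 'n) = 1" "norm (axis b 1 :: real ^ 'n) = 1"
    "(axis a 1 :: real ^ 'n) \<bullet> axis b 1 = 0"
    using ab by (auto simp: inner_axis_axis)
  then obtain \<tau>0 :: "3 \<Rightarrow> real \<Rightarrow> real ^ 'n" and L0 C0
    where "theta_data \<tau>0 L0 C0" "\<And>i. 0 < L0 i" "data_energy L0 C0 < 6 * pi"
    by (rule double_bubble_data) blast
  note D0 = this
  obtain \<tau> :: "3 \<Rightarrow> real \<Rightarrow> real ^ 'n" and L C where D: "theta_data \<tau> L C" "\<And>i. 0 < L i"
    and min: "\<And>(\<tau>' :: 3 \<Rightarrow> real \<Rightarrow> real ^ 'n) L' C'. theta_data \<tau>' L' C' \<Longrightarrow> (\<And>i. 0 < L' i) \<Longrightarrow>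
      data_energy L C \<le> data_energy L' C'"
    by (rule theta_data_minimizer[OF D0]) blast
  obtain \<Gamma>bar :: "3 \<Rightarrow> real \<Rightarrow> real ^ 'n" where G: "\<Gamma>bar \<in> Theta_networks" "energy \<Gamma>bar \<le> ennreal (data_energy L C)"
    by (rule theta_network_of_data[OF D])
  have "energy \<Gamma>bar \<le> energy \<Gamma>" if \<Gamma>: "\<Gamma> \<in> Theta_networks" for \<Gamma> :: "3 \<Rightarrow> real \<Rightarrow> real ^ 'n"
  proof -
    obtain \<tau>' :: "3 \<Rightarrow> real \<Rightarrow> real ^ 'n" and L' C' where
      D': "theta_data \<tau>' L' C'" "\<And>i. 0 < L' i" and e: "energy \<Gamma> = ennreal (data_energy L' C')"
      by (rule theta_network_data[OF \<Gamma>]) blast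
    have "ennreal (data_energy L C) \<le> ennreal (data_energy L' C')" by (rule ennreal_leI[OF min[OF D']])
    then show ?thesis using G(2) e by simp
  qed
  then have "energy \<Gamma>bar = (INF \<Gamma> \<in> (Theta_networks :: (3 \<Rightarrow> real \<Rightarrow> real ^ 'n) set). energy \<Gamma>)"
    by (intro antisym INF_greatest INF_lower[OF G(1)])
  then show ?thesis using G(1) by blast
qed

end
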